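(* Let $\Omega=(\mathbf{R}^{d_1}\setminus\{0\})\times\mathbf{R}^{d_2}$, write $x=(x_1,x_2)$ with $x_1\in\mathbf{R}^{d_1}$, $x_2\in\mathbf{R}^{d_2}$, so $d_\Omega(x)=|x_1|$. Let $\delta,\delta'\geq0$, $c(s)=s^\delta(1+s)^{\delta'-\delta}$ for $s>0$, $c_\Omega=c\circ d_\Omega$, and let $H$ be the submarkovian operator on $L_2(\Omega)$ corresponding to the Grushin form $h$ defined in the context. (a) Assume $\delta+\delta'\leq4$. If $d_1+2(\delta\wedge\delta')-4>0$ then the Rellich inequality $$(H\varphi,H\varphi)\geq a_2\,(c_\Omega d_\Omega^{-2}\varphi,\,c_\Omega d_\Omega^{-2}\varphi)$$ is valid for all $\varphi\in D(H)$ with $a_2=d_1^2(d_1+2(\delta\wedge\delta')-4)^2/16$. The value of $a_2$ is optimal. (b) Assume $\delta+\delta'\geq4$. If $d_1-|\delta-\delta'|>0$ then the Rellich inequality $$(H\varphi,H\varphi)\geq a_2\,(c_\Omega d_\Omega^{-2}\varphi,\,c_\Omega d_\Omega^{-2}\varphi)$$ is valid for all $\varphi\in D(H)$ with $a_2=(d_1-|\delta-\delta'|)^2(d_1+\delta+\delta'-4)^2/16$.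
   Context: $L_2(\Omega)$ is the real $L_2$-space with respect to Lebesgue measure, with inner product $(\cdot,\cdot)$. The form $h$ is the closure of $$\varphi\in C_c^\infty(\Omega)\mapsto h(\varphi)=(\nabla_{x_1}\varphi,c_\Omega\,\nabla_{x_1}\varphi)+(\nabla_{x_2}\varphi,b\,\nabla_{x_2}\varphi),$$ where $b$ is the operator of multiplication by a positive bounded (measurable) function of the variable $x_1$ only. $H$ is the positive self-adjoint operator associated with $h$ ($D(h)=D(H^{1/2})$, $h(\varphi)=\|H^{1/2}\varphi\|_2^2$). $\wedge$ denotes minimum. "Optimal" means that $a_2$ is the largest constant for which the inequality holds for all $\varphi\in D(H)$. *)

theory Defs
  imports "HOL-Analysis.Analysis"
begin

section \<open>Real L2-spaces\<close>

text \<open>Elements of the L2-space are represented by functions; all notions below are invariant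
  under change on null sets of the measure.\<close>

definition L2 :: "'x measure \<Rightarrow> ('x \<Rightarrow> real) set" where
  "L2 M = {f \<in> borel_measurable M. integrable M (\<lambda>x. (f x)\<^sup>2)}"

definition l2_inner :: "'x measure \<Rightarrow> ('x \<Rightarrow> real) \<Rightarrow> ('x \<Rightarrow> real) \<Rightarrow> real" where
  "l2_inner M f g = (\<integral>x. f x * g x \<partial>M)"

definition l2_norm :: "'x measure \<Rightarrow> ('x \<Rightarrow> real) \<Rightarrow> real" where
  "l2_norm M f = sqrt (l2_inner M f f)"


section \<open>Unbounded operators\<close>

text \<open>An operator is given by its graph, a set of pairs of representatives.\<close>

definition densely_defined :: "'x measure \<Rightarrow> (('x \<Rightarrow> real) \<times> ('x \<Rightarrow> real)) set \<Rightarrow> bool" where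
  "densely_defined M T \<longleftrightarrow>
     (\<forall>f\<in>L2 M. \<forall>e>0. \<exists>g\<in>Domain T \<inter> L2 M. l2_norm M (\<lambda>x. f x - g x) < e)"

definition adjoint_graph ::
    "'x measure \<Rightarrow> (('x \<Rightarrow> real) \<times> ('x \<Rightarrow> real)) set \<Rightarrow> (('x \<Rightarrow> real) \<times> ('x \<Rightarrow> real)) set" where
  "adjoint_graph M T =
     {(f, g). f \<in> L2 M \<and> g \<in> L2 M \<and> (\<forall>(u, v)\<in>T. l2_inner M v f = l2_inner M u g)}"

text \<open>The adjoint of a densely defined graph is linear, single-valued modulo null sets, and
  closed under almost everywhere equality in both components. Hence so is every graph
  satisfying the following predicate.\<close>

definition self_adjoint_op :: "'x measure \<Rightarrow> (('x \<Rightarrow> real) \<times> ('x \<Rightarrow> real)) set \<Rightarrow> bool" where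
  "self_adjoint_op M T \<longleftrightarrow> densely_defined M T \<and> T = adjoint_graph M T"

definition positive_self_adjoint :: "'x measure \<Rightarrow> (('x \<Rightarrow> real) \<times> ('x \<Rightarrow> real)) set \<Rightarrow> bool" where
  "positive_self_adjoint M T \<longleftrightarrow>
     self_adjoint_op M T \<and> (\<forall>(f, g)\<in>T. 0 \<le> l2_inner M f g)"


section \<open>Closure of a quadratic form and the associated operator\<close>

text \<open>The closure of the form \<open>q\<close> with domain \<open>D\<close>, as the graph of the map
  \<open>\<phi> \<mapsto> h(\<phi>)\<close>; the domain of the closed form is the domain of this graph.\<close>

definition form_closure ::
    "'x measure \<Rightarrow> ('x \<Rightarrow> real) set \<Rightarrow> (('x \<Rightarrow> real) \<Rightarrow> real) \<Rightarrow> (('x \<Rightarrow> real) \<times> real) set" where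
  "form_closure M D q =
     {(\<phi>, r). \<phi> \<in> L2 M \<and>
        (\<exists>u :: nat \<Rightarrow> 'x \<Rightarrow> real.
            (\<forall>n. u n \<in> D) \<and>
            (\<lambda>n. l2_norm M (\<lambda>x. u n x - \<phi> x)) \<longlonglongrightarrow> 0 \<and>
            (\<forall>e>0. \<exists>N. \<forall>m\<ge>N. \<forall>n\<ge>N. q (\<lambda>x. u m x - u n x) < e) \<and>
            (\<lambda>n. q (u n)) \<longlonglongrightarrow> r)}"

text \<open>\<open>H\<close> is the positive self-adjoint operator associated with the closed form \<open>h\<close>:
  with \<open>S\<close> the positive self-adjoint square root of \<open>H\<close>, the domain of \<open>h\<close> is that of
  \<open>S\<close>, and the value of \<open>h\<close> at \<open>\<phi>\<close> is the square of the norm of \<open>S \<phi>\<close>.\<close>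

definition associated_operator ::
    "'x measure \<Rightarrow> (('x \<Rightarrow> real) \<times> real) set \<Rightarrow> (('x \<Rightarrow> real) \<times> ('x \<Rightarrow> real)) set \<Rightarrow> bool" where
  "associated_operator M h H \<longleftrightarrow>
     positive_self_adjoint M H \<and>
     (\<exists>S. positive_self_adjoint M S \<and> S O S = H \<and>
          h = {(\<phi>, (l2_norm M \<psi>)\<^sup>2) | \<phi> \<psi>. (\<phi>, \<psi>) \<in> S})"


section \<open>Test functions and partial gradients\<close>

primrec Ck :: "nat \<Rightarrow> ('x::euclidean_space \<Rightarrow> real) \<Rightarrow> bool" where
  "Ck 0 f \<longleftrightarrow> continuous_on UNIV f"
| "Ck (Suc k) f \<longleftrightarrow>
     (\<forall>x. f differentiable (at x)) \<and> (\<forall>v. Ck k (\<lambda>x. frechet_derivative f (at x) v))"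

text \<open>Test functions on \<open>\<Omega>\<close> are extended by zero to the whole space.\<close>

definition test_functions :: "'x::euclidean_space set \<Rightarrow> ('x \<Rightarrow> real) set" where
  "test_functions \<Omega> =
     {\<phi>. (\<forall>k. Ck k \<phi>) \<and> compact (closure {x. \<phi> x \<noteq> 0}) \<and> closure {x. \<phi> x \<noteq> 0} \<subseteq> \<Omega>}"

definition gradient :: "('x::euclidean_space \<Rightarrow> real) \<Rightarrow> 'x \<Rightarrow> 'x" where
  "gradient f x = (\<Sum>i\<in>Basis. frechet_derivative f (at x) i *\<^sub>R i)"

definition gradient1 ::
    "('a::euclidean_space \<times> 'b::euclidean_space \<Rightarrow> real) \<Rightarrow> 'a \<times> 'b \<Rightarrow> 'a" where
  "gradient1 \<phi> x = gradient (\<lambda>y. \<phi> (y, snd x)) (fst x)"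

definition gradient2 ::
    "('a::euclidean_space \<times> 'b::euclidean_space \<Rightarrow> real) \<Rightarrow> 'a \<times> 'b \<Rightarrow> 'b" where
  "gradient2 \<phi> x = gradient (\<lambda>y. \<phi> (fst x, y)) (snd x)"


section \<open>The Grushin form\<close>

definition Omega :: "('a::euclidean_space \<times> 'b::euclidean_space) set" where
  "Omega = (- {0}) \<times> UNIV"

definition d_Omega :: "'a::euclidean_space \<times> 'b::euclidean_space \<Rightarrow> real" where
  "d_Omega x = infdist x (frontier Omega)"

lemma frontier_Omega:
  "frontier (Omega :: ('a::euclidean_space \<times> 'b::euclidean_space) set) = {0} \<times> UNIV"
proof -
  have "interior (- {0::'a}) = - {0}"
    by (intro interior_open open_Compl closed_singleton)
  moreover have "closure (- {0::'a}) = UNIV"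
    by (simp add: closure_complement interior_singleton)
  ultimately show ?thesis
    unfolding frontier_def Omega_def by (auto simp: closure_Times interior_Times)
qed

lemma d_Omega_eq: "d_Omega x = norm (fst x)"
proof (rule antisym)
  have "d_Omega x \<le> dist x (0, snd x)"
    unfolding d_Omega_def frontier_Omega by (rule infdist_le) simp
  then show "d_Omega x \<le> norm (fst x)"
    by (cases x) (simp add: dist_norm norm_Pair)
  show "norm (fst x) \<le> d_Omega x"
    unfolding d_Omega_def frontier_Omega infdist_def
  proof (auto intro!: cINF_greatest)
    fix b show "norm (fst x) \<le> dist x (0, b)"
      using dist_fst_le[of x "(0, b)"] by simp
  qed
qed

definition c_fun :: "real \<Rightarrow> real \<Rightarrow> real \<Rightarrow> real" where
  "c_fun \<delta> \<delta>' s = s powr \<delta> * (1 + s) powr (\<delta>' - \<delta>)"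

definition c_Omega :: "real \<Rightarrow> real \<Rightarrow> 'a::euclidean_space \<times> 'b::euclidean_space \<Rightarrow> real" where
  "c_Omega \<delta> \<delta>' x = c_fun \<delta> \<delta>' (d_Omega x)"

definition grushin_form ::
    "real \<Rightarrow> real \<Rightarrow> ('a::euclidean_space \<Rightarrow> real) \<Rightarrow> ('a \<times> 'b::euclidean_space \<Rightarrow> real) \<Rightarrow> real" where
  "grushin_form \<delta> \<delta>' b \<phi> =
     (\<integral>x. gradient1 \<phi> x \<bullet> (c_Omega \<delta> \<delta>' x *\<^sub>R gradient1 \<phi> x) \<partial>lebesgue_on Omega) +
     (\<integral>x. gradient2 \<phi> x \<bullet> (b (fst x) *\<^sub>R gradient2 \<phi> x) \<partial>lebesgue_on Omega)"

definition grushin_operator ::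
    "real \<Rightarrow> real \<Rightarrow> ('a::euclidean_space \<Rightarrow> real) \<Rightarrow>
     (('a \<times> 'b::euclidean_space \<Rightarrow> real) \<times> ('a \<times> 'b \<Rightarrow> real)) set \<Rightarrow> bool" where
  "grushin_operator \<delta> \<delta>' b H \<longleftrightarrow>
     associated_operator (lebesgue_on Omega)
       (form_closure (lebesgue_on Omega) (test_functions Omega) (grushin_form \<delta> \<delta>' b)) H"


section \<open>The Rellich inequality\<close>

definition rellich_weight :: "real \<Rightarrow> real \<Rightarrow> 'a::euclidean_space \<times> 'b::euclidean_space \<Rightarrow> real" where
  "rellich_weight \<delta> \<delta>' x = c_Omega \<delta> \<delta>' x * d_Omega x powr (-2)"

text \<open>The membership in the L2-space is part of the inequality: without it the integral on
  the right, which is then infinite, would be read as \<open>0\<close>.\<close>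

definition rellich_inequality ::
    "real \<Rightarrow> real \<Rightarrow> (('a::euclidean_space \<times> 'b::euclidean_space \<Rightarrow> real) \<times> ('a \<times> 'b \<Rightarrow> real)) set
     \<Rightarrow> real \<Rightarrow> bool" where
  "rellich_inequality \<delta> \<delta>' H a \<longleftrightarrow>
     (\<forall>(\<phi>, H\<phi>)\<in>H.
        (\<lambda>x. rellich_weight \<delta> \<delta>' x * \<phi> x) \<in> L2 (lebesgue_on Omega) \<and>
        l2_inner (lebesgue_on Omega) H\<phi> H\<phi> \<ge>
          a * l2_inner (lebesgue_on Omega)
                (\<lambda>x. rellich_weight \<delta> \<delta>' x * \<phi> x) (\<lambda>x. rellich_weight \<delta> \<delta>' x * \<phi> x))"

end

(*
  Put r = |x1|, n = d1, s = r c'/c and chi = c/r^2. Pairing H phi with w phi, for a bounded radial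
  weight w, leaves the form h(phi, w phi), whose x2-part is nonnegative because w depends on x1 only.
  Completing the square in its x1-part as in Hardy's inequality, with (n - 2 + s)/2 as the
  coefficient of the radial field, bounds it below by the integral of chi w phi^2 times
    ((n - 2 + s)^2 - sigma^2)/4 + r s'/2,    sigma = r w'/w.
  The regularisation w = chi/(1 + eps chi^2) is bounded, maps the form domain to itself and satisfies
  |sigma| <= |s - 2|. Hence the factor dominates n(n + 2s - 4)/4 + r s'/2, which is at least
  A = n(n + 2 min(delta, delta') - 4)/4 everywhere. As w <= chi this yields
  A |w phi|^2 <= (H phi, w phi), so A |w phi| <= |H phi|, and eps tends to 0. If delta + delta' >= 4,
  the constant in (b) is at most A^2.

  Test functions belong to D(H). For the optimality H is applied to r^(-(n + 2 mu - 4)/2) zeta(ln r) g(x2),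
  mu = min(delta, delta'), with zeta a long plateau placed far towards the end of the half-line
  where c behaves as r^mu, and g a wide cutoff. H acts there as A chi up to errors that are of lower
  order in the length of the plateau.
*)
theory Submission
  imports Defs
begin

section \<open>L2-spaces and self-adjoint graphs\<close>

text \<open>Elements of D(H) carry no regularity that could be used directly: H is reached only
  through a square root S whose graph encodes the closed form. Pairings with H phi are therefore
  limits of pairings of test functions u_n, and the multiplier w must keep the forms h(w u_n)
  bounded along the whole sequence. This, and not only the boundedness of w, dictates the shape of
  the regularisation. In the optimality argument the exponent is the one for which the square of chi
  r^(-(n + 2 mu - 4)/2) is comparable to r^(-n), a density with equal mass on all shells of unit
  length in ln r. With a plateau of length N and a cutoff of width R in x2, the weighted norm
  squared has order N R^d2 and the edges of the plateau cost only R^d2. The x2-derivatives cost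
  R^(d2 - 4) with a factor that depends on N without control. So R tends to infinity first, then
  N.\<close>

lemma L2_measurable: "f \<in> L2 M \<Longrightarrow> f \<in> borel_measurable M"
  and L2_integrable_square: "f \<in> L2 M \<Longrightarrow> integrable M (\<lambda>x. (f x)\<^sup>2)"
  by (auto simp: L2_def)

lemma L2_integrable_mult:
  assumes "f \<in> L2 M" "g \<in> L2 M"
  shows "integrable M (\<lambda>x. f x * g x)"
proof (rule Bochner_Integration.integrable_bound)
  show "integrable M (\<lambda>x. (f x)\<^sup>2 + (g x)\<^sup>2)"
    using assms by (auto simp: L2_def)
  show "(\<lambda>x. f x * g x) \<in> borel_measurable M"
    using assms by (auto simp: L2_def)
  have "\<bar>a * b\<bar> \<le> a\<^sup>2 + b\<^sup>2" for a b :: real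
  proof -
    have "2 * \<bar>a * b\<bar> \<le> a\<^sup>2 + b\<^sup>2"
      using sum_squares_bound[of "\<bar>a\<bar>" "\<bar>b\<bar>"] by (simp add: abs_mult)
    then show ?thesis by (smt (verit) zero_le_power2)
  qed
  then show "AE x in M. norm (f x * g x) \<le> norm ((f x)\<^sup>2 + (g x)\<^sup>2)"
    by simp
qed

lemma L2_add: assumes "f \<in> L2 M" "g \<in> L2 M" shows "(\<lambda>x. f x + g x) \<in> L2 M"
  using assms L2_integrable_mult[OF assms] by (auto simp: L2_def power2_sum mult.assoc)

lemma L2_cmult: assumes "f \<in> L2 M" shows "(\<lambda>x. c * f x) \<in> L2 M"
  using assms by (auto simp: L2_def power_mult_distrib)

lemma L2_diff: assumes "f \<in> L2 M" "g \<in> L2 M" shows "(\<lambda>x. f x - g x) \<in> L2 M"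
  using L2_add[OF assms(1) L2_cmult[OF assms(2), of "-1"]] by simp

lemma L2_mult_bounded:
  assumes f: "f \<in> L2 M" and w: "w \<in> borel_measurable M" and C: "\<And>x. x \<in> space M \<Longrightarrow> \<bar>w x\<bar> \<le> C"
  shows "(\<lambda>x. w x * f x) \<in> L2 M"
proof -
  have "integrable M (\<lambda>x. (w x * f x)\<^sup>2)"
  proof (rule Bochner_Integration.integrable_bound)
    show "integrable M (\<lambda>x. C\<^sup>2 * (f x)\<^sup>2)"
      using f by (auto simp: L2_def)
    show "(\<lambda>x. (w x * f x)\<^sup>2) \<in> borel_measurable M"
      using f w by (auto simp: L2_def)
    show "AE x in M. norm ((w x * f x)\<^sup>2) \<le> norm (C\<^sup>2 * (f x)\<^sup>2)"
    proof (intro AE_I2)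
      fix x assume "x \<in> space M"
      then have "(w x)\<^sup>2 \<le> C\<^sup>2" using C[of x] by (metis abs_ge_zero power2_abs power_mono)
      then show "norm ((w x * f x)\<^sup>2) \<le> norm (C\<^sup>2 * (f x)\<^sup>2)"
        by (simp add: power_mult_distrib mult_right_mono)
    qed
  qed
  with f w show ?thesis by (auto simp: L2_def)
qed

lemma l2_inner_commute: "l2_inner M f g = l2_inner M g f"
  by (simp add: l2_inner_def mult.commute)

lemma l2_inner_add_left:
  "f \<in> L2 M \<Longrightarrow> g \<in> L2 M \<Longrightarrow> k \<in> L2 M \<Longrightarrow> l2_inner M (\<lambda>x. f x + g x) k = l2_inner M f k + l2_inner M g k"
  by (simp add: l2_inner_def distrib_right L2_integrable_mult)

lemma l2_inner_diff_left:
  "f \<in> L2 M \<Longrightarrow> g \<in> L2 M \<Longrightarrow> k \<in> L2 M \<Longrightarrow> l2_inner M (\<lambda>x. f x - g x) k = l2_inner M f k - l2_inner M g k"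
  by (simp add: l2_inner_def left_diff_distrib L2_integrable_mult)

lemma l2_inner_cmult_left: "l2_inner M (\<lambda>x. c * f x) k = c * l2_inner M f k"
  by (simp add: l2_inner_def mult.assoc)

lemma l2_inner_add_right:
  "f \<in> L2 M \<Longrightarrow> g \<in> L2 M \<Longrightarrow> k \<in> L2 M \<Longrightarrow> l2_inner M k (\<lambda>x. f x + g x) = l2_inner M k f + l2_inner M k g"
  by (simp only: l2_inner_commute[of M k] l2_inner_add_left)

lemma l2_inner_diff_right:
  "f \<in> L2 M \<Longrightarrow> g \<in> L2 M \<Longrightarrow> k \<in> L2 M \<Longrightarrow> l2_inner M k (\<lambda>x. f x - g x) = l2_inner M k f - l2_inner M k g"
  by (simp only: l2_inner_commute[of M k] l2_inner_diff_left)

lemma l2_inner_cmult_right: "l2_inner M k (\<lambda>x. c * f x) = c * l2_inner M k f"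
  by (simp only: l2_inner_commute[of M k] l2_inner_cmult_left)

lemma l2_inner_self_nonneg: "0 \<le> l2_inner M f f"
  by (simp add: l2_inner_def)

lemma l2_norm_nonneg: "0 \<le> l2_norm M f"
  by (simp add: l2_norm_def l2_inner_self_nonneg)

lemma l2_norm_power2: "(l2_norm M f)\<^sup>2 = l2_inner M f f"
  by (simp add: l2_norm_def l2_inner_self_nonneg)

text \<open>Functions are representatives, so \<open>l2_norm\<close> also vanishes on null
  functions; the discriminant argument uses only that the inner product is semidefinite.\<close>

lemma l2_Cauchy_Schwarz:
  assumes f: "f \<in> L2 M" and g: "g \<in> L2 M"
  shows "\<bar>l2_inner M f g\<bar> \<le> l2_norm M f * l2_norm M g"
proof -
  let ?a = "l2_inner M f f" and ?b = "l2_inner M f g" and ?c = "l2_inner M g g"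
  have q: "0 \<le> ?a + 2 * t * ?b + t\<^sup>2 * ?c" for t
  proof -
    have tg: "(\<lambda>x. t * g x) \<in> L2 M" by (rule L2_cmult[OF g])
    have "l2_inner M (\<lambda>x. f x + t * g x) (\<lambda>x. f x + t * g x)
        = (?a + t * ?b) + (t * l2_inner M g f + t * (t * ?c))"
      unfolding l2_inner_add_left[OF f tg L2_add[OF f tg]] l2_inner_add_right[OF f tg f]
        l2_inner_cmult_left l2_inner_add_right[OF f tg g] l2_inner_cmult_right by (simp add: distrib_left)
    also have "\<dots> = ?a + 2 * t * ?b + t\<^sup>2 * ?c"
      unfolding l2_inner_commute[of M g f] by (simp add: power2_eq_square algebra_simps)
    finally have "?a + 2 * t * ?b + t\<^sup>2 * ?c = l2_inner M (\<lambda>x. f x + t * g x) (\<lambda>x. f x + t * g x)" ..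
    then show ?thesis using l2_inner_self_nonneg by metis
  qed
  have "?b\<^sup>2 \<le> ?a * ?c"
  proof (cases "?c = 0")
    case True
    have "?b = 0"
    proof (rule ccontr)
      assume "?b \<noteq> 0"
      \<comment> \<open>The expression is affine in t here, and this t gives it the value
        -1.\<close>
      then show False using q[of "-(?a + 1) / (2 * ?b)"] True by (simp add: field_simps)
    qed
    then show ?thesis using True by simp
  next
    case False
    then have "?c > 0" using l2_inner_self_nonneg[of M g] by simp
    then show ?thesis using q[of "- ?b / ?c"] by (simp add: field_simps power2_eq_square)
  qed
  then have "sqrt (?b\<^sup>2) \<le> sqrt (?a * ?c)" by (rule real_sqrt_le_mono)
  then show ?thesis by (simp add: l2_norm_def real_sqrt_mult)
qed

lemma l2_inner_tendsto:
  assumes u: "\<And>n. u n \<in> L2 M" and f: "f \<in> L2 M" and g: "g \<in> L2 M"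
    and lim: "(\<lambda>n. l2_norm M (\<lambda>x. u n x - f x)) \<longlonglongrightarrow> 0"
  shows "(\<lambda>n. l2_inner M (u n) g) \<longlonglongrightarrow> l2_inner M f g"
proof -
  have "(\<lambda>n. l2_inner M (u n) g - l2_inner M f g) \<longlonglongrightarrow> 0"
  proof (rule Lim_null_comparison)
    show "\<forall>\<^sub>F n in sequentially. norm (l2_inner M (u n) g - l2_inner M f g) \<le> l2_norm M (\<lambda>x. u n x - f x) * l2_norm M g"
      using l2_Cauchy_Schwarz[OF L2_diff[OF u f] g] by (simp add: l2_inner_diff_left u f g)
    show "(\<lambda>n. l2_norm M (\<lambda>x. u n x - f x) * l2_norm M g) \<longlonglongrightarrow> 0"
      using tendsto_mult_left_zero[OF lim] by simp
  qed
  then show ?thesis by (rule LIM_zero_cancel)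
qed

lemma l2_inner_diff_self:
  assumes "f \<in> L2 M" "g \<in> L2 M"
  shows "l2_inner M (\<lambda>x. f x - g x) (\<lambda>x. f x - g x) = l2_inner M f f - 2 * l2_inner M f g + l2_inner M g g"
proof -
  note d = L2_diff[OF assms]
  show ?thesis
    unfolding l2_inner_diff_left[OF assms d] l2_inner_diff_right[OF assms assms(1)]
      l2_inner_diff_right[OF assms assms(2)] l2_inner_commute[of M g f] by simp
qed

lemma l2_inner_self_tendsto:
  assumes u: "\<And>n. u n \<in> L2 M" and f: "f \<in> L2 M"
    and lim: "(\<lambda>n. l2_norm M (\<lambda>x. u n x - f x)) \<longlonglongrightarrow> 0"
  shows "(\<lambda>n. l2_inner M (u n) (u n)) \<longlonglongrightarrow> l2_inner M f f"
proof -
  have "l2_inner M (u n) (u n) =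
      (l2_norm M (\<lambda>x. u n x - f x))\<^sup>2 + 2 * l2_inner M (u n) f - l2_inner M f f" for n
    by (simp add: l2_norm_power2 l2_inner_diff_self u f)
  moreover have "(\<lambda>n. (l2_norm M (\<lambda>x. u n x - f x))\<^sup>2 + 2 * l2_inner M (u n) f - l2_inner M f f)
      \<longlonglongrightarrow> 0\<^sup>2 + 2 * l2_inner M f f - l2_inner M f f"
    by (intro tendsto_intros lim l2_inner_tendsto u f)
  ultimately show ?thesis by simp
qed

lemma l2_norm_mult_bounded_tendsto:
  assumes u: "\<And>n. u n \<in> L2 M" and f: "f \<in> L2 M" and w: "w \<in> borel_measurable M"
    and C: "\<And>x. x \<in> space M \<Longrightarrow> \<bar>w x\<bar> \<le> C"
    and lim: "(\<lambda>n. l2_norm M (\<lambda>x. u n x - f x)) \<longlonglongrightarrow> 0"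
  shows "(\<lambda>n. l2_norm M (\<lambda>x. w x * u n x - w x * f x)) \<longlonglongrightarrow> 0"
proof (rule Lim_null_comparison)
  show "(\<lambda>n. \<bar>C\<bar> * l2_norm M (\<lambda>x. u n x - f x)) \<longlonglongrightarrow> 0"
    using tendsto_mult_right_zero[OF lim] by simp
  have "l2_norm M (\<lambda>x. w x * u n x - w x * f x) \<le> \<bar>C\<bar> * l2_norm M (\<lambda>x. u n x - f x)" for n
  proof (rule power2_le_imp_le)
    have d: "(\<lambda>x. u n x - f x) \<in> L2 M" by (rule L2_diff[OF u f])
    have "l2_inner M (\<lambda>x. w x * (u n x - f x)) (\<lambda>x. w x * (u n x - f x)) \<le> C\<^sup>2 * l2_inner M (\<lambda>x. u n x - f x) (\<lambda>x. u n x - f x)"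
      unfolding l2_inner_def integral_mult_right_zero[symmetric]
    proof (rule integral_mono)
      show "integrable M (\<lambda>x. w x * (u n x - f x) * (w x * (u n x - f x)))"
        by (intro L2_integrable_mult L2_mult_bounded[OF d w C])
      show "integrable M (\<lambda>x. C\<^sup>2 * ((u n x - f x) * (u n x - f x)))"
        by (intro integrable_mult_right L2_integrable_mult d)
      fix x assume "x \<in> space M"
      then have "(w x)\<^sup>2 \<le> C\<^sup>2" using C[of x] by (metis abs_ge_zero power2_abs power_mono)
      then have "(w x)\<^sup>2 * (u n x - f x)\<^sup>2 \<le> C\<^sup>2 * (u n x - f x)\<^sup>2" by (rule mult_right_mono) simp
      then show "w x * (u n x - f x) * (w x * (u n x - f x)) \<le> C\<^sup>2 * ((u n x - f x) * (u n x - f x))"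
        by (simp add: power2_eq_square mult_ac)
    qed
    then show "(l2_norm M (\<lambda>x. w x * u n x - w x * f x))\<^sup>2 \<le> (\<bar>C\<bar> * l2_norm M (\<lambda>x. u n x - f x))\<^sup>2"
      by (simp add: power_mult_distrib l2_norm_power2 right_diff_distrib)
  qed (simp add: l2_norm_nonneg)
  then show "\<forall>\<^sub>F n in sequentially. norm (l2_norm M (\<lambda>x. w x * u n x - w x * f x)) \<le> \<bar>C\<bar> * l2_norm M (\<lambda>x. u n x - f x)"
    by (simp add: l2_norm_nonneg)
qed

section \<open>Self-adjoint graphs modulo null sets\<close>

locale self_adjoint_graph =
  fixes M :: "'x measure" and S :: "(('x \<Rightarrow> real) \<times> ('x \<Rightarrow> real)) set"
  assumes sa: "self_adjoint_op M S"
begin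

lemma eq_adjoint: "S = adjoint_graph M S"
  by (rule conjunct2[OF sa[unfolded self_adjoint_op_def]])

lemma dense: "densely_defined M S"
  by (rule conjunct1[OF sa[unfolded self_adjoint_op_def]])

lemma graphD:
  assumes "(f, g) \<in> S"
  shows "f \<in> L2 M \<and> g \<in> L2 M \<and> (\<forall>(u, v)\<in>S. l2_inner M v f = l2_inner M u g)"
proof -
  have "(f, g) \<in> adjoint_graph M S" using assms eq_adjoint by (rule back_subst)
  then show ?thesis unfolding adjoint_graph_def by simp
qed

lemma graph_L2: assumes "(f, g) \<in> S" shows "f \<in> L2 M" "g \<in> L2 M"
  using graphD[OF assms] by simp_all

lemma symmetric: assumes "(f, g) \<in> S" "(u, v) \<in> S" shows "l2_inner M v f = l2_inner M u g"
  using graphD[OF assms(1)] assms(2) by blast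

text \<open>The inclusion of the adjoint in \<open>S\<close>. Sums and differences enter the graph,
  and later test functions enter the domain of the operator, through this test.\<close>

lemma graphI: "f \<in> L2 M \<Longrightarrow> g \<in> L2 M \<Longrightarrow> (\<And>u v. (u, v) \<in> S \<Longrightarrow> l2_inner M v f = l2_inner M u g) \<Longrightarrow> (f, g) \<in> S"
proof -
  assume "f \<in> L2 M" "g \<in> L2 M" "\<And>u v. (u, v) \<in> S \<Longrightarrow> l2_inner M v f = l2_inner M u g"
  then have "(f, g) \<in> adjoint_graph M S" by (auto simp: adjoint_graph_def)
  then show "(f, g) \<in> S" using eq_adjoint[symmetric] by (rule back_subst)
qed

lemma graph_add: assumes "(f, g) \<in> S" "(f', g') \<in> S" shows "(\<lambda>x. f x + f' x, \<lambda>x. g x + g' x) \<in> S"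
proof (rule graphI)
  fix u v assume uv: "(u, v) \<in> S"
  show "l2_inner M v (\<lambda>x. f x + f' x) = l2_inner M u (\<lambda>x. g x + g' x)"
    unfolding l2_inner_add_right[OF graph_L2(1)[OF assms(1)] graph_L2(1)[OF assms(2)] graph_L2(2)[OF uv]]
      l2_inner_add_right[OF graph_L2(2)[OF assms(1)] graph_L2(2)[OF assms(2)] graph_L2(1)[OF uv]]
      symmetric[OF assms(1) uv] symmetric[OF assms(2) uv] ..
qed (rule L2_add[OF graph_L2(1)[OF assms(1)] graph_L2(1)[OF assms(2)]] L2_add[OF graph_L2(2)[OF assms(1)] graph_L2(2)[OF assms(2)]])+

lemma graph_diff: assumes "(f, g) \<in> S" "(f', g') \<in> S" shows "(\<lambda>x. f x - f' x, \<lambda>x. g x - g' x) \<in> S"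
proof (rule graphI)
  fix u v assume uv: "(u, v) \<in> S"
  show "l2_inner M v (\<lambda>x. f x - f' x) = l2_inner M u (\<lambda>x. g x - g' x)"
    unfolding l2_inner_diff_right[OF graph_L2(1)[OF assms(1)] graph_L2(1)[OF assms(2)] graph_L2(2)[OF uv]]
      l2_inner_diff_right[OF graph_L2(2)[OF assms(1)] graph_L2(2)[OF assms(2)] graph_L2(1)[OF uv]]
      symmetric[OF assms(1) uv] symmetric[OF assms(2) uv] ..
qed (rule L2_diff[OF graph_L2(1)[OF assms(1)] graph_L2(1)[OF assms(2)]] L2_diff[OF graph_L2(2)[OF assms(1)] graph_L2(2)[OF assms(2)]])+

text \<open>A domain element \<open>k\<close> closer to \<open>g\<close> than the norm of
  \<open>g\<close> contradicts Cauchy-Schwarz, because (g - k, g) would be the full square of that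
  norm.\<close>

lemma orthogonal_to_domain:
  assumes g: "g \<in> L2 M" and orth: "\<And>u v. (u, v) \<in> S \<Longrightarrow> l2_inner M u g = 0"
  shows "l2_inner M g g = 0"
proof (rule ccontr)
  assume nz: "l2_inner M g g \<noteq> 0"
  have pos: "l2_norm M g > 0"
    using l2_inner_self_nonneg[of M g] nz unfolding l2_norm_def by simp
  from dense g pos obtain k where k: "k \<in> Domain S" "k \<in> L2 M" "l2_norm M (\<lambda>x. g x - k x) < l2_norm M g"
    unfolding densely_defined_def by blast
  then have "l2_inner M k g = 0" using orth by auto
  then have "l2_inner M (\<lambda>x. g x - k x) g = (l2_norm M g)\<^sup>2"
    using g k by (simp add: l2_inner_diff_left l2_norm_power2)
  moreover have "\<bar>l2_inner M (\<lambda>x. g x - k x) g\<bar> \<le> l2_norm M (\<lambda>x. g x - k x) * l2_norm M g"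
    by (intro l2_Cauchy_Schwarz L2_diff g k)
  moreover have "\<dots> < l2_norm M g * l2_norm M g" using k(3) pos by simp
  ultimately show False by (simp add: power2_eq_square)
qed

text \<open>The graph contains every almost-everywhere version of an image, so images agree only up
  to a null function. Equality of norms is all that the values of the form, which are squared norms,
  can detect.\<close>

lemma single_valued_norm:
  assumes "(f, g) \<in> S" "(f, g') \<in> S"
  shows "l2_inner M g g = l2_inner M g' g'"
proof -
  have L: "g \<in> L2 M" "g' \<in> L2 M" using graph_L2[OF assms(1)] graph_L2[OF assms(2)] by auto
  let ?d = "\<lambda>x. g x - g' x"
  have d: "?d \<in> L2 M" by (rule L2_diff[OF L])
  have "l2_inner M ?d ?d = 0"
    using d
  proof (rule orthogonal_to_domain)
    fix u v assume uv: "(u, v) \<in> S"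
    show "l2_inner M u ?d = 0"
      using symmetric[OF assms(1) uv] symmetric[OF assms(2) uv] graph_L2(1)[OF uv] L
      by (simp add: l2_inner_diff_right)
  qed
  then have n0: "l2_norm M ?d = 0" by (simp add: l2_norm_def)
  have "l2_inner M ?d k = 0" if "k \<in> L2 M" for k
    using l2_Cauchy_Schwarz[OF d that] n0 by simp
  then have "l2_inner M ?d g = 0" "l2_inner M ?d g' = 0" using L by auto
  then show ?thesis using L by (simp add: l2_inner_diff_left l2_inner_commute[of M g' g])
qed

end

section \<open>The operator associated with the closure of a form\<close>

text \<open>Polarisation is used because \<open>q\<close> is given only as a function, without a
  bilinear form; \<open>core_inner\<close> recovers from it the inner product of the images under
  \<open>S\<close>.\<close>

definition polar_form :: "(('x \<Rightarrow> real) \<Rightarrow> real) \<Rightarrow> ('x \<Rightarrow> real) \<Rightarrow> ('x \<Rightarrow> real) \<Rightarrow> real" where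
  "polar_form q u v = (q (\<lambda>x. u x + v x) - q (\<lambda>x. u x - v x)) / 4"

locale closed_form_operator =
  fixes M :: "'x measure" and D :: "('x \<Rightarrow> real) set" and q :: "('x \<Rightarrow> real) \<Rightarrow> real"
    and H S :: "(('x \<Rightarrow> real) \<times> ('x \<Rightarrow> real)) set"
  assumes D_L2: "u \<in> D \<Longrightarrow> u \<in> L2 M"
    and D_add: "u \<in> D \<Longrightarrow> v \<in> D \<Longrightarrow> (\<lambda>x. u x + v x) \<in> D"
    and D_diff: "u \<in> D \<Longrightarrow> v \<in> D \<Longrightarrow> (\<lambda>x. u x - v x) \<in> D"
    and q_zero: "q (\<lambda>x. 0) = 0"
    and S: "positive_self_adjoint M S"
    and SS: "S O S = H"
    and form: "form_closure M D q = {(\<phi>, (l2_norm M \<psi>)\<^sup>2) | \<phi> \<psi>. (\<phi>, \<psi>) \<in> S}"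
begin

sublocale self_adjoint_graph M S
  using S by unfold_locales (simp add: positive_self_adjoint_def)

text \<open>The constant sequence \<open>u\<close> is admissible in the closure; its differences are
  the zero function, where \<open>q_zero\<close> applies.\<close>

lemma core_in_closure: "u \<in> D \<Longrightarrow> (u, q u) \<in> form_closure M D q"
  unfolding form_closure_def
  by (auto simp: D_L2 q_zero l2_norm_def l2_inner_def intro!: exI[of _ "\<lambda>_. u"])

lemma core_graph:
  assumes "u \<in> D" obtains \<psi> where "(u, \<psi>) \<in> S"
  using core_in_closure[OF assms] unfolding form by blast

lemma core_norm:
  assumes "u \<in> D" "(u, \<psi>) \<in> S" shows "l2_inner M \<psi> \<psi> = q u"
proof -
  obtain \<psi>' where "(u, \<psi>') \<in> S" "q u = (l2_norm M \<psi>')\<^sup>2"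
    using core_in_closure[OF assms(1)] unfolding form by blast
  then show ?thesis using single_valued_norm[OF assms(2)] by (simp add: l2_norm_power2)
qed

lemma core_inner:
  assumes u: "u \<in> D" "(u, \<psi>) \<in> S" and v: "v \<in> D" "(v, \<theta>) \<in> S"
  shows "l2_inner M \<psi> \<theta> = polar_form q u v"
proof -
  have L: "\<psi> \<in> L2 M" "\<theta> \<in> L2 M" using graph_L2[OF u(2)] graph_L2[OF v(2)] by auto
  have "l2_inner M (\<lambda>x. \<psi> x + \<theta> x) (\<lambda>x. \<psi> x + \<theta> x) = q (\<lambda>x. u x + v x)"
    by (intro core_norm D_add graph_add u v)
  moreover have "l2_inner M (\<lambda>x. \<psi> x - \<theta> x) (\<lambda>x. \<psi> x - \<theta> x) = q (\<lambda>x. u x - v x)"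
    by (intro core_norm D_diff graph_diff u v)
  ultimately show ?thesis
    using L L2_add[OF L]
    by (simp add: polar_form_def l2_inner_diff_self l2_inner_add_left l2_inner_add_right l2_inner_commute[of M \<theta> \<psi>])
qed

text \<open>Write \<psi> = S phi and Psi_n = S u_n. The form values give |Psi_n|^2 -> |\<psi>|^2,
  and (Psi_n, \<psi>) = (u_n, \<eta>) converges to |\<psi>|^2 because \<psi> lies in the domain of
  \<open>S\<close>; together Psi_n -> \<psi> in norm. As (\<eta>, v_n) = (\<psi>, S v_n), the error
  in the last clause is at most |Psi_n - \<psi>| times the square root of a bound for q(v_n). The
  \<open>v n\<close> may vary with n, as the later choice w u_n requires.\<close>

lemma operator_approx:
  assumes H: "(\<phi>, \<eta>) \<in> H"
  obtains u where "\<phi> \<in> L2 M" "\<eta> \<in> L2 M" "\<forall>n. u n \<in> D"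
    "(\<lambda>n. l2_norm M (\<lambda>x. u n x - \<phi> x)) \<longlonglongrightarrow> 0" "Bseq (\<lambda>n. q (u n))"
    "\<forall>v. (\<forall>n. v n \<in> D) \<longrightarrow> Bseq (\<lambda>n. q (v n)) \<longrightarrow>
       (\<lambda>n. l2_inner M \<eta> (v n) - polar_form q (u n) (v n)) \<longlonglongrightarrow> 0"
proof -
  obtain \<psi> where \<psi>: "(\<phi>, \<psi>) \<in> S" "(\<psi>, \<eta>) \<in> S" using H unfolding SS[symmetric] by blast
  note L = graph_L2[OF \<psi>(1)] graph_L2[OF \<psi>(2)]
  have "(\<phi>, (l2_norm M \<psi>)\<^sup>2) \<in> form_closure M D q" using \<psi>(1) unfolding form by blast
  then obtain u where u: "\<And>n. u n \<in> D" and lim: "(\<lambda>n. l2_norm M (\<lambda>x. u n x - \<phi> x)) \<longlonglongrightarrow> 0"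
    and qlim: "(\<lambda>n. q (u n)) \<longlonglongrightarrow> (l2_norm M \<psi>)\<^sup>2"
    unfolding form_closure_def by auto
  have "\<exists>p. (u n, p) \<in> S" for n using core_graph[OF u] by metis
  then obtain \<Psi> where \<Psi>: "\<And>n. (u n, \<Psi> n) \<in> S" by metis
  note \<Psi>L = graph_L2(2)[OF \<Psi>]
  have "(\<lambda>n. l2_inner M (\<Psi> n) \<psi>) \<longlonglongrightarrow> l2_inner M \<psi> \<psi>"
  proof -
    have "l2_inner M (\<Psi> n) \<psi> = l2_inner M (u n) \<eta>" for n
      using symmetric[OF \<psi>(2) \<Psi>] by simp
    moreover have "l2_inner M \<phi> \<eta> = l2_inner M \<psi> \<psi>" using symmetric[OF \<psi>(2) \<psi>(1)] by simp
    moreover have "(\<lambda>n. l2_inner M (u n) \<eta>) \<longlonglongrightarrow> l2_inner M \<phi> \<eta>"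
      by (intro l2_inner_tendsto lim L D_L2 u)
    ultimately show ?thesis by simp
  qed
  then have "(\<lambda>n. q (u n) - 2 * l2_inner M (\<Psi> n) \<psi> + l2_inner M \<psi> \<psi>) \<longlonglongrightarrow>
      (l2_norm M \<psi>)\<^sup>2 - 2 * l2_inner M \<psi> \<psi> + l2_inner M \<psi> \<psi>"
    by (intro tendsto_intros qlim)
  moreover have "q (u n) - 2 * l2_inner M (\<Psi> n) \<psi> + l2_inner M \<psi> \<psi> = l2_inner M (\<lambda>x. \<Psi> n x - \<psi> x) (\<lambda>x. \<Psi> n x - \<psi> x)" for n
    using core_norm[OF u \<Psi>] \<Psi>L L by (simp add: l2_inner_diff_self)
  ultimately have "(\<lambda>n. l2_inner M (\<lambda>x. \<Psi> n x - \<psi> x) (\<lambda>x. \<Psi> n x - \<psi> x)) \<longlonglongrightarrow> 0"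
    by (simp add: l2_norm_power2)
  then have nlim: "(\<lambda>n. l2_norm M (\<lambda>x. \<Psi> n x - \<psi> x)) \<longlonglongrightarrow> 0"
    unfolding l2_norm_def using tendsto_real_sqrt by fastforce
  have "(\<lambda>n. l2_inner M \<eta> (v n) - polar_form q (u n) (v n)) \<longlonglongrightarrow> 0"
    if v: "\<And>n. v n \<in> D" and bd: "Bseq (\<lambda>n. q (v n))" for v
  proof -
    have "\<exists>p. (v n, p) \<in> S" for n using core_graph[OF v] by metis
    then obtain \<Theta> where \<Theta>: "\<And>n. (v n, \<Theta> n) \<in> S" by metis
    note \<Theta>L = graph_L2(2)[OF \<Theta>]
    obtain K where K: "\<And>n. \<bar>q (v n)\<bar> \<le> K" using bd by (auto simp: Bseq_def)
    have \<Theta>n: "l2_norm M (\<Theta> n) \<le> sqrt K" for n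
      using core_norm[OF v \<Theta>, of n] K[of n] by (simp add: l2_norm_def)
    have "l2_inner M \<eta> (v n) - polar_form q (u n) (v n) = - l2_inner M (\<lambda>x. \<Psi> n x - \<psi> x) (\<Theta> n)" for n
      using symmetric[OF \<Theta> \<psi>(2), of n] core_inner[OF u \<Psi> v \<Theta>, of n n] L \<Psi>L \<Theta>L
      by (simp add: l2_inner_diff_left)
    moreover have "\<bar>l2_inner M (\<lambda>x. \<Psi> n x - \<psi> x) (\<Theta> n)\<bar> \<le> l2_norm M (\<lambda>x. \<Psi> n x - \<psi> x) * sqrt K" for n
      by (rule order_trans[OF l2_Cauchy_Schwarz[OF L2_diff[OF \<Psi>L[of n] L(2)] \<Theta>L[of n]]
            mult_left_mono[OF \<Theta>n[of n] l2_norm_nonneg]])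
    ultimately have "norm (l2_inner M \<eta> (v n) - polar_form q (u n) (v n)) \<le> l2_norm M (\<lambda>x. \<Psi> n x - \<psi> x) * sqrt K" for n
      by simp
    then show ?thesis
      by (intro Lim_null_comparison[OF _ tendsto_mult_left_zero[OF nlim, of "sqrt K"]]) simp
  qed
  moreover have "Bseq (\<lambda>n. q (u n))" by (rule convergent_imp_Bseq[OF convergentI[OF qlim]])
  ultimately show ?thesis using that[OF L(1) L(4) allI[OF u] lim] by blast
qed

text \<open>The claim amounts to (w, \<psi>) = (v, Lu) for all (v, w) in \<open>S\<close>, and it is
  known for v in the core. Core approximants \<open>a n\<close> of v have images that are bounded
  and converge to w when tested on the domain of \<open>S\<close>. Whether \<psi> lies in that
  domain is the very question, so density and the uniform bound carry the convergence over to
  \<psi>.\<close>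

lemma core_in_operator:
  assumes u: "u \<in> D" and L: "Lu \<in> L2 M" and parts: "\<And>v. v \<in> D \<Longrightarrow> polar_form q v u = l2_inner M v Lu"
  shows "(u, Lu) \<in> H"
proof -
  obtain \<psi> where \<psi>: "(u, \<psi>) \<in> S" using core_graph[OF u] .
  note \<psi>L = graph_L2(2)[OF \<psi>]
  have "(\<psi>, Lu) \<in> S"
  proof (rule graphI[OF \<psi>L L])
    fix v w assume vw: "(v, w) \<in> S"
    note vL = graph_L2[OF vw]
    have "(v, (l2_norm M w)\<^sup>2) \<in> form_closure M D q" using vw unfolding form by blast
    then obtain a where a: "\<And>n. a n \<in> D" and lim: "(\<lambda>n. l2_norm M (\<lambda>x. a n x - v x)) \<longlonglongrightarrow> 0"
      and qlim: "(\<lambda>n. q (a n)) \<longlonglongrightarrow> (l2_norm M w)\<^sup>2"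
      unfolding form_closure_def by auto
    have "\<exists>p. (a n, p) \<in> S" for n using core_graph[OF a] by metis
    then obtain \<Psi> where \<Psi>: "\<And>n. (a n, \<Psi> n) \<in> S" by metis
    note \<Psi>L = graph_L2(2)[OF \<Psi>]
    have lim1: "(\<lambda>n. l2_inner M (\<Psi> n) \<psi>) \<longlonglongrightarrow> l2_inner M v Lu"
    proof -
      have "l2_inner M (\<Psi> n) \<psi> = l2_inner M (a n) Lu" for n
        using core_inner[OF a \<Psi> u \<psi>, of n] parts[OF a, of n] by simp
      then show ?thesis using l2_inner_tendsto[OF D_L2[OF a] vL(1) L lim] by simp
    qed
    have weak: "(\<lambda>n. l2_inner M (\<Psi> n) f) \<longlonglongrightarrow> l2_inner M w f" if fg: "(f, g) \<in> S" for f g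
    proof -
      have "l2_inner M (\<Psi> n) f = l2_inner M (a n) g" for n using symmetric[OF fg \<Psi>] .
      moreover have "l2_inner M w f = l2_inner M v g" using symmetric[OF fg vw] .
      ultimately show ?thesis using l2_inner_tendsto[OF D_L2[OF a] vL(1) graph_L2(2)[OF fg] lim] by simp
    qed
    obtain K where K: "\<And>n. \<bar>q (a n)\<bar> \<le> K" using convergent_imp_Bseq[OF convergentI[OF qlim]] by (auto simp: Bseq_def)
    have \<Psi>n: "l2_norm M (\<Psi> n) \<le> sqrt K" for n
      using core_norm[OF a \<Psi>, of n] K[of n] by (simp add: l2_norm_def)
    have K0: "0 \<le> sqrt K" using order_trans[OF l2_norm_nonneg \<Psi>n] .
    let ?x = "\<lambda>n. l2_inner M (\<Psi> n) \<psi> - l2_inner M w \<psi>"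
    have "?x \<longlonglongrightarrow> 0"
    proof (rule LIMSEQ_I)
      fix e :: real assume e: "0 < e"
      \<comment> \<open>Both remainders together stay below e / 2; the summand 1 keeps the
        denominator positive.\<close>
      define d where "d = e / (2 * (sqrt K + l2_norm M w + 1))"
      have den: "0 < sqrt K + l2_norm M w + 1" using K0 l2_norm_nonneg[of M w] by linarith
      then have "0 < d" using e by (simp add: d_def)
      then obtain f where f: "f \<in> Domain S" "f \<in> L2 M" "l2_norm M (\<lambda>x. \<psi> x - f x) < d"
        using dense \<psi>L unfolding densely_defined_def by blast
      then obtain g where fg: "(f, g) \<in> S" by auto
      obtain N where N: "\<And>n. n \<ge> N \<Longrightarrow> \<bar>l2_inner M (\<Psi> n) f - l2_inner M w f\<bar> < e / 2"
        using LIMSEQ_D[OF weak[OF fg], of "e / 2"] e by auto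
      have "\<bar>?x n\<bar> < e" if "n \<ge> N" for n
      proof -
        have df: "(\<lambda>x. \<psi> x - f x) \<in> L2 M" by (rule L2_diff[OF \<psi>L f(2)])
        have "?x n = (l2_inner M (\<Psi> n) f - l2_inner M w f) + l2_inner M (\<Psi> n) (\<lambda>x. \<psi> x - f x) - l2_inner M w (\<lambda>x. \<psi> x - f x)"
          using \<Psi>L vL \<psi>L f by (simp add: l2_inner_diff_right)
        moreover have "\<bar>l2_inner M (\<Psi> n) (\<lambda>x. \<psi> x - f x)\<bar> \<le> sqrt K * d"
          using l2_Cauchy_Schwarz[OF \<Psi>L df, of n] mult_mono[OF \<Psi>n[of n] less_imp_le[OF f(3)] K0 l2_norm_nonneg] by linarith
        moreover have "\<bar>l2_inner M w (\<lambda>x. \<psi> x - f x)\<bar> \<le> l2_norm M w * d"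
          using l2_Cauchy_Schwarz[OF vL(2) df] mult_left_mono[OF less_imp_le[OF f(3)] l2_norm_nonneg[of M w]] by linarith
        moreover have "sqrt K * d + l2_norm M w * d \<le> e / 2"
        proof -
          have "sqrt K * d + l2_norm M w * d + d = (sqrt K + l2_norm M w + 1) * d" by (simp add: algebra_simps)
          also have "\<dots> = e / 2"
          proof -
            have "p * (e / (2 * p)) = e / 2" if "0 < p" for p :: real using that by simp
            from this[OF den] show ?thesis unfolding d_def .
          qed
          finally have "sqrt K * d + l2_norm M w * d + d = e / 2" .
          then show ?thesis using \<open>0 < d\<close> by simp
        qed
        ultimately show ?thesis using N[OF that] by linarith
      qed
      then show "\<exists>no. \<forall>n\<ge>no. norm (?x n - 0) < e" by auto
    qed
    then have "(\<lambda>n. l2_inner M (\<Psi> n) \<psi>) \<longlonglongrightarrow> l2_inner M w \<psi>" by (rule LIM_zero_cancel)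
    then show "l2_inner M w \<psi> = l2_inner M v Lu" using lim1 LIMSEQ_unique by blast
  qed
  with \<psi> show ?thesis unfolding SS[symmetric] by blast
qed

end

section \<open>Smooth functions on open sets\<close>

definition dird :: "'x::euclidean_space \<Rightarrow> ('x \<Rightarrow> real) \<Rightarrow> 'x \<Rightarrow> real" where
  "dird v f x = frechet_derivative f (at x) v"

text \<open>A local form of \<open>Ck\<close>: the weights are smooth only where x1 is
  nonzero.\<close>

primrec Ck_on :: "nat \<Rightarrow> 'x::euclidean_space set \<Rightarrow> ('x \<Rightarrow> real) \<Rightarrow> bool" where
  "Ck_on 0 U f \<longleftrightarrow> continuous_on U f"
| "Ck_on (Suc k) U f \<longleftrightarrow> (\<forall>x\<in>U. f differentiable (at x)) \<and> (\<forall>v. Ck_on k U (dird v f))"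

definition smooth_on :: "'x::euclidean_space set \<Rightarrow> ('x \<Rightarrow> real) \<Rightarrow> bool" where
  "smooth_on U f \<longleftrightarrow> (\<forall>k. Ck_on k U f)"

lemma Ck_iff_Ck_on: "Ck k f \<longleftrightarrow> Ck_on k UNIV f"
  by (induction k arbitrary: f) (auto simp: dird_def[abs_def])

lemma has_derivative_dird:
  "f differentiable (at x) \<Longrightarrow> (f has_derivative (\<lambda>v. dird v f x)) (at x)"
  by (simp add: dird_def frechet_derivative_works[symmetric])

lemma dird_eqI: "(f has_derivative f') (at x) \<Longrightarrow> dird v f x = f' v"
  unfolding dird_def using frechet_derivative_at by metis

lemma dird_cong:
  assumes "open U" "x \<in> U" "\<And>y. y \<in> U \<Longrightarrow> f y = g y" "f differentiable (at x)"
  shows "dird v f x = dird v g x"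
  unfolding dird_def using frechet_derivative_transform_within_open[OF assms(4,1,2,3)] by simp

lemma Ck_on_SucI:
  assumes "\<And>x. x \<in> U \<Longrightarrow> (f has_derivative (\<lambda>v. f' v x)) (at x)" "\<And>v. Ck_on k U (f' v)" "open U"
  shows "Ck_on (Suc k) U f"
proof -
  \<comment> \<open>\<open>Ck_on\<close> refers to \<open>dird\<close> itself, so passing to a
    derivative \<open>f'\<close> known only on \<open>U\<close> requires invariance under equality
    on an open set.\<close>
  have cong: "Ck_on k U f \<Longrightarrow> (\<And>x. x \<in> U \<Longrightarrow> f x = g x) \<Longrightarrow> Ck_on k U g" for k f g
  proof (induction k arbitrary: f g)
    case 0 then show ?case using continuous_on_cong by fastforce
  next
    case (Suc k)
    have d: "\<And>x. x \<in> U \<Longrightarrow> f differentiable (at x)" using Suc.prems(1) by simp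
    have "g differentiable (at x)" if x: "x \<in> U" for x
    proof -
      obtain f' where "(f has_derivative f') (at x)" using d[OF x] unfolding differentiable_def by blast
      then have "(g has_derivative f') (at x)"
        by (rule has_derivative_transform_within_open[OF _ assms(3) x Suc.prems(2)])
      then show ?thesis unfolding differentiable_def by blast
    qed
    moreover have "Ck_on k U (dird v g)" for v
      by (rule Suc.IH[of "dird v f"]) (use Suc.prems dird_cong[OF assms(3) _ _ d] in auto)
    ultimately show ?case by simp
  qed
  have "Ck_on k U (dird v f)" for v
    by (rule cong[OF assms(2)[of v]]) (simp add: dird_eqI[OF assms(1)])
  then show ?thesis using assms(1) by (auto simp: differentiable_def)
qed

lemma Ck_on_cong:
  assumes "open U" "Ck_on k U f" "\<And>x. x \<in> U \<Longrightarrow> f x = g x"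
  shows "Ck_on k U g"
proof (cases k)
  case 0 then show ?thesis using assms continuous_on_cong by fastforce
next
  case (Suc j)
  show ?thesis unfolding Suc
  proof (rule Ck_on_SucI[OF _ _ assms(1)])
    fix x assume x: "x \<in> U"
    then have "(f has_derivative (\<lambda>v. dird v f x)) (at x)"
      using assms(2) Suc by (intro has_derivative_dird) auto
    then show "(g has_derivative (\<lambda>v. dird v f x)) (at x)"
      by (rule has_derivative_transform_within_open[OF _ assms(1) x assms(3)])
  qed (use assms(2) Suc in auto)
qed

lemma Ck_on_derivative: "Ck_on (Suc k) U f \<Longrightarrow> x \<in> U \<Longrightarrow> (f has_derivative (\<lambda>v. dird v f x)) (at x)"
  by (simp add: has_derivative_dird)

lemma Ck_on_Suc_imp: "Ck_on (Suc k) U f \<Longrightarrow> Ck_on k U f"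
proof (induction k arbitrary: f)
  case 0 then show ?case
    by (auto intro!: continuous_at_imp_continuous_on differentiable_imp_continuous_within)
next
  case (Suc k)
  then have "Ck_on (Suc k) U (dird v f)" for v by simp
  then have "Ck_on k U (dird v f)" for v using Suc.IH by blast
  then show ?case using Suc.prems by simp
qed

lemma Ck_on_subset: "Ck_on k U f \<Longrightarrow> V \<subseteq> U \<Longrightarrow> Ck_on k V f"
  by (induction k arbitrary: f) (auto intro: continuous_on_subset)

lemma Ck_on_const: "open U \<Longrightarrow> Ck_on k U (\<lambda>x. c)"
proof (induction k arbitrary: c)
  case (Suc k)
  show ?case by (rule Ck_on_SucI[where f' = "\<lambda>v x. 0"]) (use Suc in auto)
qed simp

lemma Ck_on_linear: assumes "bounded_linear f" "open U" shows "Ck_on k U f"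
proof (cases k)
  case 0 then show ?thesis using assms(1) linear_continuous_on by auto
next
  case (Suc j)
  show ?thesis unfolding Suc
    by (rule Ck_on_SucI[where f' = "\<lambda>v x. f v"]) (use assms Ck_on_const bounded_linear_imp_has_derivative in auto)
qed

lemma Ck_on_add: "open U \<Longrightarrow> Ck_on k U f \<Longrightarrow> Ck_on k U g \<Longrightarrow> Ck_on k U (\<lambda>x. f x + g x)"
proof (induction k arbitrary: f g)
  case (Suc k)
  show ?case
  proof (rule Ck_on_SucI[where f' = "\<lambda>v x. dird v f x + dird v g x"])
    show "Ck_on k U (\<lambda>x. dird v f x + dird v g x)" for v
      using Suc.prems by (intro Suc.IH) auto
  qed (use Suc.prems in \<open>auto intro!: has_derivative_add has_derivative_dird\<close>)
qed (auto intro: continuous_on_add)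

lemma Ck_on_mult: "open U \<Longrightarrow> Ck_on k U f \<Longrightarrow> Ck_on k U g \<Longrightarrow> Ck_on k U (\<lambda>x. f x * g x)"
proof (induction k arbitrary: f g)
  case (Suc k)
  show ?case
  proof (rule Ck_on_SucI[where f' = "\<lambda>v x. f x * dird v g x + dird v f x * g x"])
    show "Ck_on k U (\<lambda>x. f x * dird v g x + dird v f x * g x)" for v
      using Suc.prems Ck_on_Suc_imp[OF Suc.prems(2)] Ck_on_Suc_imp[OF Suc.prems(3)]
      by (intro Ck_on_add Suc.IH) auto
  qed (use Suc.prems in \<open>auto intro!: has_derivative_mult has_derivative_dird\<close>)
qed (auto intro: continuous_on_mult)

lemma Ck_on_compose:
  fixes g :: "real \<Rightarrow> real"
  assumes "open U" "open I" "\<And>x. x \<in> U \<Longrightarrow> f x \<in> I"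
  shows "Ck_on k I g \<Longrightarrow> Ck_on k U f \<Longrightarrow> Ck_on k U (\<lambda>x. g (f x))"
proof (induction k arbitrary: g)
  case 0 then show ?case using assms(3) continuous_on_compose2[of I g U f] by auto
next
  case (Suc k)
  show ?case
  proof (rule Ck_on_SucI[where f' = "\<lambda>v x. dird 1 g (f x) * dird v f x"])
    show "Ck_on k U (\<lambda>x. dird 1 g (f x) * dird v f x)" for v
    proof (rule Ck_on_mult[OF assms(1)])
      show "Ck_on k U (\<lambda>x. dird 1 g (f x))"
        by (rule Suc.IH[OF _ Ck_on_Suc_imp[OF Suc.prems(2)]]) (use Suc.prems in simp)
    qed (use Suc.prems in simp)
    fix x assume x: "x \<in> U"
    have g: "(g has_derivative (\<lambda>v. dird v g (f x))) (at (f x))"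
      using Suc.prems(1) assms(3)[OF x] by (rule Ck_on_derivative)
    have lin: "dird v g (f x) = v * dird 1 g (f x)" for v
      using linear_scale[OF has_derivative_linear[OF g], of v 1] by simp
    have "((\<lambda>x. g (f x)) has_derivative (\<lambda>v. dird (dird v f x) g (f x))) (at x)"
      by (rule has_derivative_compose[OF Ck_on_derivative[OF Suc.prems(2) x] g])
    moreover have "(\<lambda>v. dird (dird v f x) g (f x)) = (\<lambda>v. dird 1 g (f x) * dird v f x)"
      using lin by (intro ext) (metis mult.commute)
    ultimately show "((\<lambda>x. g (f x)) has_derivative (\<lambda>v. dird 1 g (f x) * dird v f x)) (at x)"
      by simp
  qed (rule assms)
qed

text \<open>\<open>U\<close> and the complement of \<open>K\<close> cover the space, and
  \<open>dird v f\<close> again vanishes off \<open>K\<close>, so the induction passes to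
  derivatives.\<close>

lemma Ck_on_extend_zero:
  assumes "open U" "closed K" "K \<subseteq> U"
  shows "Ck_on k U f \<Longrightarrow> (\<And>x. x \<notin> K \<Longrightarrow> f x = 0) \<Longrightarrow> Ck_on k UNIV f"
proof (induction k arbitrary: f)
  case 0
  have "continuous_on (- K) f" using continuous_on_cong[of "-K" "-K" f "\<lambda>_. 0"] 0 by simp
  then have "continuous_on (U \<union> - K) f"
    using 0 assms by (intro continuous_on_open_Un) auto
  moreover have "U \<union> - K = UNIV" using assms by auto
  ultimately show ?case by simp
next
  case (Suc k)
  have z: "(f has_derivative (\<lambda>v. 0)) (at x)" if "x \<notin> K" for x
  proof (rule has_derivative_transform_within_open)
    show "((\<lambda>x. 0) has_derivative (\<lambda>v. 0)) (at x)" by simp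
    show "open (- K)" using assms by auto
  qed (use that Suc.prems in auto)
  have "f differentiable (at x)" for x
    using z[of x] Suc.prems(1) assms(3) unfolding differentiable_def by (cases "x \<in> K") (auto simp: differentiable_def)
  moreover have "Ck_on k UNIV (dird v f)" for v
    using Suc.prems(1) z by (intro Suc.IH) (auto dest: dird_eqI)
  ultimately show ?case by simp
qed

lemma Ck_on_real_SucI:
  fixes g :: "real \<Rightarrow> real"
  assumes "open I" "\<And>t. t \<in> I \<Longrightarrow> (g has_real_derivative g' t) (at t)" "Ck_on k I g'"
  shows "Ck_on (Suc k) I g"
proof (rule Ck_on_SucI[OF _ _ assms(1)])
  show "(g has_derivative (\<lambda>v. g' t * v)) (at t)" if "t \<in> I" for t
    using assms(2)[OF that] by (simp add: has_field_derivative_def)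
  show "Ck_on k I (\<lambda>x. g' x * v)" for v
    by (intro Ck_on_mult Ck_on_const assms)
qed

lemma smooth_on_const: "open U \<Longrightarrow> smooth_on U (\<lambda>x. c)"
  by (simp add: smooth_on_def Ck_on_const)
lemma smooth_on_linear: "bounded_linear f \<Longrightarrow> open U \<Longrightarrow> smooth_on U f"
  by (simp add: smooth_on_def Ck_on_linear)
lemma smooth_on_add: "open U \<Longrightarrow> smooth_on U f \<Longrightarrow> smooth_on U g \<Longrightarrow> smooth_on U (\<lambda>x. f x + g x)"
  by (simp add: smooth_on_def Ck_on_add)
lemma smooth_on_mult: "open U \<Longrightarrow> smooth_on U f \<Longrightarrow> smooth_on U g \<Longrightarrow> smooth_on U (\<lambda>x. f x * g x)"
  by (simp add: smooth_on_def Ck_on_mult)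
lemma smooth_on_diff: "open U \<Longrightarrow> smooth_on U f \<Longrightarrow> smooth_on U g \<Longrightarrow> smooth_on U (\<lambda>x. f x - g x)"
  using smooth_on_add[of U f "\<lambda>x. -1 * g x"] smooth_on_mult[of U "\<lambda>x. -1" g] smooth_on_const[of U "-1"] by simp
lemma smooth_on_sum: "open U \<Longrightarrow> (\<And>i. i \<in> I \<Longrightarrow> smooth_on U (f i)) \<Longrightarrow> smooth_on U (\<lambda>x. \<Sum>i\<in>I. f i x)"
  by (induction I rule: infinite_finite_induct) (auto intro: smooth_on_const smooth_on_add)
lemma smooth_on_compose:
  fixes g :: "real \<Rightarrow> real"
  shows "open U \<Longrightarrow> open I \<Longrightarrow> (\<And>x. x \<in> U \<Longrightarrow> f x \<in> I) \<Longrightarrow> smooth_on I g \<Longrightarrow> smooth_on U f \<Longrightarrow> smooth_on U (\<lambda>x. g (f x))"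
  by (simp add: smooth_on_def Ck_on_compose)
lemma smooth_on_cong: "open U \<Longrightarrow> smooth_on U f \<Longrightarrow> (\<And>x. x \<in> U \<Longrightarrow> f x = g x) \<Longrightarrow> smooth_on U g"
  unfolding smooth_on_def using Ck_on_cong by blast
lemma smooth_on_subset: "smooth_on U f \<Longrightarrow> V \<subseteq> U \<Longrightarrow> smooth_on V f"
  unfolding smooth_on_def using Ck_on_subset by blast
lemma smooth_on_dird: "smooth_on U f \<Longrightarrow> smooth_on U (dird v f)"
  unfolding smooth_on_def by (metis Ck_on.simps(2))
lemma smooth_on_has_derivative: "smooth_on U f \<Longrightarrow> x \<in> U \<Longrightarrow> (f has_derivative (\<lambda>v. dird v f x)) (at x)"
  unfolding smooth_on_def by (metis Ck_on_derivative)
lemma smooth_on_continuous: "smooth_on U f \<Longrightarrow> continuous_on U f"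
  unfolding smooth_on_def by (metis Ck_on.simps(1))

lemma smooth_on_powr: "smooth_on {0<..} (\<lambda>t::real. t powr a)"
proof -
  \<comment> \<open>The free factor \<open>c\<close> lets the induction absorb the exponent produced
    by differentiation.\<close>
  have "Ck_on k {0<..} (\<lambda>t::real. c * t powr a)" for k c a
  proof (induction k arbitrary: c a)
    case 0 show ?case by (auto intro!: continuous_intros)
  next
    case (Suc k)
    show ?case
    proof (rule Ck_on_real_SucI[where g' = "\<lambda>t. (c * a) * t powr (a - 1)"])
      fix t :: real assume "t \<in> {0<..}"
      then show "((\<lambda>t. c * t powr a) has_real_derivative c * a * t powr (a - 1)) (at t)"
        by (auto intro!: derivative_eq_intros)
    qed (use Suc in auto)
  qed
  from this[of _ 1] show ?thesis by (simp add: smooth_on_def)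
qed

lemma smooth_on_ln: "smooth_on {0<..} (ln :: real \<Rightarrow> real)"
  unfolding smooth_on_def
proof
  fix k show "Ck_on k {0<..} (ln :: real \<Rightarrow> real)"
  proof (cases k)
    case 0 then show ?thesis by (auto intro!: continuous_intros)
  next
    case (Suc j)
    show ?thesis unfolding Suc
    proof (rule Ck_on_real_SucI[where g' = "\<lambda>t. t powr (-1)"])
      show "(ln has_real_derivative t powr (-1)) (at t)" if "t \<in> {0<..}" for t :: real
        using that by (auto intro!: derivative_eq_intros simp: powr_minus_divide)
    qed (use smooth_on_powr[of "-1"] in \<open>simp_all add: smooth_on_def\<close>)
  qed
qed

section \<open>A smooth step built from exp (- 1 / t)\<close>

definition exp_flat :: "nat \<Rightarrow> real \<Rightarrow> real" where
  "exp_flat j t = (if t > 0 then (1 / t) ^ j * exp (- (1 / t)) else 0)"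

lemma exp_flat_tendsto: "(exp_flat j \<longlongrightarrow> 0) (at 0)"
proof (rule filterlim_split_at)
  show "(exp_flat j \<longlongrightarrow> 0) (at_left 0)"
    by (rule tendsto_eventually) (auto simp: exp_flat_def eventually_at_filter)
  have "((\<lambda>t. (inverse t) ^ j / exp (inverse t)) \<longlongrightarrow> 0) (at_right (0::real))"
    by (rule filterlim_compose[OF tendsto_power_div_exp_0 filterlim_inverse_at_top_right])
  then show "(exp_flat j \<longlongrightarrow> 0) (at_right 0)"
    by (rule Lim_transform_eventually)
      (auto simp: exp_flat_def eventually_at_filter exp_minus field_simps)
qed

text \<open>Derivatives are linear combinations of members of the family \<open>exp_flat j\<close>,
  which is why the powers of 1 / t are carried along: smoothness is then one induction over all
  \<open>j\<close>.\<close>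

lemma exp_flat_derivative:
  "(exp_flat j has_real_derivative (- real j * exp_flat (j + 1) t + exp_flat (j + 2) t)) (at t)"
proof -
  consider "t < 0" | "t = 0" | "t > 0" by linarith
  then show ?thesis
  proof cases
    case 1
    have "((\<lambda>t. 0) has_real_derivative 0) (at t)" by simp
    then have "(exp_flat j has_real_derivative 0) (at t)"
      by (rule has_field_derivative_transform_within_open[where S = "{..<0}"])
        (use 1 in \<open>auto simp: exp_flat_def\<close>)
    then show ?thesis using 1 by (simp add: exp_flat_def)
  next
    case 2
    \<comment> \<open>The difference quotient of \<open>exp_flat j\<close> at 0 is
      \<open>exp_flat (Suc j)\<close>, so the same limit serves all \<open>j\<close>.\<close>
    have "((\<lambda>h. (exp_flat j (0 + h) - exp_flat j 0) / h) \<longlongrightarrow> 0) (at 0)"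
      by (rule Lim_transform_eventually[OF exp_flat_tendsto[of "Suc j"]])
        (auto simp: exp_flat_def eventually_at_filter)
    then show ?thesis using 2 by (simp add: DERIV_def exp_flat_def)
  next
    case 3
    have "((\<lambda>t. (1 / t) ^ j * exp (- (1 / t))) has_real_derivative
        (real j * (1 / t) ^ (j - 1) * (- 1 / t\<^sup>2)) * exp (- (1 / t)) + (1 / t) ^ j * (exp (- (1 / t)) * (1 / t\<^sup>2))) (at t)"
      using 3 by (auto intro!: derivative_eq_intros simp: power2_eq_square)
    then have "(exp_flat j has_real_derivative
        (real j * (1 / t) ^ (j - 1) * (- 1 / t\<^sup>2)) * exp (- (1 / t)) + (1 / t) ^ j * (exp (- (1 / t)) * (1 / t\<^sup>2))) (at t)"
      by (rule has_field_derivative_transform_within_open[where S = "{0<..}"])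
        (use 3 in \<open>auto simp: exp_flat_def\<close>)
    moreover have 1: "real j * (1 / t) ^ (j - 1) * (- 1 / t\<^sup>2) = - real j * (1 / t) ^ (j + 1)"
    proof (cases j)
      case (Suc i)
      have "a * b * (- 1 / t\<^sup>2) = - a * (1 / t * (1 / t * b))" for a b by (simp add: power2_eq_square)
      from this[of "real j" "(1 / t) ^ i"] show ?thesis by (simp add: Suc)
    qed simp
    moreover have 2: "(1 / t) ^ j * (exp (- (1 / t)) * (1 / t\<^sup>2)) = (1 / t) ^ (j + 2) * exp (- (1 / t))"
      by (simp add: power2_eq_square)
    ultimately show ?thesis using 3 unfolding 1 2 by (simp only: exp_flat_def if_True mult.assoc)
  qed
qed

lemma smooth_on_exp_flat: "smooth_on UNIV (exp_flat j)"
proof -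
  have "Ck_on k UNIV (exp_flat j)" for k
  proof (induction k arbitrary: j)
    case 0 show ?case
      using DERIV_isCont[OF exp_flat_derivative] by (auto intro: continuous_at_imp_continuous_on)
  next
    case (Suc k)
    show ?case
      by (rule Ck_on_real_SucI[OF _ exp_flat_derivative])
        (intro Ck_on_add Ck_on_mult Ck_on_const Suc open_UNIV)+
  qed
  then show ?thesis by (simp add: smooth_on_def)
qed

lemma exp_flat_pos: "0 < t \<Longrightarrow> 0 < exp_flat 0 t" and exp_flat_zero: "t \<le> 0 \<Longrightarrow> exp_flat 0 t = 0"
  and exp_flat_nonneg: "0 \<le> exp_flat 0 t"
  by (auto simp: exp_flat_def)

lemma smooth_step:
  obtains \<eta> :: "real \<Rightarrow> real" where "smooth_on UNIV \<eta>" "\<And>t. 0 \<le> \<eta> t" "\<And>t. \<eta> t \<le> 1"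
    "\<And>t. t \<le> 0 \<Longrightarrow> \<eta> t = 0" "\<And>t. t \<ge> 1 \<Longrightarrow> \<eta> t = 1"
proof -
  \<comment> \<open>One of t and 1 - t is always positive, so this denominator never
    vanishes.\<close>
  define d where "d t = exp_flat 0 t + exp_flat 0 (1 - t)" for t
  have d: "0 < d t" for t
    using exp_flat_pos[of t] exp_flat_pos[of "1 - t"] exp_flat_nonneg[of t] exp_flat_nonneg[of "1 - t"]
    unfolding d_def by (cases "t > 0") auto
  define \<eta> where "\<eta> t = exp_flat 0 t * d t powr (-1)" for t
  have "smooth_on UNIV (\<lambda>t::real. 1 - t)"
    by (rule smooth_on_diff[OF open_UNIV smooth_on_const[OF open_UNIV] smooth_on_linear[OF bounded_linear_ident open_UNIV]])
  then have "smooth_on UNIV (\<lambda>t. exp_flat 0 (1 - t))"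
    by (rule smooth_on_compose[OF open_UNIV open_UNIV UNIV_I smooth_on_exp_flat])
  then have "smooth_on UNIV d" unfolding d_def[abs_def]
    by (rule smooth_on_add[OF open_UNIV smooth_on_exp_flat])
  then have "smooth_on UNIV (\<lambda>t. d t powr (-1))"
    using d by (intro smooth_on_compose[OF open_UNIV open_greaterThan _ smooth_on_powr]) auto
  then have "smooth_on UNIV \<eta>" unfolding \<eta>_def[abs_def]
    by (rule smooth_on_mult[OF open_UNIV smooth_on_exp_flat])
  moreover have eq: "\<eta> t = exp_flat 0 t / d t" for t
    using d[of t] by (simp add: \<eta>_def powr_minus_divide)
  moreover have "0 \<le> \<eta> t" for t using d[of t] exp_flat_nonneg[of t] by (simp add: eq)
  moreover have "\<eta> t \<le> 1" for t using d[of t] exp_flat_nonneg[of "1 - t"] by (simp add: eq d_def)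
  moreover have "t \<le> 0 \<Longrightarrow> \<eta> t = 0" for t by (simp add: eq exp_flat_zero)
  moreover have "t \<ge> 1 \<Longrightarrow> \<eta> t = 1" for t using d[of t] by (simp add: eq d_def exp_flat_zero)
  ultimately show ?thesis using that by blast
qed

section \<open>Test functions\<close>

text \<open>Smoothness is asked on \<open>U\<close> only, and extension by zero supplies the rest.
  Products with weights that are singular at x1 = 0 are therefore again test functions.\<close>

lemma test_functionI:
  assumes "open U" "smooth_on U f" "compact K" "K \<subseteq> U" "\<And>x. x \<notin> K \<Longrightarrow> f x = 0"
  shows "f \<in> test_functions U"
proof -
  have cl: "closure {x. f x \<noteq> 0} \<subseteq> K"
    using assms by (intro closure_minimal compact_imp_closed) auto
  have "compact (closure {x. f x \<noteq> 0})"
    using compact_Int_closed[OF assms(3) closed_closure, of "{x. f x \<noteq> 0}"] cl by (simp add: Int_absorb1)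
  moreover have "Ck k f" for k
    unfolding Ck_iff_Ck_on using assms compact_imp_closed
    by (intro Ck_on_extend_zero[of U K]) (auto simp: smooth_on_def)
  ultimately show ?thesis using cl assms(4) by (auto simp: test_functions_def)
qed

lemma test_functionE:
  assumes "f \<in> test_functions U"
  obtains K where "smooth_on UNIV f" "compact K" "K \<subseteq> U" "\<And>x. x \<notin> K \<Longrightarrow> f x = 0"
proof (rule that)
  show "smooth_on UNIV f" using assms by (simp add: test_functions_def smooth_on_def Ck_iff_Ck_on)
  show "compact (closure {x. f x \<noteq> 0})" "closure {x. f x \<noteq> 0} \<subseteq> U"
    using assms by (auto simp: test_functions_def)
  show "f x = 0" if "x \<notin> closure {x. f x \<noteq> 0}" for x
    using that closure_subset[of "{x. f x \<noteq> 0}"] by auto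
qed

lemma test_function_smooth: "f \<in> test_functions U \<Longrightarrow> smooth_on UNIV f"
  by (metis test_functionE)

lemma test_function_outside: "f \<in> test_functions U \<Longrightarrow> x \<notin> U \<Longrightarrow> f x = 0"
  by (metis test_functionE subsetD)

lemma test_function_mult:
  assumes "open U" "f \<in> test_functions U" "smooth_on U g"
  shows "(\<lambda>x. g x * f x) \<in> test_functions U"
proof -
  obtain K where "smooth_on UNIV f" "compact K" "K \<subseteq> U" "\<And>x. x \<notin> K \<Longrightarrow> f x = 0"
    using test_functionE[OF assms(2)] by metis
  then show ?thesis
    using assms(1,3) by (intro test_functionI[of U _ K] smooth_on_mult) (auto intro: smooth_on_subset)
qed

lemma test_function_times:
  assumes "open U" "f \<in> test_functions U" "g \<in> test_functions U"
  shows "(\<lambda>x. f x * g x) \<in> test_functions U"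
  by (rule test_function_mult[OF assms(1,3)]) (rule smooth_on_subset[OF test_function_smooth[OF assms(2)]], simp)

lemma test_function_add:
  assumes "open U" "f \<in> test_functions U" "g \<in> test_functions U"
  shows "(\<lambda>x. f x + g x) \<in> test_functions U"
proof -
  obtain K where "smooth_on UNIV f" "compact K" "K \<subseteq> U" "\<And>x. x \<notin> K \<Longrightarrow> f x = 0"
    using test_functionE[OF assms(2)] by metis
  moreover obtain L where "smooth_on UNIV g" "compact L" "L \<subseteq> U" "\<And>x. x \<notin> L \<Longrightarrow> g x = 0"
    using test_functionE[OF assms(3)] by metis
  ultimately show ?thesis
    using assms(1) by (intro test_functionI[of U _ "K \<union> L"] smooth_on_add) (auto intro: smooth_on_subset)
qed

lemma test_function_cmult:
  assumes "open U" "f \<in> test_functions U" shows "(\<lambda>x. c * f x) \<in> test_functions U"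
  using assms by (intro test_function_mult smooth_on_const)

lemma test_function_diff:
  assumes "open U" "f \<in> test_functions U" "g \<in> test_functions U"
  shows "(\<lambda>x. f x - g x) \<in> test_functions U"
  using test_function_add[OF assms(1,2) test_function_cmult[OF assms(1,3), of "-1"]] by simp

lemma test_function_zero: "open U \<Longrightarrow> (\<lambda>x. 0) \<in> test_functions U"
  by (rule test_functionI[of U _ "{}"]) (auto intro: smooth_on_const)

lemma test_function_sum:
  assumes "open U" "\<And>i. i \<in> I \<Longrightarrow> f i \<in> test_functions U"
  shows "(\<lambda>x. \<Sum>i\<in>I. f i x) \<in> test_functions U"
  using assms(2) by (induction I rule: infinite_finite_induct) (auto intro: test_function_add test_function_zero assms(1))

lemma test_function_dird:
  assumes "open U" "f \<in> test_functions U" shows "dird v f \<in> test_functions U"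
proof -
  obtain K where K: "smooth_on UNIV f" "compact K" "K \<subseteq> U" "\<And>x. x \<notin> K \<Longrightarrow> f x = 0"
    using test_functionE[OF assms(2)] by metis
  have "dird v f x = 0" if "x \<notin> K" for x
  proof -
    have "dird v f x = dird v (\<lambda>_. 0) x"
      by (rule dird_cong[of "- K"])
        (use K that compact_imp_closed in \<open>auto intro!: differentiableI[OF smooth_on_has_derivative[OF K(1)]]\<close>)
    then show ?thesis using dird_eqI[of "\<lambda>_. 0" "\<lambda>_. 0" x v] by simp
  qed
  then show ?thesis
    using K assms(1) by (intro test_functionI[of U _ K] smooth_on_subset[OF smooth_on_dird]) auto
qed

lemma test_function_continuous: "f \<in> test_functions U \<Longrightarrow> continuous_on UNIV f"
  by (intro smooth_on_continuous test_function_smooth)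

lemma test_function_borel: "f \<in> test_functions U \<Longrightarrow> f \<in> borel_measurable borel"
  by (intro borel_measurable_continuous_onI test_function_continuous)

lemma test_function_derivative: "f \<in> test_functions U \<Longrightarrow> (f has_derivative (\<lambda>v. dird v f x)) (at x)"
  by (rule smooth_on_has_derivative[OF test_function_smooth]) auto

lemma test_function_bounded:
  assumes "f \<in> test_functions U"
  obtains B where "0 \<le> B" "\<And>x. \<bar>f x\<bar> \<le> B"
proof -
  obtain K where K: "compact K" "\<And>x. x \<notin> K \<Longrightarrow> f x = 0" using test_functionE[OF assms] by metis
  have "compact (f ` K)"
    by (intro compact_continuous_image K continuous_on_subset[OF test_function_continuous[OF assms]]) auto
  then obtain B where "\<And>x. x \<in> K \<Longrightarrow> \<bar>f x\<bar> \<le> B"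
    by (metis bounded_iff compact_imp_bounded imageI real_norm_def)
  \<comment> \<open>\<open>B\<close> may be negative when \<open>K\<close> is empty.\<close>
  then have "\<bar>f x\<bar> \<le> max 0 B" for x using K(2)[of x] by (cases "x \<in> K") fastforce+
  then show ?thesis by (intro that[of "max 0 B"]) auto
qed

section \<open>Integrals of derivatives of test functions\<close>

lemma integrable_bounded_compact_support:
  fixes f :: "'x::euclidean_space \<Rightarrow> real"
  assumes "f \<in> borel_measurable borel" "compact K" "\<And>x. x \<notin> K \<Longrightarrow> f x = 0" "\<And>x. \<bar>f x\<bar> \<le> B"
  shows "integrable lborel f"
proof (rule Bochner_Integration.integrable_bound)
  show "integrable lborel (\<lambda>x. B * indicator K x :: real)"
    using emeasure_compact_finite[OF assms(2)] compact_imp_closed[OF assms(2)] by (intro integrable_mult_right integrable_real_indicator) auto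
  show "AE x in lborel. norm (f x) \<le> norm (B * indicator K x :: real)"
    using assms(3,4) by (intro AE_I2) (auto simp: indicator_def intro: order_trans[OF _ abs_ge_self])
qed (use assms in simp)

lemma test_function_integrable_mult:
  assumes "f \<in> test_functions U" "\<beta> \<in> borel_measurable borel" "\<And>x. \<bar>\<beta> x\<bar> \<le> C"
  shows "integrable lborel (\<lambda>x. \<beta> x * f x)"
proof -
  obtain K where K: "compact K" "\<And>x. x \<notin> K \<Longrightarrow> f x = 0" using test_functionE[OF assms(1)] by metis
  obtain B where B: "0 \<le> B" "\<And>x. \<bar>f x\<bar> \<le> B" using test_function_bounded[OF assms(1)] by metis
  have "\<bar>\<beta> x * f x\<bar> \<le> C * B" for x
    unfolding abs_mult using assms(3)[of x] B by (intro mult_mono) auto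
  then show ?thesis
    using K by (intro integrable_bounded_compact_support[of _ K "C * B"] borel_measurable_times assms test_function_borel[OF assms(1)]) auto
qed

lemma test_function_integrable: "f \<in> test_functions U \<Longrightarrow> integrable lborel f"
  using test_function_integrable_mult[of f U "\<lambda>_. 1" 1] by simp

lemma integral_lborel_translate:
  fixes f :: "'x::euclidean_space \<Rightarrow> real"
  assumes "f \<in> borel_measurable borel"
  shows "(\<integral>x. f (x + a) \<partial>lborel) = (\<integral>x. f x \<partial>lborel)"
proof -
  have "(\<integral>x. f x \<partial>lborel) = (\<integral>x. f x \<partial>distr lborel borel ((+) a))"
    by (simp add: lborel_distr_plus)
  also have "\<dots> = (\<integral>x. f (a + x) \<partial>lborel)"
    using assms by (intro integral_distr) auto
  finally show ?thesis by (simp add: add.commute)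
qed

text \<open>The integrals of the difference quotients vanish by translation invariance; they converge
  boundedly.\<close>

lemma integral_dird_zero:
  fixes f :: "'x::euclidean_space \<Rightarrow> real"
  assumes f: "f \<in> test_functions U" and U: "open U"
    and \<beta>: "\<beta> \<in> borel_measurable borel" "\<And>x. \<bar>\<beta> x\<bar> \<le> C" "\<And>x t. \<beta> (x + t *\<^sub>R e) = \<beta> x"
  shows "(\<integral>x. \<beta> x * dird e f x \<partial>lborel) = 0"
proof -
  obtain K where K: "compact K" "\<And>x. x \<notin> K \<Longrightarrow> f x = 0" using test_functionE[OF f] by metis
  obtain B where B: "0 \<le> B" "\<And>x. \<bar>dird e f x\<bar> \<le> B"
    using test_function_bounded[OF test_function_dird[OF U f]] by metis
  define h where "h n = 1 / real (Suc n)" for n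
  have h: "0 < h n" "h n \<le> 1" for n by (auto simp: h_def)
  define s where "s n x = \<beta> x * ((f (x + h n *\<^sub>R e) - f x) / h n)" for n x
  \<comment> \<open>All steps \<open>h n\<close> are at most 1, so every point from which a shift by
    \<open>h n\<close> along \<open>e\<close> reaches \<open>K\<close> lies in \<open>K'\<close>: a
    common compact support for the difference quotients.\<close>
  define K' where "K' = (\<lambda>(x, t). x - t *\<^sub>R e) ` (K \<times> {0..1})"
  have K': "compact K'" unfolding K'_def
    by (intro compact_continuous_image compact_Times K compact_Icc) (auto simp: case_prod_unfold intro!: continuous_intros)
  have C: "0 \<le> C" using \<beta>(2) abs_ge_zero order_trans by blast
  have fb: "f \<in> borel_measurable borel" using f by (rule test_function_borel)
  have bound: "\<bar>s n x\<bar> \<le> C * B * indicator K' x" for n x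
  proof (cases "x \<in> K'")
    case True
    have der: "((\<lambda>t. f (x + t *\<^sub>R e)) has_real_derivative dird e f (x + t *\<^sub>R e)) (at t)" for t
    proof -
      have "((\<lambda>t. f (x + t *\<^sub>R e)) has_derivative (\<lambda>v. dird (v *\<^sub>R e) f (x + t *\<^sub>R e))) (at t)"
        by (rule has_derivative_compose[OF _ test_function_derivative[OF f]]) (auto intro!: derivative_eq_intros)
      moreover have "dird (v *\<^sub>R e) f (x + t *\<^sub>R e) = dird e f (x + t *\<^sub>R e) * v" for v
        using linear_scale[OF has_derivative_linear[OF test_function_derivative[OF f, of "x + t *\<^sub>R e"]]] by simp
      ultimately show ?thesis by (simp add: has_field_derivative_def)
    qed
    obtain z where "f (x + h n *\<^sub>R e) - f (x + 0 *\<^sub>R e) = (h n - 0) * dird e f (x + z *\<^sub>R e)"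
      using MVT2[OF h(1)[of n], of "\<lambda>t. f (x + t *\<^sub>R e)" "\<lambda>t. dird e f (x + t *\<^sub>R e)"] der by blast
    then have "(f (x + h n *\<^sub>R e) - f x) / h n = dird e f (x + z *\<^sub>R e)" using h(1)[of n] by simp
    then show ?thesis unfolding s_def abs_mult using True B \<beta>(2)[of x] C by (auto intro!: mult_mono)
  next
    case False
    have "x \<notin> K"
    proof
      assume "x \<in> K"
      then have "x \<in> K'" unfolding K'_def by (intro image_eqI[of _ _ "(x, 0)"]) auto
      then show False using False by simp
    qed
    moreover have "x + h n *\<^sub>R e \<notin> K"
    proof
      assume "x + h n *\<^sub>R e \<in> K"
      then have "x \<in> K'" unfolding K'_def using h[of n] by (intro image_eqI[of _ _ "(x + h n *\<^sub>R e, h n)"]) auto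
      then show False using False by simp
    qed
    ultimately show ?thesis using K False by (simp add: s_def)
  qed
  have meas: "s n \<in> borel_measurable lborel" for n
    unfolding s_def[abs_def] using \<beta>(1) fb by measurable
  have "(\<lambda>n. \<integral>x. s n x \<partial>lborel) \<longlonglongrightarrow> (\<integral>x. \<beta> x * dird e f x \<partial>lborel)"
  proof (rule integral_dominated_convergence[where w = "\<lambda>x. C * B * indicator K' x"])
    show "(\<lambda>x. \<beta> x * dird e f x) \<in> borel_measurable lborel"
      using \<beta>(1) test_function_borel[OF test_function_dird[OF U f]] by simp
    show "integrable lborel (\<lambda>x. C * B * indicator K' x)"
      using emeasure_compact_finite[OF K'] compact_imp_closed[OF K'] by (intro integrable_mult_right integrable_real_indicator) auto
    show "AE x in lborel. (\<lambda>n. s n x) \<longlonglongrightarrow> \<beta> x * dird e f x"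
    proof (intro AE_I2)
      fix x
      have "((\<lambda>t. f (x + t *\<^sub>R e)) has_derivative (\<lambda>v. dird (v *\<^sub>R e) f (x + 0 *\<^sub>R e))) (at 0)"
        by (rule has_derivative_compose[OF _ test_function_derivative[OF f]]) (auto intro!: derivative_eq_intros)
      moreover have "dird (v *\<^sub>R e) f x = dird e f x * v" for v
        using linear_scale[OF has_derivative_linear[OF test_function_derivative[OF f, of x]]] by simp
      ultimately have "((\<lambda>t. f (x + t *\<^sub>R e)) has_real_derivative dird e f x) (at 0)"
        by (simp add: has_field_derivative_def)
      then have "((\<lambda>t. (f (x + t *\<^sub>R e) - f x) / t) \<longlongrightarrow> dird e f x) (at 0)"
        by (simp add: DERIV_def)
      moreover have "filterlim h (at 0) sequentially"
        unfolding filterlim_at using h LIMSEQ_Suc[OF lim_1_over_n] by (auto simp: h_def[abs_def] intro!: always_eventually)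
      ultimately have "(\<lambda>n. (f (x + h n *\<^sub>R e) - f x) / h n) \<longlonglongrightarrow> dird e f x"
        by (rule filterlim_compose)
      then show "(\<lambda>n. s n x) \<longlonglongrightarrow> \<beta> x * dird e f x" unfolding s_def by (rule tendsto_mult_left)
    qed
  qed (use meas bound in auto)
  moreover have "(\<integral>x. s n x \<partial>lborel) = 0" for n
  proof -
    have I: "integrable lborel (\<lambda>x. \<beta> x * f x)" by (rule test_function_integrable_mult[OF f \<beta>(1,2)])
    \<comment> \<open>\<beta> is constant along \<open>e\<close>, so the shift passes through it. A
      merely measurable coefficient of x1 can thus stand in front of derivatives along x2.\<close>
    have "(\<integral>x. \<beta> x * f (x + h n *\<^sub>R e) \<partial>lborel) = (\<integral>x. \<beta> (x + h n *\<^sub>R e) * f (x + h n *\<^sub>R e) \<partial>lborel)"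
      by (simp add: \<beta>(3))
    also have "\<dots> = (\<integral>x. \<beta> x * f x \<partial>lborel)"
      using integral_lborel_translate[of "\<lambda>x. \<beta> x * f x" "h n *\<^sub>R e"] \<beta>(1) fb by simp
    finally have eq: "(\<integral>x. \<beta> x * f (x + h n *\<^sub>R e) \<partial>lborel) = (\<integral>x. \<beta> x * f x \<partial>lborel)" .
    have I': "integrable lborel (\<lambda>x. \<beta> x * f (x + h n *\<^sub>R e))"
    proof -
      have "integrable lborel (\<lambda>x. \<beta> (h n *\<^sub>R e + x) * f (h n *\<^sub>R e + x))"
        using integrable_distr[of "(+) (h n *\<^sub>R e)" lborel borel "\<lambda>x. \<beta> x * f x"] I
        by (simp add: lborel_distr_plus)
      then show ?thesis by (simp add: add.commute[of "h n *\<^sub>R e"] \<beta>(3))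
    qed
    have "s n x = (\<beta> x * f (x + h n *\<^sub>R e) - \<beta> x * f x) / h n" for x
      by (simp add: s_def right_diff_distrib diff_divide_distrib)
    then show ?thesis using I I' eq by simp
  qed
  ultimately show ?thesis by (simp add: LIMSEQ_const_iff)
qed

section \<open>Partial gradients of test functions on Omega\<close>

lemma open_Omega: "open (Omega :: ('a::euclidean_space \<times> 'b::euclidean_space) set)"
  unfolding Omega_def by (intro open_Times) auto

lemma Omega_iff: "x \<in> Omega \<longleftrightarrow> fst x \<noteq> 0"
  by (cases x) (auto simp: Omega_def)

lemma Omega_in_sets_lebesgue: "Omega \<inter> space lebesgue \<in> sets (lebesgue :: ('a::euclidean_space \<times> 'b::euclidean_space) measure)"
proof -
  have "(Omega :: ('a \<times> 'b) set) \<in> sets lborel" using borel_open[OF open_Omega] by simp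
  then show ?thesis using sets_completionI_sets by auto
qed

lemma sum_Basis_inner_dird:
  assumes "f differentiable (at x)"
  shows "(\<Sum>i\<in>Basis. (a \<bullet> i) * dird (i, 0) f x) = dird (a, 0) f x"
    and "(\<Sum>j\<in>Basis. (c \<bullet> j) * dird (0, j) f x) = dird (0, c) f x"
proof -
  have l: "linear (\<lambda>v. dird v f x)" using has_derivative_linear[OF has_derivative_dird[OF assms]] .
  have "(a, 0) = (\<Sum>i\<in>Basis. (a \<bullet> i) *\<^sub>R (i, 0))"
    by (simp add: prod_eq_iff fst_sum snd_sum euclidean_representation)
  then have "dird (a, 0) f x = dird (\<Sum>i\<in>Basis. (a \<bullet> i) *\<^sub>R (i, 0)) f x" by (rule arg_cong)
  also have "\<dots> = (\<Sum>i\<in>Basis. (a \<bullet> i) * dird (i, 0) f x)"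
    by (simp only: linear_sum[OF l] linear_scale[OF l] real_scaleR_def)
  finally show "(\<Sum>i\<in>Basis. (a \<bullet> i) * dird (i, 0) f x) = dird (a, 0) f x" ..
  have "(0, c) = (\<Sum>j\<in>Basis. (c \<bullet> j) *\<^sub>R (0, j))"
    by (simp add: prod_eq_iff fst_sum snd_sum euclidean_representation)
  then have "dird (0, c) f x = dird (\<Sum>j\<in>Basis. (c \<bullet> j) *\<^sub>R (0, j)) f x" by (rule arg_cong)
  also have "\<dots> = (\<Sum>j\<in>Basis. (c \<bullet> j) * dird (0, j) f x)"
    by (simp only: linear_sum[OF l] linear_scale[OF l] real_scaleR_def)
  finally show "(\<Sum>j\<in>Basis. (c \<bullet> j) * dird (0, j) f x) = dird (0, c) f x" ..
qed

lemma gradient1_inner_Basis: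
  assumes "f differentiable (at x)" "i \<in> Basis"
  shows "gradient1 f x \<bullet> i = dird (i, 0) f x"
proof -
  have "((\<lambda>y. (y, snd x)) has_derivative (\<lambda>v. (v, 0))) (at (fst x))"
    by (auto intro!: derivative_eq_intros)
  moreover have "(f has_derivative (\<lambda>v. dird v f x)) (at (fst x, snd x))"
    using has_derivative_dird[OF assms(1)] by simp
  ultimately have "((\<lambda>y. f (y, snd x)) has_derivative (\<lambda>v. dird (v, 0) f x)) (at (fst x))"
    by (rule has_derivative_compose)
  then have "frechet_derivative (\<lambda>y. f (y, snd x)) (at (fst x)) = (\<lambda>v. dird (v, 0) f x)"
    using frechet_derivative_at by metis
  then show ?thesis using assms(2)
    by (simp add: gradient1_def gradient_def inner_sum_left inner_Basis if_distrib cong: if_cong)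
qed

lemma gradient2_inner_Basis:
  assumes "f differentiable (at x)" "j \<in> Basis"
  shows "gradient2 f x \<bullet> j = dird (0, j) f x"
proof -
  have "((\<lambda>y. (fst x, y)) has_derivative (\<lambda>v. (0, v))) (at (snd x))"
    by (auto intro!: derivative_eq_intros)
  moreover have "(f has_derivative (\<lambda>v. dird v f x)) (at (fst x, snd x))"
    using has_derivative_dird[OF assms(1)] by simp
  ultimately have "((\<lambda>y. f (fst x, y)) has_derivative (\<lambda>v. dird (0, v) f x)) (at (snd x))"
    by (rule has_derivative_compose)
  then have "frechet_derivative (\<lambda>y. f (fst x, y)) (at (snd x)) = (\<lambda>v. dird (0, v) f x)"
    using frechet_derivative_at by metis
  then show ?thesis using assms(2)
    by (simp add: gradient2_def gradient_def inner_sum_left inner_Basis if_distrib cong: if_cong)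
qed

text \<open>Written as a sum of products of directional derivatives, so that it is visibly a test
  function; \<open>grad_prod_eq\<close> identifies it with the inner product of the partial
  gradients.\<close>

definition grad1_prod :: "('a::euclidean_space \<times> 'b::euclidean_space \<Rightarrow> real) \<Rightarrow> ('a \<times> 'b \<Rightarrow> real) \<Rightarrow> 'a \<times> 'b \<Rightarrow> real" where
  "grad1_prod u v x = (\<Sum>i\<in>Basis. dird (i, 0) u x * dird (i, 0) v x)"

definition grad2_prod :: "('a::euclidean_space \<times> 'b::euclidean_space \<Rightarrow> real) \<Rightarrow> ('a \<times> 'b \<Rightarrow> real) \<Rightarrow> 'a \<times> 'b \<Rightarrow> real" where
  "grad2_prod u v x = (\<Sum>j\<in>Basis. dird (0, j) u x * dird (0, j) v x)"

lemma grad_prod_eq: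
  assumes "u differentiable (at x)" "v differentiable (at x)"
  shows "gradient1 u x \<bullet> gradient1 v x = grad1_prod u v x"
    and "gradient2 u x \<bullet> gradient2 v x = grad2_prod u v x"
  unfolding grad1_prod_def grad2_prod_def
  by (subst euclidean_inner, intro sum.cong refl, simp add: gradient1_inner_Basis gradient2_inner_Basis assms)+

lemma test_function_differentiable: "f \<in> test_functions U \<Longrightarrow> f differentiable (at x)"
  using test_function_derivative differentiableI by blast

lemma dird_add:
  "f differentiable (at x) \<Longrightarrow> g differentiable (at x) \<Longrightarrow> dird v (\<lambda>x. f x + g x) x = dird v f x + dird v g x"
  by (rule dird_eqI) (intro has_derivative_add has_derivative_dird)

lemma dird_diff:
  "f differentiable (at x) \<Longrightarrow> g differentiable (at x) \<Longrightarrow> dird v (\<lambda>x. f x - g x) x = dird v f x - dird v g x"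
  by (rule dird_eqI) (intro has_derivative_diff has_derivative_dird)

lemma dird_mult:
  "f differentiable (at x) \<Longrightarrow> g differentiable (at x) \<Longrightarrow>
   dird v (\<lambda>x. f x * g x) x = f x * dird v g x + dird v f x * g x"
  by (rule dird_eqI) (intro has_derivative_mult has_derivative_dird)

lemma test_function_grad_prod:
  assumes "u \<in> test_functions Omega" "v \<in> test_functions Omega"
  shows "grad1_prod u v \<in> test_functions Omega" "grad2_prod u v \<in> test_functions Omega"
  unfolding grad1_prod_def[abs_def] grad2_prod_def[abs_def]
  by (intro test_function_sum test_function_times test_function_dird open_Omega assms)+

lemma grad_prod_outside:
  assumes "u \<in> test_functions Omega" "v \<in> test_functions Omega" "x \<notin> Omega"
  shows "grad1_prod u v x = 0" "grad2_prod u v x = 0"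
  using test_function_outside[OF test_function_grad_prod(1)[OF assms(1,2)] assms(3)]
    test_function_outside[OF test_function_grad_prod(2)[OF assms(1,2)] assms(3)] by auto

lemma grad_prod_polar:
  assumes "u differentiable (at x)" "v differentiable (at x)"
  shows "grad1_prod (\<lambda>x. u x + v x) (\<lambda>x. u x + v x) x =
      grad1_prod (\<lambda>x. u x - v x) (\<lambda>x. u x - v x) x + 4 * grad1_prod u v x"
    and "grad2_prod (\<lambda>x. u x + v x) (\<lambda>x. u x + v x) x =
      grad2_prod (\<lambda>x. u x - v x) (\<lambda>x. u x - v x) x + 4 * grad2_prod u v x"
  unfolding grad1_prod_def grad2_prod_def dird_add[OF assms] dird_diff[OF assms]
    sum_distrib_left sum.distrib[symmetric]
  by (intro sum.cong refl, simp add: algebra_simps)+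

text \<open>Carries integrals over to \<open>lborel\<close> on the whole space, where translation
  invariance and the product structure are available.\<close>

lemma integral_Omega:
  fixes f :: "'a::euclidean_space \<times> 'b::euclidean_space \<Rightarrow> real"
  assumes "f \<in> borel_measurable borel" "\<And>x. x \<notin> Omega \<Longrightarrow> f x = 0"
  shows "(\<integral>x. f x \<partial>lebesgue_on Omega) = (\<integral>x. f x \<partial>lborel)"
    and "integrable (lebesgue_on Omega) f \<longleftrightarrow> integrable lborel f"
proof -
  have eq: "(\<lambda>x. indicator Omega x *\<^sub>R f x) = f"
  proof
    show "indicator Omega x *\<^sub>R f x = f x" for x using assms(2)[of x] by (cases "x \<in> Omega") auto
  qed
  show "(\<integral>x. f x \<partial>lebesgue_on Omega) = (\<integral>x. f x \<partial>lborel)"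
    unfolding integral_restrict_space[OF Omega_in_sets_lebesgue] eq
    using assms(1) by (intro integral_completion) simp
  show "integrable (lebesgue_on Omega) f \<longleftrightarrow> integrable lborel f"
    unfolding integrable_restrict_space[OF Omega_in_sets_lebesgue] eq
    using assms(1) by (intro integrable_completion) simp
qed

lemma borel_lebesgue_on: "f \<in> borel_measurable borel \<Longrightarrow> f \<in> borel_measurable (lebesgue_on S)"
  by (intro measurable_restrict_space1 measurable_completion) simp

lemma test_function_L2_mult:
  assumes u: "u \<in> test_functions Omega" and \<beta>: "\<beta> \<in> borel_measurable borel" "\<And>x. \<bar>\<beta> x\<bar> \<le> C"
  shows "(\<lambda>x. \<beta> x * u x) \<in> L2 (lebesgue_on Omega)"
proof -
  have m: "(\<lambda>x. \<beta> x * u x) \<in> borel_measurable borel"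
    using \<beta>(1) test_function_borel[OF u] by simp
  have "integrable lborel (\<lambda>x. (\<beta> x * \<beta> x) * (u x * u x))"
  proof (rule test_function_integrable_mult[OF test_function_times[OF open_Omega u u]])
    show "\<bar>\<beta> x * \<beta> x\<bar> \<le> C * C" for x
      unfolding abs_mult using \<beta>(2)[of x] by (intro mult_mono) (auto intro: order_trans[OF abs_ge_zero])
  qed (use \<beta>(1) in simp)
  then have "integrable (lebesgue_on Omega) (\<lambda>x. (\<beta> x * \<beta> x) * (u x * u x))"
    using \<beta>(1) test_function_borel[OF u] by (subst integral_Omega(2)) (auto simp: test_function_outside[OF u])
  then have "integrable (lebesgue_on Omega) (\<lambda>x. (\<beta> x * u x)\<^sup>2)"
    by (simp add: power2_eq_square mult_ac)
  then show ?thesis using borel_lebesgue_on[OF m] by (simp add: L2_def)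
qed

lemma test_function_L2: "u \<in> test_functions Omega \<Longrightarrow> u \<in> L2 (lebesgue_on Omega)"
  using test_function_L2_mult[of u "\<lambda>_. 1" 1] by simp

lemma test_function_l2_inner:
  assumes "u \<in> test_functions Omega" "v \<in> test_functions Omega"
  shows "l2_inner (lebesgue_on Omega) u v = (\<integral>x. u x * v x \<partial>lborel)"
  unfolding l2_inner_def using assms
  by (intro integral_Omega) (auto simp: test_function_outside intro: borel_measurable_times test_function_borel)

section \<open>The bilinear Grushin form on test functions\<close>

lemma norm_fst_derivative:
  assumes "x \<in> Omega"
  shows "((\<lambda>x. norm (fst x)) has_derivative (\<lambda>v. (fst x \<bullet> fst v) / norm (fst x))) (at x)"
proof -
  have "(norm has_derivative (\<lambda>v. (fst x \<bullet> v) / norm (fst x))) (at (fst x))"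
    using has_derivative_norm[of "fst x"] assms
    by (simp add: Omega_iff sgn_div_norm inner_commute divide_inverse mult.commute)
  then show ?thesis
    by (intro has_derivative_compose[of fst fst x UNIV norm]) (auto intro!: derivative_eq_intros)
qed

lemma radial_derivative:
  assumes "x \<in> Omega" "(w has_real_derivative w') (at (norm (fst x)))"
  shows "((\<lambda>x. w (norm (fst x))) has_derivative (\<lambda>v. w' * (fst x \<bullet> fst v) / norm (fst x))) (at x)"
  using has_derivative_compose[OF norm_fst_derivative[OF assms(1)] assms(2)[unfolded has_field_derivative_def]]
  by simp

lemma smooth_on_norm_fst:
  "smooth_on (Omega :: ('a::euclidean_space \<times> 'b::euclidean_space) set) (\<lambda>x. norm (fst x))"
proof -
  have "smooth_on (Omega :: ('a \<times> 'b) set) (\<lambda>x. \<Sum>i\<in>Basis. (fst x \<bullet> i) * (fst x \<bullet> i))"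
    by (intro smooth_on_sum smooth_on_mult smooth_on_linear open_Omega bounded_linear_compose[OF bounded_linear_inner_left bounded_linear_fst])
  then have "smooth_on (Omega :: ('a \<times> 'b) set) (\<lambda>x. (\<Sum>i\<in>Basis. (fst x \<bullet> i) * (fst x \<bullet> i)) powr (1/2))"
    by (intro smooth_on_compose[OF open_Omega open_greaterThan _ smooth_on_powr])
      (auto simp: euclidean_inner[symmetric] Omega_iff)
  then show ?thesis
    by (rule smooth_on_cong[OF open_Omega])
      (simp add: euclidean_inner[symmetric] powr_half_sqrt norm_eq_sqrt_inner)
qed

lemma smooth_on_radial:
  assumes "smooth_on {0<..} w"
  shows "smooth_on (Omega :: ('a::euclidean_space \<times> 'b::euclidean_space) set) (\<lambda>x. w (norm (fst x)))"
  by (rule smooth_on_compose[OF open_Omega open_greaterThan _ assms smooth_on_norm_fst]) (simp add: Omega_iff)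

lemma smooth_on_c_fun: "smooth_on {0<..} (c_fun \<delta> \<delta>')"
proof -
  have "smooth_on {0<..} (\<lambda>s::real. (1 + s) powr (\<delta>' - \<delta>))"
    by (rule smooth_on_compose[OF open_greaterThan open_greaterThan _ smooth_on_powr])
      (auto intro: smooth_on_add[OF open_greaterThan smooth_on_const[OF open_greaterThan] smooth_on_linear[OF bounded_linear_ident open_greaterThan]])
  then show ?thesis unfolding c_fun_def[abs_def]
    by (intro smooth_on_mult[OF open_greaterThan smooth_on_powr])
qed

lemma c_Omega_radial: "c_Omega \<delta> \<delta>' x = c_fun \<delta> \<delta>' (norm (fst x))"
  by (simp add: c_Omega_def d_Omega_eq)

lemma smooth_on_c_Omega: "smooth_on Omega (c_Omega \<delta> \<delta>')"
  unfolding c_Omega_radial[abs_def] by (rule smooth_on_radial[OF smooth_on_c_fun])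

lemma c_fun_nonneg: "0 \<le> c_fun \<delta> \<delta>' s"
  by (simp add: c_fun_def)

definition grushin_inner ::
    "real \<Rightarrow> real \<Rightarrow> ('a::euclidean_space \<Rightarrow> real) \<Rightarrow> ('a \<times> 'b::euclidean_space \<Rightarrow> real) \<Rightarrow> ('a \<times> 'b \<Rightarrow> real) \<Rightarrow> real" where
  "grushin_inner \<delta> \<delta>' \<beta> u v =
     (\<integral>x. c_Omega \<delta> \<delta>' x * grad1_prod u v x \<partial>lborel) + (\<integral>x. \<beta> (fst x) * grad2_prod u v x \<partial>lborel)"

text \<open>The bounds hold at every point, and a truncated Borel version of \<open>b\<close> meets
  them even where it differs from \<open>b\<close>.\<close>

locale bounded_coefficient =
  fixes \<beta> :: "'a::euclidean_space \<Rightarrow> real" and C :: real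
  assumes \<beta>_borel: "\<beta> \<in> borel_measurable borel"
    and \<beta>_nonneg: "0 \<le> \<beta> y" and \<beta>_le: "\<beta> y \<le> C"
begin

lemma \<beta>_fst: "(\<lambda>x. \<beta> (fst x)) \<in> borel_measurable (borel :: ('a \<times> 'b::euclidean_space) measure)"
proof -
  have "fst \<in> borel_measurable (borel :: ('a \<times> 'b) measure)"
    by (intro borel_measurable_continuous_onI continuous_intros)
  then show ?thesis using \<beta>_borel by (rule measurable_compose)
qed

lemma \<beta>_abs: "\<bar>\<beta> y\<bar> \<le> C"
  using \<beta>_nonneg \<beta>_le by simp

lemma integrable_\<beta>:
  "f \<in> test_functions U \<Longrightarrow> integrable lborel (\<lambda>x. \<beta> (fst x) * f x)"
  by (rule test_function_integrable_mult[OF _ \<beta>_fst \<beta>_abs])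

lemma integrable_c:
  "f \<in> test_functions Omega \<Longrightarrow> integrable lborel (\<lambda>x. c_Omega \<delta> \<delta>' x * f x)"
  by (rule test_function_integrable[OF test_function_mult[OF open_Omega _ smooth_on_c_Omega]])

lemma grushin_form_eq:
  fixes u :: "'a \<times> 'b::euclidean_space \<Rightarrow> real"
  assumes u: "u \<in> test_functions Omega"
  shows "grushin_form \<delta> \<delta>' \<beta> u = grushin_inner \<delta> \<delta>' \<beta> u u"
proof -
  note d = test_function_differentiable[OF u]
  note G = test_function_grad_prod[OF u u]
  note G0 = grad_prod_outside[OF u u]
  have cG: "(\<lambda>x. c_Omega \<delta> \<delta>' x * grad1_prod u u x) \<in> borel_measurable borel"
    by (rule test_function_borel[OF test_function_mult[OF open_Omega G(1) smooth_on_c_Omega]])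
  have bG: "(\<lambda>x. \<beta> (fst x) * grad2_prod u u x) \<in> borel_measurable borel"
    by (intro borel_measurable_times \<beta>_fst test_function_borel[OF G(2)])
  show ?thesis
    unfolding grushin_form_def grushin_inner_def inner_scaleR_right grad_prod_eq[OF d d]
    by (simp add: integral_Omega(1)[OF cG] integral_Omega(1)[OF bG] G0)
qed

lemma polar_grushin_form:
  fixes u :: "'a \<times> 'b::euclidean_space \<Rightarrow> real"
  assumes u: "u \<in> test_functions Omega" and v: "v \<in> test_functions Omega"
  shows "polar_form (grushin_form \<delta> \<delta>' \<beta>) u v = grushin_inner \<delta> \<delta>' \<beta> u v"
proof -
  note p = test_function_add[OF open_Omega u v] and m = test_function_diff[OF open_Omega u v]
  note d = test_function_differentiable[OF u] test_function_differentiable[OF v]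
  note Gm = test_function_grad_prod[OF m m] and G = test_function_grad_prod[OF u v]
  have "(\<integral>x. c_Omega \<delta> \<delta>' x * grad1_prod (\<lambda>x. u x + v x) (\<lambda>x. u x + v x) x \<partial>lborel)
      = (\<integral>x. c_Omega \<delta> \<delta>' x * grad1_prod (\<lambda>x. u x - v x) (\<lambda>x. u x - v x) x + 4 * (c_Omega \<delta> \<delta>' x * grad1_prod u v x) \<partial>lborel)"
    by (intro Bochner_Integration.integral_cong refl) (simp add: grad_prod_polar(1)[OF d] algebra_simps)
  also have "\<dots> = (\<integral>x. c_Omega \<delta> \<delta>' x * grad1_prod (\<lambda>x. u x - v x) (\<lambda>x. u x - v x) x \<partial>lborel)
      + 4 * (\<integral>x. c_Omega \<delta> \<delta>' x * grad1_prod u v x \<partial>lborel)"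
    using integrable_c[OF Gm(1)] integrable_c[OF G(1)] by simp
  finally have 1: "(\<integral>x. c_Omega \<delta> \<delta>' x * grad1_prod (\<lambda>x. u x + v x) (\<lambda>x. u x + v x) x \<partial>lborel) = \<dots>" .
  have "(\<integral>x. \<beta> (fst x) * grad2_prod (\<lambda>x. u x + v x) (\<lambda>x. u x + v x) x \<partial>lborel)
      = (\<integral>x. \<beta> (fst x) * grad2_prod (\<lambda>x. u x - v x) (\<lambda>x. u x - v x) x + 4 * (\<beta> (fst x) * grad2_prod u v x) \<partial>lborel)"
    by (intro Bochner_Integration.integral_cong refl) (simp add: grad_prod_polar(2)[OF d] algebra_simps)
  also have "\<dots> = (\<integral>x. \<beta> (fst x) * grad2_prod (\<lambda>x. u x - v x) (\<lambda>x. u x - v x) x \<partial>lborel)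
      + 4 * (\<integral>x. \<beta> (fst x) * grad2_prod u v x \<partial>lborel)"
    using integrable_\<beta>[OF Gm(2)] integrable_\<beta>[OF G(2)] by simp
  finally have 2: "(\<integral>x. \<beta> (fst x) * grad2_prod (\<lambda>x. u x + v x) (\<lambda>x. u x + v x) x \<partial>lborel) = \<dots>" .
  show ?thesis
    unfolding polar_form_def grushin_form_eq[OF p] grushin_form_eq[OF m] unfolding grushin_inner_def 1 2 by simp
qed

end

section \<open>The radial derivative r d/dr in x1 and products with radial functions\<close>

definition euler :: "('a::euclidean_space \<times> 'b::euclidean_space \<Rightarrow> real) \<Rightarrow> 'a \<times> 'b \<Rightarrow> real" where
  "euler f x = dird (fst x, 0) f x"

lemma inner_fst_smooth: "smooth_on Omega (\<lambda>x. fst x \<bullet> i)"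
  by (intro smooth_on_linear open_Omega bounded_linear_compose[OF bounded_linear_inner_left bounded_linear_fst])

lemma dird_inner_fst_mult:
  assumes "f differentiable (at x)"
  shows "dird (v, 0) (\<lambda>x. (fst x \<bullet> i) * f x) x = (fst x \<bullet> i) * dird (v, 0) f x + (v \<bullet> i) * f x"
proof (rule dird_eqI[of _ "\<lambda>w. (fst x \<bullet> i) * dird w f x + (fst w \<bullet> i) * f x", THEN trans])
  show "((\<lambda>x. (fst x \<bullet> i) * f x) has_derivative (\<lambda>w. (fst x \<bullet> i) * dird w f x + (fst w \<bullet> i) * f x)) (at x)"
    by (intro has_derivative_mult has_derivative_dird assms has_derivative_inner_left has_derivative_fst has_derivative_ident)
qed simp

text \<open>The field x1 f has x1-divergence \<open>euler f\<close> plus n f, and divergences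
  integrate to zero. This is the only integration by parts in the Hardy bound.\<close>

lemma integral_euler:
  fixes f :: "'a::euclidean_space \<times> 'b::euclidean_space \<Rightarrow> real"
  assumes f: "f \<in> test_functions Omega"
  shows "integrable lborel (euler f)" "(\<integral>x. euler f x \<partial>lborel) = - real DIM('a) * (\<integral>x. f x \<partial>lborel)"
proof -
  note d = test_function_differentiable[OF f]
  have fi: "(\<lambda>x. (fst x \<bullet> i) * f x) \<in> test_functions Omega" for i
    by (rule test_function_mult[OF open_Omega f inner_fst_smooth])
  have int: "integrable lborel (dird (i, 0) (\<lambda>x. (fst x \<bullet> i) * f x))" for i
    by (rule test_function_integrable[OF test_function_dird[OF open_Omega fi]])
  have eq: "euler f x = (\<Sum>i\<in>Basis. dird (i, 0) (\<lambda>x. (fst x \<bullet> i) * f x) x) - real DIM('a) * f x" for x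
    by (simp add: dird_inner_fst_mult[OF d] sum.distrib sum_Basis_inner_dird(1)[OF d] euler_def)
  have I: "integrable lborel (\<lambda>x. \<Sum>i\<in>Basis. dird (i, 0) (\<lambda>x. (fst x \<bullet> i) * f x) x)"
    using int by (intro Bochner_Integration.integrable_sum)
  have J: "integrable lborel (\<lambda>x. real DIM('a) * f x)"
    using test_function_integrable[OF f] by simp
  show "integrable lborel (euler f)" unfolding eq[abs_def] using I J by simp
  have "(\<integral>x. dird (i, 0) (\<lambda>x. (fst x \<bullet> i) * f x) x \<partial>lborel) = 0" for i
    using integral_dird_zero[OF fi open_Omega, of "\<lambda>_. 1" 1] by simp
  then have "(\<integral>x. (\<Sum>i\<in>Basis. dird (i, 0) (\<lambda>x. (fst x \<bullet> i) * f x) x) \<partial>lborel) = 0"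
    using int by simp
  then show "(\<integral>x. euler f x \<partial>lborel) = - real DIM('a) * (\<integral>x. f x \<partial>lborel)"
    unfolding eq using I J by simp
qed

text \<open>Keeps the radial part of the x1-gradient and discards the angular part.\<close>

lemma euler_square_le:
  assumes "u differentiable (at x)"
  shows "(euler u x)\<^sup>2 \<le> (norm (fst x))\<^sup>2 * grad1_prod u u x"
proof -
  have "euler u x = fst x \<bullet> gradient1 u x"
    unfolding euler_def
    by (subst euclidean_inner) (simp add: gradient1_inner_Basis[OF assms] sum_Basis_inner_dird(1)[OF assms])
  moreover have "(fst x \<bullet> gradient1 u x)\<^sup>2 \<le> (fst x \<bullet> fst x) * (gradient1 u x \<bullet> gradient1 u x)"
    by (rule Cauchy_Schwarz_ineq)
  ultimately show ?thesis
    unfolding grad_prod_eq(1)[OF assms assms] by (simp add: power2_norm_eq_inner)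
qed

lemma radial_mult_derivatives:
  assumes x: "x \<in> Omega" and w: "(w has_real_derivative w') (at (norm (fst x)))" and u: "u differentiable (at x)"
  shows "dird v (\<lambda>x. w (norm (fst x)) * u x) x
      = w (norm (fst x)) * dird v u x + w' * (fst x \<bullet> fst v) / norm (fst x) * u x"
  by (rule dird_eqI) (rule has_derivative_mult[OF radial_derivative[OF x w] has_derivative_dird[OF u]])

text \<open>The mixed products of u and w u enter the lower bound of the form, the products of w u
  with itself enter the bound for multiplication by w, and the last identity computes the divergence
  of the Hardy field.\<close>

lemma grad_prod_radial_mult:
  assumes x: "x \<in> Omega" and w: "(w has_real_derivative w') (at (norm (fst x)))" and u: "u differentiable (at x)"
  defines "r \<equiv> norm (fst x)" and "wu \<equiv> \<lambda>x. w (norm (fst x)) * u x"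
  shows "grad1_prod u wu x = w r * grad1_prod u u x + w' / r * u x * euler u x"
    and "grad2_prod u wu x = w r * grad2_prod u u x"
    and "grad1_prod wu wu x = (w r)\<^sup>2 * grad1_prod u u x + 2 * (w r * w' / r * u x * euler u x) + (w' * u x)\<^sup>2"
    and "grad2_prod wu wu x = (w r)\<^sup>2 * grad2_prod u u x"
    and "euler wu x = w r * euler u x + w' * r * u x"
proof -
  note D = radial_mult_derivatives[OF x w u, folded r_def wu_def]
  have r0: "r \<noteq> 0" using x by (simp add: r_def Omega_iff)
  have rr: "fst x \<bullet> fst x = r * r" by (simp add: r_def dot_square_norm power2_eq_square)
  have e: "euler u x = (\<Sum>i\<in>Basis. (fst x \<bullet> i) * dird (i, 0) u x)"
    unfolding euler_def sum_Basis_inner_dird(1)[OF u] ..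
  show "grad1_prod u wu x = w r * grad1_prod u u x + w' / r * u x * euler u x"
    unfolding grad1_prod_def e D sum_distrib_left sum.distrib[symmetric]
    by (intro sum.cong refl) (simp add: algebra_simps)
  show "grad2_prod u wu x = w r * grad2_prod u u x"
    unfolding grad2_prod_def D sum_distrib_left by (intro sum.cong refl) simp
  show "grad2_prod wu wu x = (w r)\<^sup>2 * grad2_prod u u x"
    unfolding grad2_prod_def D sum_distrib_left by (intro sum.cong refl) (simp add: power2_eq_square)
  have "grad1_prod wu wu x = (w r)\<^sup>2 * grad1_prod u u x + 2 * (w r * w' / r * u x * euler u x)
      + (w' / r * u x)\<^sup>2 * (\<Sum>i\<in>Basis. (fst x \<bullet> i) * (fst x \<bullet> i))"
    unfolding grad1_prod_def e D sum_distrib_left sum.distrib[symmetric]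
    by (intro sum.cong refl) (simp add: power2_eq_square algebra_simps)
  also have "(\<Sum>i\<in>Basis. (fst x \<bullet> i) * (fst x \<bullet> i)) = r * r"
    unfolding rr[symmetric] by (rule euclidean_inner[symmetric])
  finally show "grad1_prod wu wu x = (w r)\<^sup>2 * grad1_prod u u x + 2 * (w r * w' / r * u x * euler u x) + (w' * u x)\<^sup>2"
    using r0 by (simp add: power2_eq_square)
  show "euler wu x = w r * euler u x + w' * r * u x"
    using r0 unfolding euler_def D by (simp add: rr)
qed

section \<open>The regularised weight\<close>

text \<open>The logarithmic derivative of a function \<open>w\<close> of the radius \<open>r\<close> is \<open>r w'(r) / w(r)\<close>; for
  \<open>c\<close> it is \<open>c_slope\<close>.\<close>

definition c_slope :: "real \<Rightarrow> real \<Rightarrow> real \<Rightarrow> real" where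
  "c_slope \<delta> \<delta>' r = \<delta> + (\<delta>' - \<delta>) * (r / (1 + r))"

definition rad_weight :: "real \<Rightarrow> real \<Rightarrow> real \<Rightarrow> real" where
  "rad_weight \<delta> \<delta>' r = c_fun \<delta> \<delta>' r * r powr (-2)"

text \<open>The square in the denominator bounds not only w but also chi w, by 1 / eps. The term c
  w'^2 u^2 of the form of w u equals chi w^2 sigma^2 u^2, and its control uses both bounds.\<close>

definition reg_weight :: "real \<Rightarrow> real \<Rightarrow> real \<Rightarrow> real \<Rightarrow> real" where
  "reg_weight \<delta> \<delta>' \<epsilon> r = rad_weight \<delta> \<delta>' r / (1 + \<epsilon> * (rad_weight \<delta> \<delta>' r)\<^sup>2)"

text \<open>The logarithmic derivative of \<open>reg_weight\<close> by the chain rule: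
  \<open>rad_weight\<close> contributes s - 2, and t / (1 + eps t^2) contributes the fraction, which
  lies between -1 and 1 for eps > 0.\<close>

definition reg_slope :: "real \<Rightarrow> real \<Rightarrow> real \<Rightarrow> real \<Rightarrow> real" where
  "reg_slope \<delta> \<delta>' \<epsilon> r = (c_slope \<delta> \<delta>' r - 2) *
     ((1 - \<epsilon> * (rad_weight \<delta> \<delta>' r)\<^sup>2) / (1 + \<epsilon> * (rad_weight \<delta> \<delta>' r)\<^sup>2))"

text \<open>Its square is a_2 of part (a); the form estimate produces the root itself.\<close>

definition rellich_root :: "real \<Rightarrow> real \<Rightarrow> real \<Rightarrow> real" where
  "rellich_root n \<delta> \<delta>' = n * (n + 2 * min \<delta> \<delta>' - 4) / 4"

lemma rellich_weight_radial: "rellich_weight \<delta> \<delta>' x = rad_weight \<delta> \<delta>' (norm (fst x))"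
  by (simp add: rellich_weight_def rad_weight_def c_Omega_radial d_Omega_eq)

lemma rad_weight_pos: "0 < r \<Longrightarrow> 0 < rad_weight \<delta> \<delta>' r"
  by (simp add: rad_weight_def c_fun_def)

lemma rad_weight_square: "0 < r \<Longrightarrow> c_fun \<delta> \<delta>' r = rad_weight \<delta> \<delta>' r * r\<^sup>2"
  by (simp add: rad_weight_def powr_minus powr_numeral field_simps)

lemma c_slope_derivative:
  assumes "0 < r" shows "(c_slope \<delta> \<delta>' has_real_derivative (\<delta>' - \<delta>) / (1 + r)\<^sup>2) (at r)"
proof -
  have "(c_slope \<delta> \<delta>' has_real_derivative (\<delta>' - \<delta>) * ((1 * (1 + r) - r * 1) / ((1 + r) * (1 + r)))) (at r)"
    unfolding c_slope_def[abs_def] using assms by (auto intro!: derivative_eq_intros) (simp add: algebra_simps)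
  then show ?thesis by (simp add: power2_eq_square)
qed

lemma rad_weight_derivative:
  assumes "0 < r"
  shows "(rad_weight \<delta> \<delta>' has_real_derivative rad_weight \<delta> \<delta>' r * (c_slope \<delta> \<delta>' r - 2) / r) (at r)"
proof -
  let ?a = "r powr \<delta>" and ?b = "(1 + r) powr (\<delta>' - \<delta>)" and ?c = "r powr (-2)"
  have 1: "((\<lambda>r. r powr \<delta>) has_real_derivative \<delta> * r powr (\<delta> - 1)) (at r)"
    using assms by (auto intro!: derivative_eq_intros)
  have 2: "((\<lambda>r. (1 + r) powr (\<delta>' - \<delta>)) has_real_derivative (\<delta>' - \<delta>) * (1 + r) powr (\<delta>' - \<delta> - 1)) (at r)"
    using assms by (auto intro!: derivative_eq_intros)
  have 3: "((\<lambda>r. r powr (-2)) has_real_derivative (-2) * r powr (-2 - 1)) (at r)"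
    using assms by (auto intro!: derivative_eq_intros)
  have p: "t powr (a - 1) = t powr a / t" if "0 < t" for t a :: real
    using that by (simp add: powr_diff)
  have "(rad_weight \<delta> \<delta>' has_real_derivative
      (\<delta> * (?a / r) * ?b + (\<delta>' - \<delta>) * (?b / (1 + r)) * ?a) * ?c + (-2) * (?c / r) * (?a * ?b)) (at r)"
    unfolding rad_weight_def[abs_def] c_fun_def[abs_def]
    using DERIV_mult[OF DERIV_mult[OF 1 2] 3] assms
    by (simp only: p[OF assms] p[of "1 + r"] add_pos_pos zero_less_one)
  moreover have "(\<delta> * (a / r) * b + (\<delta>' - \<delta>) * (b / (1 + r)) * a) * c + (-2) * (c / r) * (a * b)
      = (a * b * c) * (\<delta> + (\<delta>' - \<delta>) * (r / (1 + r)) - 2) / r" for a b c :: real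
    using assms by (simp add: divide_simps) (simp add: algebra_simps)
  ultimately show ?thesis
    unfolding c_slope_def rad_weight_def[of _ _ r] c_fun_def by simp
qed

lemma reg_denominator_pos: "0 < \<epsilon> \<Longrightarrow> 0 < 1 + \<epsilon> * (t::real)\<^sup>2"
  by (simp add: add_pos_nonneg)

lemma reg_weight_derivative:
  assumes "0 < r" "0 < \<epsilon>"
  shows "(reg_weight \<delta> \<delta>' \<epsilon> has_real_derivative reg_weight \<delta> \<delta>' \<epsilon> r * reg_slope \<delta> \<delta>' \<epsilon> r / r) (at r)"
proof -
  let ?c = "rad_weight \<delta> \<delta>' r" and ?d = "rad_weight \<delta> \<delta>' r * (c_slope \<delta> \<delta>' r - 2) / r"
  note D = reg_denominator_pos[OF assms(2), of ?c]
  have "(reg_weight \<delta> \<delta>' \<epsilon> has_real_derivative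
      (?d * (1 + \<epsilon> * ?c\<^sup>2) - ?c * (\<epsilon> * (2 * ?c * ?d))) / ((1 + \<epsilon> * ?c\<^sup>2) * (1 + \<epsilon> * ?c\<^sup>2))) (at r)"
    unfolding reg_weight_def[abs_def] using D
    by (auto intro!: derivative_eq_intros rad_weight_derivative[OF assms(1)] simp: power2_eq_square)
  moreover have "(c * (s - 2) / r * N - c * (\<epsilon> * (2 * c * (c * (s - 2) / r)))) / (N * N) = c / N * ((s - 2) * (M / N)) / r"
    if "N = 1 + \<epsilon> * c\<^sup>2" "M = 1 - \<epsilon> * c\<^sup>2" "0 < N" for c s N M :: real
  proof -
    have X: "c * (s - 2) / r * N - c * (\<epsilon> * (2 * c * (c * (s - 2) / r))) = c * (s - 2) / r * M"
      using assms(1) by (simp add: that(1,2) field_simps power2_eq_square)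
    show ?thesis unfolding X by (simp add: mult_ac)
  qed
  ultimately show ?thesis unfolding reg_slope_def reg_weight_def[of _ _ _ r] using D by simp
qed

lemma smooth_on_rad_weight: "smooth_on {0<..} (rad_weight \<delta> \<delta>')"
  unfolding rad_weight_def[abs_def]
  by (rule smooth_on_mult[OF open_greaterThan smooth_on_c_fun smooth_on_powr])

lemma smooth_on_reg_weight:
  assumes "0 < \<epsilon>" shows "smooth_on {0<..} (reg_weight \<delta> \<delta>' \<epsilon>)"
proof -
  note w = smooth_on_rad_weight[of \<delta> \<delta>']
  have "smooth_on {0<..} (\<lambda>r. 1 + \<epsilon> * (rad_weight \<delta> \<delta>' r * rad_weight \<delta> \<delta>' r))"
    by (intro smooth_on_add smooth_on_mult smooth_on_const w open_greaterThan)
  then have "smooth_on {0<..} (\<lambda>r. (1 + \<epsilon> * (rad_weight \<delta> \<delta>' r * rad_weight \<delta> \<delta>' r)) powr (-1))"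
    using reg_denominator_pos[OF assms]
    by (intro smooth_on_compose[OF open_greaterThan open_greaterThan _ smooth_on_powr]) (auto simp: power2_eq_square)
  then have "smooth_on {0<..} (\<lambda>r. rad_weight \<delta> \<delta>' r * (1 + \<epsilon> * (rad_weight \<delta> \<delta>' r * rad_weight \<delta> \<delta>' r)) powr (-1))"
    by (rule smooth_on_mult[OF open_greaterThan w])
  then show ?thesis
  proof (rule smooth_on_cong[OF open_greaterThan])
    show "rad_weight \<delta> \<delta>' r * (1 + \<epsilon> * (rad_weight \<delta> \<delta>' r * rad_weight \<delta> \<delta>' r)) powr (-1) = reg_weight \<delta> \<delta>' \<epsilon> r" for r
      using reg_denominator_pos[OF assms, of "rad_weight \<delta> \<delta>' r"]
      by (simp add: reg_weight_def powr_minus_divide power2_eq_square)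
  qed
qed

lemma smooth_on_c_slope: "smooth_on {0<..} (c_slope \<delta> \<delta>')"
proof -
  have "smooth_on {0<..} (\<lambda>r::real. 1 + r)"
    by (rule smooth_on_add[OF open_greaterThan smooth_on_const[OF open_greaterThan] smooth_on_linear[OF bounded_linear_ident open_greaterThan]])
  then have "smooth_on {0<..} (\<lambda>r::real. (1 + r) powr (-1))"
    by (intro smooth_on_compose[OF open_greaterThan open_greaterThan _ smooth_on_powr]) auto
  then have "smooth_on {0<..} (\<lambda>r::real. \<delta> + (\<delta>' - \<delta>) * (r * (1 + r) powr (-1)))"
    by (intro smooth_on_add[OF open_greaterThan] smooth_on_const[OF open_greaterThan]
        smooth_on_mult[OF open_greaterThan smooth_on_const[OF open_greaterThan]]
        smooth_on_mult[OF open_greaterThan smooth_on_linear[OF bounded_linear_ident open_greaterThan]])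
  then show ?thesis
    by (rule smooth_on_cong[OF open_greaterThan]) (simp add: c_slope_def powr_minus_divide)
qed

section \<open>Pointwise bounds for the weight and for the Hardy integrand\<close>

lemma reg_slope_square_le:
  assumes "0 < \<epsilon>" shows "(reg_slope \<delta> \<delta>' \<epsilon> r)\<^sup>2 \<le> (c_slope \<delta> \<delta>' r - 2)\<^sup>2"
proof -
  let ?e = "\<epsilon> * (rad_weight \<delta> \<delta>' r)\<^sup>2"
  have "0 \<le> ?e" using assms by simp
  then have "\<bar>(1 - ?e) / (1 + ?e)\<bar> \<le> 1" by (auto simp: divide_simps abs_if)
  then have "((1 - ?e) / (1 + ?e))\<^sup>2 \<le> 1" by (rule abs_square_le_1[THEN iffD2])
  then show ?thesis
    unfolding reg_slope_def power_mult_distrib by (rule mult_right_le_one_le[OF zero_le_power2 zero_le_power2])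
qed

lemma reg_weight_bounds:
  fixes \<delta> \<delta>' \<epsilon> r :: real
  assumes r: "0 < r" and \<epsilon>: "0 < \<epsilon>"
  defines "w \<equiv> reg_weight \<delta> \<delta>' \<epsilon> r" and "c \<equiv> rad_weight \<delta> \<delta>' r"
  shows "0 < w" "w \<le> c" "c * w \<le> 1 / \<epsilon>" "w \<le> 1 + 1 / \<epsilon>"
proof -
  have c: "0 < c" unfolding c_def by (rule rad_weight_pos[OF r])
  have D: "0 < 1 + \<epsilon> * c\<^sup>2" by (rule reg_denominator_pos[OF \<epsilon>])
  have w: "w = c / (1 + \<epsilon> * c\<^sup>2)" by (simp add: w_def c_def reg_weight_def)
  show w0: "0 < w" using c D by (simp add: w)
  have "c * 1 \<le> c * (1 + \<epsilon> * c\<^sup>2)" using c \<epsilon> by (intro mult_left_mono) auto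
  then show wc: "w \<le> c" using D by (simp add: w divide_simps)
  show cw: "c * w \<le> 1 / \<epsilon>" using D \<epsilon> by (simp add: w divide_simps) (simp add: algebra_simps power2_eq_square)
  \<comment> \<open>A bound on w without square roots: w <= 1 + w^2, and w^2 <= c w.\<close>
  have "w * w \<le> c * w" using wc w0 by (intro mult_right_mono) auto
  then have "w * w \<le> 1 / \<epsilon>" using cw by simp
  moreover have "w \<le> 1 + w * w" using sum_squares_bound[of w 1] by (simp add: power2_eq_square) (smt (verit) w0)
  ultimately show "w \<le> 1 + 1 / \<epsilon>" by simp
qed

text \<open>For \<delta> <= \<delta>' the slope is at least \<delta>, and the derivative term is
  nonnegative. For \<delta> > \<delta>' the derivative term is negative, but with t = r / (1 + r)
  the total excess is (\<delta> - \<delta>') (1 - t) (n - t) / 2, which is nonnegative because t <=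
  1 <= n.\<close>

lemma rellich_root_le:
  assumes r: "0 < r" and n: "1 \<le> n"
  shows "rellich_root n \<delta> \<delta>' \<le> n * (n + 2 * c_slope \<delta> \<delta>' r - 4) / 4 + r * ((\<delta>' - \<delta>) / (1 + r)\<^sup>2 / 2)"
proof (cases "\<delta> \<le> \<delta>'")
  case True
  have "\<delta> \<le> c_slope \<delta> \<delta>' r" using True r by (simp add: c_slope_def)
  then have "n * (n + 2 * \<delta> - 4) \<le> n * (n + 2 * c_slope \<delta> \<delta>' r - 4)" using n by (intro mult_left_mono) auto
  moreover have "0 \<le> r * ((\<delta>' - \<delta>) / (1 + r)\<^sup>2 / 2)" using True r by simp
  moreover have "min \<delta> \<delta>' = \<delta>" using True by simp
  ultimately show ?thesis unfolding rellich_root_def by linarith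
next
  case False
  define t where "t = r / (1 + r)"
  have t: "0 \<le> t" "t \<le> 1" "r * ((\<delta>' - \<delta>) / (1 + r)\<^sup>2 / 2) = (\<delta>' - \<delta>) * (t * (1 - t)) / 2"
    using r by (auto simp: t_def divide_simps power2_eq_square)
  have "n * (n + 2 * c_slope \<delta> \<delta>' r - 4) / 4 + r * ((\<delta>' - \<delta>) / (1 + r)\<^sup>2 / 2) - rellich_root n \<delta> \<delta>'
      = (\<delta> - \<delta>') * (1 - t) * (n - t) / 2"
    using False unfolding t(3) by (simp add: rellich_root_def c_slope_def t_def[symmetric] field_simps)
  also have "\<dots> \<ge> 0" using False t n by simp
  finally show ?thesis by simp
qed

text \<open>Here \<open>U\<close> and \<open>e\<close> stand for u and its radial derivative.
  Splitting off the square of e + (p + \<sigma> / 2) U cancels the terms linear in \<sigma>. What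
  remains is smallest at \<sigma>^2 = (s - 2)^2, where p^2 - (s - 2)^2 / 4 = n (n + 2s - 4) /
  4.\<close>

lemma hardy_pointwise:
  fixes n s \<sigma> p p' r A U e :: real
  assumes p: "p = (n - 2 + s) / 2" and \<sigma>: "\<sigma>\<^sup>2 \<le> (s - 2)\<^sup>2" and A: "A \<le> n * (n + 2 * s - 4) / 4 + r * p'"
  shows "A * U\<^sup>2 \<le> e\<^sup>2 + \<sigma> * U * e + 2 * p * U * e + (p * (n - 2 + s + \<sigma>) + r * p') * U\<^sup>2"
proof -
  have "e\<^sup>2 + \<sigma> * U * e + 2 * p * U * e + (p * (n - 2 + s + \<sigma>) + r * p') * U\<^sup>2
      = (e + (p + \<sigma> / 2) * U)\<^sup>2 + (p * (n - 2 + s) + r * p' - p\<^sup>2 - \<sigma>\<^sup>2 / 4) * U\<^sup>2"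
    by (simp add: power2_eq_square algebra_simps)
  moreover have "A \<le> p * (n - 2 + s) + r * p' - p\<^sup>2 - \<sigma>\<^sup>2 / 4"
  proof -
    have "p * (n - 2 + s) - p\<^sup>2 - (s - 2)\<^sup>2 / 4 = n * (n + 2 * s - 4) / 4"
      unfolding p by (simp add: power2_eq_square field_simps)
    then show ?thesis using A \<sigma> by linarith
  qed
  then have "A * U\<^sup>2 \<le> (p * (n - 2 + s) + r * p' - p\<^sup>2 - \<sigma>\<^sup>2 / 4) * U\<^sup>2"
    by (rule mult_right_mono) simp
  ultimately show ?thesis by (smt (verit) zero_le_power2)
qed

context bounded_coefficient
begin

text \<open>With \<open>\<chi> = c / r\<^sup>2\<close>, the divergence of the radial field \<open>\<chi> w p u\<^sup>2 x\<^sub>1\<close> completes the integrand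
  of the form to a square; \<open>p = (n - 2 + s) / 2\<close> is the optimal choice of Hardy.\<close>

lemma form_lower_bound:
  fixes u :: "'a \<times> 'b::euclidean_space \<Rightarrow> real"
  assumes u: "u \<in> test_functions Omega" and \<epsilon>: "0 < \<epsilon>"
    and A: "0 \<le> rellich_root (real DIM('a)) \<delta> \<delta>'"
  defines "wu \<equiv> \<lambda>x. reg_weight \<delta> \<delta>' \<epsilon> (norm (fst x)) * u x"
  shows "wu \<in> test_functions Omega"
    and "rellich_root (real DIM('a)) \<delta> \<delta>' * (\<integral>x. (wu x)\<^sup>2 \<partial>lborel) \<le> grushin_inner \<delta> \<delta>' \<beta> u wu"
proof -
  let ?n = "real DIM('a)" and ?A = "rellich_root (real DIM('a)) \<delta> \<delta>'"
  note d = test_function_differentiable[OF u]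
  show wu: "wu \<in> test_functions Omega" unfolding wu_def
    by (rule test_function_mult[OF open_Omega u smooth_on_radial[OF smooth_on_reg_weight[OF \<epsilon>]]])
  define p where "p r = (?n - 2 + c_slope \<delta> \<delta>' r) / 2" for r
  define g where "g r = rad_weight \<delta> \<delta>' r * reg_weight \<delta> \<delta>' \<epsilon> r * p r" for r
  define uu where "uu x = u x * u x" for x
  \<comment> \<open>The field is x1 f. By \<open>integral_euler\<close> the integral of
    \<open>euler f\<close> plus n f is zero, so adding it to the integrand does not change the
    form.\<close>
  define f where "f x = g (norm (fst x)) * uu x" for x
  have uu: "uu \<in> test_functions Omega" unfolding uu_def[abs_def] by (rule test_function_times[OF open_Omega u u])
  have smp: "smooth_on {0<..} p"
  proof -
    have "smooth_on {0<..} (\<lambda>r. (1/2) * ((?n - 2) + c_slope \<delta> \<delta>' r))"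
      by (intro smooth_on_add smooth_on_mult smooth_on_const smooth_on_c_slope open_greaterThan)
    then show ?thesis by (rule smooth_on_cong[OF open_greaterThan]) (simp add: p_def)
  qed
  have f: "f \<in> test_functions Omega" unfolding f_def[abs_def] g_def
    by (rule test_function_mult[OF open_Omega uu smooth_on_radial[of "\<lambda>r. rad_weight \<delta> \<delta>' r * reg_weight \<delta> \<delta>' \<epsilon> r * p r"]])
      (intro smooth_on_mult smooth_on_rad_weight smooth_on_reg_weight[OF \<epsilon>] smp open_greaterThan)
  have pt: "?A * (wu x)\<^sup>2 \<le> c_Omega \<delta> \<delta>' x * grad1_prod u wu x + (euler f x + ?n * f x)" for x
  proof (cases "x \<in> Omega")
    case False
    have "euler f x = 0" unfolding euler_def
      by (rule test_function_outside[OF test_function_dird[OF open_Omega f] False])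
    then show ?thesis
      using test_function_outside[OF f False] test_function_outside[OF wu False] grad_prod_outside(1)[OF u wu False] by simp
  next
    case True
    define r where "r = norm (fst x)"
    have r: "0 < r" using True by (simp add: r_def Omega_iff)
    define c where "c = rad_weight \<delta> \<delta>' r"
    define w where "w = reg_weight \<delta> \<delta>' \<epsilon> r"
    define s where "s = c_slope \<delta> \<delta>' r"
    define \<sigma> where "\<sigma> = reg_slope \<delta> \<delta>' \<epsilon> r"
    define p' where "p' = (\<delta>' - \<delta>) / (1 + r)\<^sup>2 / 2"
    define e where "e = euler u x"
    define G where "G = grad1_prod u u x"
    have c0: "0 < c" unfolding c_def by (rule rad_weight_pos[OF r])
    note wb = reg_weight_bounds[OF r \<epsilon>, of \<delta> \<delta>', folded c_def w_def]
    have dw: "(reg_weight \<delta> \<delta>' \<epsilon> has_real_derivative w * \<sigma> / r) (at (norm (fst x)))"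
      using reg_weight_derivative[OF r \<epsilon>] by (simp add: r_def w_def \<sigma>_def)
    have dp: "(p has_real_derivative p') (at r)"
      unfolding p_def[abs_def] p'_def
      using DERIV_cdivide[OF DERIV_add[OF DERIV_const c_slope_derivative[OF r]]] by simp
    have dg: "(g has_real_derivative (c * w * (p r * (s - 2 + \<sigma>) + r * p') / r)) (at (norm (fst x)))"
    proof -
      have "(g has_real_derivative (c * (s - 2) / r * w + w * \<sigma> / r * c) * p r + p' * (c * w)) (at r)"
        unfolding g_def[abs_def]
        using DERIV_mult[OF DERIV_mult[OF rad_weight_derivative[OF r] reg_weight_derivative[OF r \<epsilon>]] dp]
        by (simp add: c_def w_def s_def \<sigma>_def)
      moreover have "(c * (s - 2) / r * w + w * \<sigma> / r * c) * p r + p' * (c * w) = c * w * (p r * (s - 2 + \<sigma>) + r * p') / r"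
        using r by (simp add: field_simps)
      ultimately show ?thesis by (simp add: r_def)
    qed
    have g1: "grad1_prod u wu x = w * G + w * \<sigma> / r / r * u x * e"
      unfolding wu_def w_def r_def G_def e_def
      using grad_prod_radial_mult(1)[OF True dw d] by (simp add: w_def r_def)
    have ef: "euler f x = g r * (2 * u x * e) + c * w * (p r * (s - 2 + \<sigma>) + r * p') * (u x)\<^sup>2"
    proof -
      have "euler uu x = 2 * u x * e"
        unfolding uu_def[abs_def] euler_def e_def dird_mult[OF d d] by simp
      moreover have "euler f x = g r * euler uu x + c * w * (p r * (s - 2 + \<sigma>) + r * p') / r * r * uu x"
        unfolding f_def[abs_def] r_def
        using grad_prod_radial_mult(5)[OF True dg test_function_differentiable[OF uu]] by (simp add: r_def)
      ultimately show ?thesis using r by (simp add: uu_def power2_eq_square)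
    qed
    have cO: "c_Omega \<delta> \<delta>' x = c * r\<^sup>2"
      unfolding c_Omega_radial r_def[symmetric] c_def by (rule rad_weight_square[OF r])
    have "e\<^sup>2 \<le> r\<^sup>2 * G" unfolding e_def r_def G_def by (rule euler_square_le[OF d])
    then have "c * w * e\<^sup>2 \<le> c * w * (r\<^sup>2 * G)" using c0 wb(1) by (intro mult_left_mono) auto
    moreover have "c_Omega \<delta> \<delta>' x * grad1_prod u wu x = c * w * (r\<^sup>2 * G) + c * w * (\<sigma> * u x * e)"
      unfolding cO g1 using r by (simp add: power2_eq_square algebra_simps)
    ultimately have "c * w * (e\<^sup>2 + \<sigma> * u x * e) \<le> c_Omega \<delta> \<delta>' x * grad1_prod u wu x"
      by (simp add: distrib_left)
    moreover have "euler f x + ?n * f x = c * w * (2 * p r * u x * e + (p r * (?n - 2 + s + \<sigma>) + r * p') * (u x)\<^sup>2)"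
      unfolding ef unfolding f_def r_def[symmetric] uu_def g_def c_def[symmetric] w_def[symmetric]
      by (simp add: power2_eq_square algebra_simps)
    moreover have "c * w * (?A * (u x)\<^sup>2) \<le> c * w * (e\<^sup>2 + \<sigma> * u x * e + 2 * p r * u x * e + (p r * (?n - 2 + s + \<sigma>) + r * p') * (u x)\<^sup>2)"
    proof (intro mult_left_mono hardy_pointwise)
      show "p r = (?n - 2 + s) / 2" by (simp add: p_def s_def)
      show "\<sigma>\<^sup>2 \<le> (s - 2)\<^sup>2" unfolding \<sigma>_def s_def by (rule reg_slope_square_le[OF \<epsilon>])
      show "?A \<le> ?n * (?n + 2 * s - 4) / 4 + r * p'"
        unfolding s_def p'_def by (rule rellich_root_le[OF r]) (simp add: DIM_positive Suc_leI)
    qed (use c0 wb in simp)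
    \<comment> \<open>One factor c is lowered to w, so that the square of w u appears; the sign of
      the root enters here.\<close>
    moreover have "?A * (wu x)\<^sup>2 \<le> c * w * (?A * (u x)\<^sup>2)"
    proof -
      have "w * w \<le> c * w" using wb by (intro mult_right_mono) auto
      then have "w * w * (?A * (u x)\<^sup>2) \<le> c * w * (?A * (u x)\<^sup>2)"
        by (rule mult_right_mono[OF _ mult_nonneg_nonneg[OF A zero_le_power2]])
      then show ?thesis by (simp add: wu_def w_def r_def power2_eq_square mult_ac)
    qed
    ultimately show ?thesis by (simp add: distrib_left add.assoc)
  qed
  note Iw = test_function_integrable[OF test_function_times[OF open_Omega wu wu]]
  note I1 = integrable_c[OF test_function_grad_prod(1)[OF u wu], of \<delta> \<delta>']
  note Ie = integral_euler[OF f] and If = test_function_integrable[OF f]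
  have "?A * (\<integral>x. (wu x)\<^sup>2 \<partial>lborel) = (\<integral>x. ?A * (wu x)\<^sup>2 \<partial>lborel)" by simp
  also have "\<dots> \<le> (\<integral>x. c_Omega \<delta> \<delta>' x * grad1_prod u wu x + (euler f x + ?n * f x) \<partial>lborel)"
    using Iw I1 Ie(1) If pt by (intro integral_mono) (auto simp: power2_eq_square)
  also have "\<dots> = (\<integral>x. c_Omega \<delta> \<delta>' x * grad1_prod u wu x \<partial>lborel)"
    using I1 Ie If by simp
  also have "\<dots> \<le> grushin_inner \<delta> \<delta>' \<beta> u wu"
  proof -
    have "0 \<le> \<beta> (fst x) * grad2_prod u wu x" for x
    proof (cases "x \<in> Omega")
      case True
      then have r: "0 < norm (fst x)" by (simp add: Omega_iff)
      have "grad2_prod u wu x = reg_weight \<delta> \<delta>' \<epsilon> (norm (fst x)) * grad2_prod u u x"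
        unfolding wu_def by (rule grad_prod_radial_mult(2)[OF True reg_weight_derivative[OF r \<epsilon>] d])
      moreover have "0 \<le> grad2_prod u u x" unfolding grad2_prod_def by (intro sum_nonneg) simp
      ultimately show ?thesis
        using \<beta>_nonneg[of "fst x"] reg_weight_bounds(1)[OF r \<epsilon>, of \<delta> \<delta>'] by simp
    qed (simp add: grad_prod_outside[OF u wu])
    then have "0 \<le> (\<integral>x. \<beta> (fst x) * grad2_prod u wu x \<partial>lborel)" by simp
    then show ?thesis by (simp add: grushin_inner_def)
  qed
  finally show "?A * (\<integral>x. (wu x)\<^sup>2 \<partial>lborel) \<le> grushin_inner \<delta> \<delta>' \<beta> u wu" .
qed

text \<open>\<open>operator_approx\<close> accepts only test sequences with bounded forms; this
  supplies the bound for w u_n. The cross term in the gradient of w u is absorbed by 2ab <= a^2 +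
  b^2, which doubles the two remaining terms. \<open>K\<close> depends on \<epsilon> but not on
  u.\<close>

lemma form_reg_weight_le:
  fixes u :: "'a \<times> 'b::euclidean_space \<Rightarrow> real"
  assumes u: "u \<in> test_functions Omega" and \<epsilon>: "0 < \<epsilon>" and \<delta>: "0 \<le> \<delta>" "0 \<le> \<delta>'"
  defines "wu \<equiv> \<lambda>x. reg_weight \<delta> \<delta>' \<epsilon> (norm (fst x)) * u x"
    and "K \<equiv> 2 * (1 + 1 / \<epsilon>)\<^sup>2 + 2 * (1 / \<epsilon> * (1 + 1 / \<epsilon>) * (\<delta> + \<delta>' + 2)\<^sup>2)"
  shows "grushin_inner \<delta> \<delta>' \<beta> wu wu \<le> K * (grushin_inner \<delta> \<delta>' \<beta> u u + (\<integral>x. (u x)\<^sup>2 \<partial>lborel))"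
    and "0 \<le> grushin_inner \<delta> \<delta>' \<beta> u u"
proof -
  note d = test_function_differentiable[OF u]
  have wu: "wu \<in> test_functions Omega" unfolding wu_def
    by (rule test_function_mult[OF open_Omega u smooth_on_radial[OF smooth_on_reg_weight[OF \<epsilon>]]])
  define K1 where "K1 = 2 * (1 + 1 / \<epsilon>)\<^sup>2"
  define K2 where "K2 = 2 * (1 / \<epsilon> * (1 + 1 / \<epsilon>) * (\<delta> + \<delta>' + 2)\<^sup>2)"
  have K: "K = K1 + K2" "0 \<le> K1" "0 \<le> K2" using \<epsilon> by (auto simp: K_def K1_def K2_def)
  have G0: "0 \<le> grad1_prod u u x" "0 \<le> grad2_prod u u x" for x
    unfolding grad1_prod_def grad2_prod_def by (intro sum_nonneg; simp)+
  have c0: "0 \<le> c_Omega \<delta> \<delta>' x" for x :: "'a \<times> 'b" by (simp add: c_Omega_radial c_fun_nonneg)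
  have pt: "c_Omega \<delta> \<delta>' x * grad1_prod wu wu x \<le> K1 * (c_Omega \<delta> \<delta>' x * grad1_prod u u x) + K2 * (u x)\<^sup>2 \<and>
      \<beta> (fst x) * grad2_prod wu wu x \<le> K1 * (\<beta> (fst x) * grad2_prod u u x)" for x
  proof (cases "x \<in> Omega")
    case False
    then show ?thesis using grad_prod_outside[OF u u False] grad_prod_outside[OF wu wu False] K by simp
  next
    case True
    define r where "r = norm (fst x)"
    have r: "0 < r" using True by (simp add: r_def Omega_iff)
    define c where "c = rad_weight \<delta> \<delta>' r"
    define w where "w = reg_weight \<delta> \<delta>' \<epsilon> r"
    define s where "s = c_slope \<delta> \<delta>' r"
    define \<sigma> where "\<sigma> = reg_slope \<delta> \<delta>' \<epsilon> r"
    define e where "e = euler u x"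
    define G where "G = grad1_prod u u x"
    have cp: "0 < c" unfolding c_def by (rule rad_weight_pos[OF r])
    note wb = reg_weight_bounds[OF r \<epsilon>, of \<delta> \<delta>', folded c_def w_def]
    have dw: "(reg_weight \<delta> \<delta>' \<epsilon> has_real_derivative w * \<sigma> / r) (at (norm (fst x)))"
      using reg_weight_derivative[OF r \<epsilon>] by (simp add: r_def w_def \<sigma>_def)
    have cO: "c_Omega \<delta> \<delta>' x = c * r\<^sup>2"
      unfolding c_Omega_radial r_def[symmetric] c_def by (rule rad_weight_square[OF r])
    have w2: "w\<^sup>2 \<le> (1 + 1 / \<epsilon>)\<^sup>2" using wb by (intro power_mono) auto
    have e2: "e\<^sup>2 \<le> r\<^sup>2 * G" unfolding e_def r_def G_def by (rule euler_square_le[OF d])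
    have "grad1_prod wu wu x = w\<^sup>2 * G + 2 * (w * (w * \<sigma> / r) / r * u x * e) + (w * \<sigma> / r * u x)\<^sup>2"
      unfolding wu_def w_def r_def G_def e_def
      using grad_prod_radial_mult(3)[OF True dw d] by (simp add: w_def r_def)
    then have "c_Omega \<delta> \<delta>' x * grad1_prod wu wu x = c * w\<^sup>2 * (r\<^sup>2 * G) + c * w\<^sup>2 * (2 * (\<sigma> * u x) * e + (\<sigma> * u x)\<^sup>2)"
      unfolding cO using r by (simp add: field_simps power2_eq_square)
    also have "\<dots> \<le> c * w\<^sup>2 * (r\<^sup>2 * G) + c * w\<^sup>2 * (e\<^sup>2 + 2 * (\<sigma> * u x)\<^sup>2)"
      using cp sum_squares_bound[of "\<sigma> * u x" e] by (intro add_left_mono mult_left_mono) auto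
    also have "\<dots> \<le> c * w\<^sup>2 * (r\<^sup>2 * G) + c * w\<^sup>2 * (r\<^sup>2 * G + 2 * (\<sigma> * u x)\<^sup>2)"
      using cp e2 by (intro add_left_mono mult_left_mono) auto
    also have "\<dots> = 2 * (w\<^sup>2 * (c * r\<^sup>2 * G)) + 2 * ((c * w) * w * \<sigma>\<^sup>2) * (u x)\<^sup>2"
      by (simp add: algebra_simps power2_eq_square)
    also have "\<dots> \<le> 2 * ((1 + 1 / \<epsilon>)\<^sup>2 * (c * r\<^sup>2 * G)) + 2 * (1 / \<epsilon> * (1 + 1 / \<epsilon>) * (\<delta> + \<delta>' + 2)\<^sup>2) * (u x)\<^sup>2"
    proof (intro add_mono mult_left_mono mult_right_mono mult_mono)
      show "\<sigma>\<^sup>2 \<le> (\<delta> + \<delta>' + 2)\<^sup>2"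
      proof (rule order_trans)
        show "\<sigma>\<^sup>2 \<le> (s - 2)\<^sup>2" unfolding \<sigma>_def s_def by (rule reg_slope_square_le[OF \<epsilon>])
        \<comment> \<open>The slope is a convex combination of \<delta> and \<delta>', with weights
          1 - t and t.\<close>
        define t where "t = r / (1 + r)"
        have t: "0 \<le> t" "t \<le> 1" using r by (auto simp: t_def)
        have st: "s = \<delta> * (1 - t) + \<delta>' * t" unfolding s_def c_slope_def t_def[symmetric] by (simp add: algebra_simps)
        have "0 \<le> \<delta> * (1 - t)" "\<delta> * (1 - t) \<le> \<delta>" "0 \<le> \<delta>' * t" "\<delta>' * t \<le> \<delta>'"
          using \<delta> t by (auto intro: mult_left_le)
        then have "\<bar>s - 2\<bar> \<le> \<bar>\<delta> + \<delta>' + 2\<bar>" unfolding st using \<delta> by linarith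
        then show "(s - 2)\<^sup>2 \<le> (\<delta> + \<delta>' + 2)\<^sup>2" by (simp add: abs_le_square_iff)
      qed
    qed (use wb w2 cp G0 \<epsilon> G_def in auto)
    finally have 1: "c_Omega \<delta> \<delta>' x * grad1_prod wu wu x \<le> K1 * (c_Omega \<delta> \<delta>' x * G) + K2 * (u x)\<^sup>2"
      unfolding cO K1_def K2_def by (simp add: mult.assoc)
    have "grad2_prod wu wu x = w\<^sup>2 * grad2_prod u u x"
      unfolding wu_def w_def r_def by (rule grad_prod_radial_mult(4)[OF True dw d])
    also have "\<dots> \<le> K1 * grad2_prod u u x"
      using G0(2)[of x] unfolding K1_def
      by (intro mult_right_mono) (use w2 zero_le_power2[of "1 + 1 / \<epsilon>"] in linarith)
    finally have "\<beta> (fst x) * grad2_prod wu wu x \<le> \<beta> (fst x) * (K1 * grad2_prod u u x)"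
      using \<beta>_nonneg by (intro mult_left_mono)
    then show ?thesis using 1 by (simp add: G_def mult_ac)
  qed
  note I1 = integrable_c[OF test_function_grad_prod(1)[OF u u], of \<delta> \<delta>'] integrable_\<beta>[OF test_function_grad_prod(2)[OF u u]]
  note I2 = integrable_c[OF test_function_grad_prod(1)[OF wu wu], of \<delta> \<delta>'] integrable_\<beta>[OF test_function_grad_prod(2)[OF wu wu]]
  have Iu: "integrable lborel (\<lambda>x. (u x)\<^sup>2)"
    using test_function_integrable[OF test_function_times[OF open_Omega u u]] by (simp add: power2_eq_square)
  have "(\<integral>x. c_Omega \<delta> \<delta>' x * grad1_prod wu wu x \<partial>lborel) \<le> (\<integral>x. K1 * (c_Omega \<delta> \<delta>' x * grad1_prod u u x) + K2 * (u x)\<^sup>2 \<partial>lborel)"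
    using I1 I2 Iu pt by (intro integral_mono) auto
  also have "\<dots> = K1 * (\<integral>x. c_Omega \<delta> \<delta>' x * grad1_prod u u x \<partial>lborel) + K2 * (\<integral>x. (u x)\<^sup>2 \<partial>lborel)"
    using I1 Iu by simp
  finally have 1: "(\<integral>x. c_Omega \<delta> \<delta>' x * grad1_prod wu wu x \<partial>lborel) \<le> \<dots>" .
  have "(\<integral>x. \<beta> (fst x) * grad2_prod wu wu x \<partial>lborel) \<le> (\<integral>x. K1 * (\<beta> (fst x) * grad2_prod u u x) \<partial>lborel)"
    using I1 I2 pt by (intro integral_mono) auto
  also have "\<dots> = K1 * (\<integral>x. \<beta> (fst x) * grad2_prod u u x \<partial>lborel)" by simp
  finally have 2: "(\<integral>x. \<beta> (fst x) * grad2_prod wu wu x \<partial>lborel) \<le> \<dots>" .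
  have n1: "0 \<le> (\<integral>x. c_Omega \<delta> \<delta>' x * grad1_prod u u x \<partial>lborel)" using G0 c0 by simp
  have n2: "0 \<le> (\<integral>x. \<beta> (fst x) * grad2_prod u u x \<partial>lborel)" using G0 \<beta>_nonneg by simp
  show q0: "0 \<le> grushin_inner \<delta> \<delta>' \<beta> u u" unfolding grushin_inner_def using n1 n2 by simp
  have n3: "0 \<le> (\<integral>x. (u x)\<^sup>2 \<partial>lborel)" by simp
  have "grushin_inner \<delta> \<delta>' \<beta> wu wu \<le> K1 * grushin_inner \<delta> \<delta>' \<beta> u u + K2 * (\<integral>x. (u x)\<^sup>2 \<partial>lborel)"
    unfolding grushin_inner_def using 1 2 by (simp add: distrib_left)
  also have "\<dots> \<le> K * grushin_inner \<delta> \<delta>' \<beta> u u + K * (\<integral>x. (u x)\<^sup>2 \<partial>lborel)"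
    using K q0 n3 by (intro add_mono mult_right_mono) auto
  finally show "grushin_inner \<delta> \<delta>' \<beta> wu wu \<le> K * (grushin_inner \<delta> \<delta>' \<beta> u u + (\<integral>x. (u x)\<^sup>2 \<partial>lborel))"
    by (simp add: distrib_left)
qed

end

section \<open>The Rellich inequality on the operator domain\<close>

text \<open>\<open>b\<close> is Lebesgue measurable in x1, while composition with \<open>fst\<close>
  and the translation argument ask for Borel functions. A Borel version is truncated to [0, |C|],
  which changes nothing where it agrees with \<open>b\<close>; the exceptional set times the whole
  x2-space is null, so the forms coincide.\<close>

lemma bounded_borel_version:
  fixes b :: "'a::euclidean_space \<Rightarrow> real"
  assumes meas: "b \<in> borel_measurable (lebesgue_on (- {0}))" and pos: "\<forall>y\<in>- {0}. 0 < b y"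
    and bdd: "bounded (b ` (- {0}))"
  obtains \<beta> C where "bounded_coefficient \<beta> C"
    "\<And>u :: 'a \<times> 'b::euclidean_space \<Rightarrow> real. u \<in> test_functions Omega \<Longrightarrow> grushin_form \<delta> \<delta>' b u = grushin_form \<delta> \<delta>' \<beta> u"
proof -
  obtain C where C: "\<And>y. y \<noteq> 0 \<Longrightarrow> \<bar>b y\<bar> \<le> C"
    using bdd by (auto simp: bounded_iff)
  have "(\<lambda>y. if y \<in> - {0} then b y else 0) \<in> borel_measurable lebesgue"
    using meas by (intro borel_measurable_if_I) auto
  then obtain g where g: "g \<in> borel_measurable lborel"
    and ae: "AE y in lborel. (if y \<in> - {0} then b y else 0) = g y"
    using completion_ex_borel_measurable_real by blast
  define \<beta> where "\<beta> y = max 0 (min \<bar>C\<bar> (g y))" for y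
  have coeff: "bounded_coefficient \<beta> \<bar>C\<bar>"
    using g by unfold_locales (auto simp: \<beta>_def[abs_def])
  obtain N where N: "N \<in> null_sets lborel" "\<And>y. y \<notin> N \<Longrightarrow> (if y \<in> - {0} then b y else 0) = g y"
    using ae by (auto elim!: AE_E3)
  have eq: "b y = \<beta> y" if "y \<notin> N" "y \<noteq> 0" for y
  proof -
    have "g y = b y" using N(2)[OF that(1)] that(2) by simp
    moreover have "0 < b y" using pos that(2) by simp
    ultimately show ?thesis using C[OF that(2)] unfolding \<beta>_def by linarith
  qed
  have "N \<times> UNIV \<in> null_sets (lborel :: ('a \<times> 'b) measure)"
  proof -
    have "emeasure (lborel \<Otimes>\<^sub>M lborel) (N \<times> (UNIV :: 'b set)) = emeasure lborel N * emeasure lborel (UNIV :: 'b set)"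
      using N(1) by (intro lborel.emeasure_pair_measure_Times) auto
    \<comment> \<open>The second factor is the infinite measure of the whole space; its product with
      0 is 0 in \<open>ennreal\<close>.\<close>
    then have "emeasure (lborel :: ('a \<times> 'b) measure) (N \<times> UNIV) = 0"
      using N(1) by (simp add: lborel_prod null_setsD1)
    moreover have "N \<times> (UNIV :: 'b set) \<in> sets (lborel \<Otimes>\<^sub>M lborel)"
      using N(1) by (intro pair_measureI) auto
    ultimately show ?thesis unfolding lborel_prod null_sets_def by simp
  qed
  then have "AE x in (lborel :: ('a \<times> 'b) measure). x \<notin> N \<times> UNIV" by (rule AE_not_in)
  then have aeN: "AE x in (lebesgue :: ('a \<times> 'b) measure). x \<notin> N \<times> UNIV" by (rule AE_completion)
  have "grushin_form \<delta> \<delta>' b u = grushin_form \<delta> \<delta>' \<beta> u" if u: "u \<in> test_functions Omega" for u :: "'a \<times> 'b \<Rightarrow> real"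
  proof -
    interpret bounded_coefficient \<beta> "\<bar>C\<bar>" by (rule coeff)
    note d = test_function_differentiable[OF u]
    have m0: "(\<lambda>x. \<beta> (fst x) * grad2_prod u u x) \<in> borel_measurable (borel :: ('a \<times> 'b) measure)"
      by (intro borel_measurable_times \<beta>_fst test_function_borel[OF test_function_grad_prod(2)[OF u u]])
    have "indicat_real (Omega :: ('a \<times> 'b) set) \<in> borel_measurable borel"
      using borel_open[OF open_Omega] by (rule borel_measurable_indicator)
    from borel_measurable_times[OF this m0]
    have m: "(\<lambda>x. indicator Omega x *\<^sub>R (\<beta> (fst x) * grad2_prod u u x)) \<in> borel_measurable lebesgue"
      by (intro measurable_completion) simp
    have ae: "AE x in lebesgue. indicator Omega x *\<^sub>R (\<beta> (fst x) * grad2_prod u u x) = indicator Omega x *\<^sub>R (b (fst x) * grad2_prod u u x)"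
      using aeN
    proof eventually_elim
      case (elim x)
      then show ?case using eq[of "fst x"] by (cases x) (auto simp: indicator_def Omega_iff)
    qed
    have "(\<integral>x. b (fst x) * grad2_prod u u x \<partial>lebesgue_on Omega) = (\<integral>x. \<beta> (fst x) * grad2_prod u u x \<partial>lebesgue_on Omega)"
      unfolding integral_restrict_space[OF Omega_in_sets_lebesgue]
      by (rule integral_cong_AE[OF borel_measurable_AE[OF m ae] m]) (use ae in \<open>eventually_elim, metis\<close>)
    then show ?thesis
      unfolding grushin_form_def inner_scaleR_right grad_prod_eq[OF d d] by simp
  qed
  with coeff show ?thesis by (rule that)
qed

text \<open>The closure evaluates the form only at members of a core sequence and at their
  differences.\<close>

lemma form_closure_cong:
  assumes "\<And>u v. u \<in> D \<Longrightarrow> v \<in> D \<Longrightarrow> (\<lambda>x. u x - v x) \<in> D" "\<And>u. u \<in> D \<Longrightarrow> q u = q' u"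
  shows "form_closure M D q = form_closure M D q'"
proof -
  have *: "r \<in> form_closure M D q'" if r: "r \<in> form_closure M D q"
    and q: "\<And>u. u \<in> D \<Longrightarrow> q u = q' u" for r and q q' :: "('a \<Rightarrow> real) \<Rightarrow> real"
  proof -
    obtain \<phi> t u where u: "r = (\<phi>, t)" "\<phi> \<in> L2 M" "\<forall>n. u n \<in> D" "(\<lambda>n. l2_norm M (\<lambda>x. u n x - \<phi> x)) \<longlonglongrightarrow> 0"
      "\<forall>e>0. \<exists>N. \<forall>m\<ge>N. \<forall>n\<ge>N. q (\<lambda>x. u m x - u n x) < e" "(\<lambda>n. q (u n)) \<longlonglongrightarrow> t"
      using r unfolding form_closure_def by blast
    have "q (\<lambda>x. u m x - u n x) = q' (\<lambda>x. u m x - u n x)" "q (u n) = q' (u n)" for m n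
      using u(3) assms(1) q by auto
    with u show ?thesis unfolding form_closure_def by auto
  qed
  show ?thesis using *[of _ q q'] *[of _ q' q] assms(2) by auto
qed

text \<open>The differential expression of H on test functions. \<beta> stands outside the
  derivatives because it depends on x1 only, where it may fail to be differentiable.\<close>

definition grushin_apply ::
    "real \<Rightarrow> real \<Rightarrow> ('a::euclidean_space \<Rightarrow> real) \<Rightarrow> ('a \<times> 'b::euclidean_space \<Rightarrow> real) \<Rightarrow> 'a \<times> 'b \<Rightarrow> real" where
  "grushin_apply \<delta> \<delta>' \<beta> u x =
     - (\<Sum>i\<in>Basis. dird (i, 0) (\<lambda>x. c_Omega \<delta> \<delta>' x * dird (i, 0) u x) x)
     - \<beta> (fst x) * (\<Sum>j\<in>Basis. dird (0, j) (dird (0, j) u) x)"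

locale grushin = bounded_coefficient \<beta> C for \<beta> :: "'a::euclidean_space \<Rightarrow> real" and C :: real +
  fixes \<delta> \<delta>' :: real and H :: "(('a \<times> 'b::euclidean_space \<Rightarrow> real) \<times> ('a \<times> 'b \<Rightarrow> real)) set"
  assumes \<delta>: "0 \<le> \<delta>" "0 \<le> \<delta>'" and grushin_H: "grushin_operator \<delta> \<delta>' \<beta> H"
begin

lemma square_root:
  obtains S where "closed_form_operator (lebesgue_on Omega) (test_functions Omega) (grushin_form \<delta> \<delta>' \<beta>) H S"
proof -
  obtain S where S: "positive_self_adjoint (lebesgue_on Omega) S" "S O S = H"
    "form_closure (lebesgue_on Omega) (test_functions Omega) (grushin_form \<delta> \<delta>' \<beta>)
       = {(\<phi>, (l2_norm (lebesgue_on Omega) \<psi>)\<^sup>2) | \<phi> \<psi>. (\<phi>, \<psi>) \<in> S}"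
    using grushin_H unfolding grushin_operator_def associated_operator_def by blast
  have "grushin_form \<delta> \<delta>' \<beta> (\<lambda>x. 0) = 0"
    unfolding grushin_form_eq[OF test_function_zero[OF open_Omega]]
    by (simp add: grushin_inner_def grad1_prod_def grad2_prod_def dird_eqI[OF has_derivative_const])
  then have "closed_form_operator (lebesgue_on Omega) (test_functions Omega) (grushin_form \<delta> \<delta>' \<beta>) H S"
    using S by unfold_locales (auto intro: test_function_L2 test_function_add[OF open_Omega] test_function_diff[OF open_Omega])
  then show ?thesis by (rule that)
qed

text \<open>The bound of \<open>form_lower_bound\<close> is carried to \<phi> along test functions
  u_n. The products w u_n have bounded forms by \<open>form_reg_weight_le\<close>, hence form a
  legitimate test sequence for \<open>operator_approx\<close>.\<close>

lemma reg_weight_inequality: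
  assumes \<phi>: "(\<phi>, \<eta>) \<in> H" and A: "0 < rellich_root (real DIM('a)) \<delta> \<delta>'" and \<epsilon>: "0 < \<epsilon>"
  defines "w\<phi> \<equiv> \<lambda>x. reg_weight \<delta> \<delta>' \<epsilon> (norm (fst x)) * \<phi> x"
  shows "w\<phi> \<in> L2 (lebesgue_on Omega)"
    and "(rellich_root (real DIM('a)) \<delta> \<delta>')\<^sup>2 * l2_inner (lebesgue_on Omega) w\<phi> w\<phi> \<le> l2_inner (lebesgue_on Omega) \<eta> \<eta>"
proof -
  let ?M = "lebesgue_on (Omega :: ('a \<times> 'b) set)" and ?A = "rellich_root (real DIM('a)) \<delta> \<delta>'"
  let ?q = "grushin_form \<delta> \<delta>' \<beta> :: ('a \<times> 'b \<Rightarrow> real) \<Rightarrow> real"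
  obtain S where "closed_form_operator ?M (test_functions Omega) ?q H S" by (rule square_root)
  then interpret closed_form_operator ?M "test_functions Omega" ?q H S .
  define w where "w x = reg_weight \<delta> \<delta>' \<epsilon> (norm (fst x))" for x :: "'a \<times> 'b"
  have sw: "smooth_on Omega w" unfolding w_def[abs_def]
    by (rule smooth_on_radial[OF smooth_on_reg_weight[OF \<epsilon>]])
  have wm: "w \<in> borel_measurable ?M"
    using Omega_in_sets_lebesgue by (intro continuous_imp_measurable_on_sets_lebesgue smooth_on_continuous[OF sw]) simp
  have wb: "\<bar>w x\<bar> \<le> 1 + 1 / \<epsilon>" if "x \<in> space ?M" for x
    using that reg_weight_bounds(1,4)[of "norm (fst x)" \<epsilon> \<delta> \<delta>'] \<epsilon>
    by (simp add: w_def space_restrict_space Omega_iff)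
  obtain u where L: "\<phi> \<in> L2 ?M" "\<eta> \<in> L2 ?M" and "\<forall>n. u n \<in> test_functions Omega"
    and lim: "(\<lambda>n. l2_norm ?M (\<lambda>x. u n x - \<phi> x)) \<longlonglongrightarrow> 0" and bu: "Bseq (\<lambda>n. ?q (u n))"
    and approx: "\<forall>v. (\<forall>n. v n \<in> test_functions Omega) \<longrightarrow> Bseq (\<lambda>n. ?q (v n)) \<longrightarrow>
       (\<lambda>n. l2_inner ?M \<eta> (v n) - polar_form ?q (u n) (v n)) \<longlonglongrightarrow> 0"
    by (rule operator_approx[OF \<phi>])
  then have u: "\<And>n. u n \<in> test_functions Omega" by blast
  note uL = test_function_L2[OF u]
  define v where "v n x = w x * u n x" for n x
  have v: "v n \<in> test_functions Omega" for n
    unfolding v_def by (rule test_function_mult[OF open_Omega u sw])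
  note vL = test_function_L2[OF v]
  show wL: "w\<phi> \<in> L2 ?M"
    using L2_mult_bounded[OF L(1) wm wb] by (simp add: w\<phi>_def w_def)
  have w\<phi>: "w\<phi> = (\<lambda>x. w x * \<phi> x)" by (simp add: w\<phi>_def w_def)
  have vlim: "(\<lambda>n. l2_norm ?M (\<lambda>x. v n x - w\<phi> x)) \<longlonglongrightarrow> 0"
    unfolding v_def w\<phi> by (rule l2_norm_mult_bounded_tendsto[OF uL L(1) wm wb lim])
  have l2u: "(\<integral>x. (u n x)\<^sup>2 \<partial>lborel) = l2_inner ?M (u n) (u n)" for n
    unfolding test_function_l2_inner[OF u u] by (simp add: power2_eq_square)
  have l2v: "(\<integral>x. (v n x)\<^sup>2 \<partial>lborel) = l2_inner ?M (v n) (v n)" for n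
    unfolding test_function_l2_inner[OF v v] by (simp add: power2_eq_square)
  obtain K1 where K1: "\<And>n. \<bar>?q (u n)\<bar> \<le> K1" using bu by (auto simp: Bseq_def)
  have "Bseq (\<lambda>n. l2_inner ?M (u n) (u n))"
    by (rule convergent_imp_Bseq[OF convergentI[OF l2_inner_self_tendsto[OF uL L(1) lim]]])
  then obtain K2 where K2: "\<And>n. \<bar>l2_inner ?M (u n) (u n)\<bar> \<le> K2" by (auto simp: Bseq_def)
  define K where "K = 2 * (1 + 1 / \<epsilon>)\<^sup>2 + 2 * (1 / \<epsilon> * (1 + 1 / \<epsilon>) * (\<delta> + \<delta>' + 2)\<^sup>2)"
  have K0: "0 \<le> K" using \<epsilon> by (simp add: K_def)
  have "\<bar>?q (v n)\<bar> \<le> K * (K1 + K2)" for n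
  proof -
    have "?q (v n) \<le> K * (?q (u n) + l2_inner ?M (u n) (u n))"
      unfolding grushin_form_eq[OF u] grushin_form_eq[OF v] l2u[symmetric] v_def w_def K_def
      by (rule form_reg_weight_le(1)[OF u \<epsilon> \<delta>])
    also have "\<dots> \<le> K * (K1 + K2)"
      using K1[of n] K2[of n] K0 by (intro mult_left_mono) auto
    finally have "?q (v n) \<le> K * (K1 + K2)" .
    moreover have "0 \<le> ?q (v n)" unfolding grushin_form_eq[OF v] by (rule form_reg_weight_le(2)[OF v \<epsilon> \<delta>])
    ultimately show ?thesis by simp
  qed
  then have "Bseq (\<lambda>n. ?q (v n))" by (intro BseqI'[where K = "K * (K1 + K2)"]) simp
  with v approx have a0: "(\<lambda>n. l2_inner ?M \<eta> (v n) - polar_form ?q (u n) (v n)) \<longlonglongrightarrow> 0" by blast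
  have "(\<lambda>n. l2_inner ?M (v n) \<eta>) \<longlonglongrightarrow> l2_inner ?M w\<phi> \<eta>"
    by (rule l2_inner_tendsto[OF vL wL L(2) vlim])
  then have a1: "(\<lambda>n. l2_inner ?M \<eta> (v n)) \<longlonglongrightarrow> l2_inner ?M \<eta> w\<phi>"
    by (simp add: l2_inner_commute[of ?M \<eta>])
  have "(\<lambda>n. ?A * l2_inner ?M (v n) (v n)) \<longlonglongrightarrow> ?A * l2_inner ?M w\<phi> w\<phi>"
    by (intro tendsto_mult_left l2_inner_self_tendsto[OF vL wL vlim])
  \<comment> \<open>Convergence of \<open>polar_form\<close> is known only through its difference
    from the pairing with \<eta>.\<close>
  moreover have "(\<lambda>n. l2_inner ?M \<eta> (v n) - (l2_inner ?M \<eta> (v n) - polar_form ?q (u n) (v n))) \<longlonglongrightarrow> l2_inner ?M \<eta> w\<phi> - 0"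
    by (rule tendsto_diff[OF a1 a0])
  moreover have "?A * l2_inner ?M (v n) (v n) \<le> l2_inner ?M \<eta> (v n) - (l2_inner ?M \<eta> (v n) - polar_form ?q (u n) (v n))" for n
    using form_lower_bound(2)[OF u \<epsilon> less_imp_le[OF A], of n]
    unfolding polar_grushin_form[OF u v] l2v[symmetric] v_def w_def by simp
  ultimately have "?A * l2_inner ?M w\<phi> w\<phi> \<le> l2_inner ?M \<eta> w\<phi> - 0"
    by (intro LIMSEQ_le) auto
  also have "\<dots> \<le> l2_norm ?M \<eta> * l2_norm ?M w\<phi>"
    using l2_Cauchy_Schwarz[OF L(2) wL] by simp
  finally have "?A * l2_norm ?M w\<phi> * l2_norm ?M w\<phi> \<le> l2_norm ?M \<eta> * l2_norm ?M w\<phi>"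
    by (simp add: l2_norm_power2[symmetric] power2_eq_square mult.assoc)
  then have "?A * l2_norm ?M w\<phi> \<le> l2_norm ?M \<eta>"
    using l2_norm_nonneg[of ?M w\<phi>] l2_norm_nonneg[of ?M \<eta>] by (cases "l2_norm ?M w\<phi> = 0") auto
  then have "(?A * l2_norm ?M w\<phi>)\<^sup>2 \<le> (l2_norm ?M \<eta>)\<^sup>2"
    using A l2_norm_nonneg[of ?M w\<phi>] by (intro power_mono) auto
  then show "?A\<^sup>2 * l2_inner ?M w\<phi> w\<phi> \<le> l2_inner ?M \<eta> \<eta>"
    by (simp add: power_mult_distrib l2_norm_power2)
qed

text \<open>The regularised weights increase to the full one as \<epsilon> decreases. Monotone
  convergence under the uniform bound yields membership of the weighted function in L2 together with
  the inequality.\<close>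

theorem rellich_inequality_root:
  assumes A: "0 < rellich_root (real DIM('a)) \<delta> \<delta>'"
  shows "rellich_inequality \<delta> \<delta>' H ((rellich_root (real DIM('a)) \<delta> \<delta>')\<^sup>2)"
  unfolding rellich_inequality_def
proof (clarify)
  fix \<phi> \<eta> assume \<phi>: "(\<phi>, \<eta>) \<in> H"
  let ?M = "lebesgue_on (Omega :: ('a \<times> 'b) set)" and ?A = "rellich_root (real DIM('a)) \<delta> \<delta>'"
  let ?q = "grushin_form \<delta> \<delta>' \<beta> :: ('a \<times> 'b \<Rightarrow> real) \<Rightarrow> real"
  obtain S where "closed_form_operator ?M (test_functions Omega) ?q H S" by (rule square_root)
  then interpret closed_form_operator ?M "test_functions Omega" ?q H S .
  have \<phi>L: "\<phi> \<in> L2 ?M" by (rule operator_approx[OF \<phi>])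
  define \<epsilon> where "\<epsilon> n = 1 / real (Suc n)" for n
  have \<epsilon>: "0 < \<epsilon> n" for n by (simp add: \<epsilon>_def)
  define f where "f n x = (reg_weight \<delta> \<delta>' (\<epsilon> n) (norm (fst x)) * \<phi> x)\<^sup>2" for n x
  define g where "g x = (rellich_weight \<delta> \<delta>' x * \<phi> x)\<^sup>2" for x
  note R = reg_weight_inequality[OF \<phi> A \<epsilon>]
  have fi: "integrable ?M (f n)" for n
    using R(1)[of n] by (simp add: f_def[abs_def] L2_def)
  have fint: "integral\<^sup>L ?M (f n) \<le> l2_inner ?M \<eta> \<eta> / ?A\<^sup>2" for n
    using R(2)[of n] A by (simp add: l2_inner_def f_def[abs_def] power2_eq_square field_simps)
  have fm: "f n x \<le> f m x" if "x \<in> space ?M" "n \<le> m" for n m x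
  proof -
    have r: "0 < norm (fst x)" using that(1) by (simp add: space_restrict_space Omega_iff)
    have "\<epsilon> m \<le> \<epsilon> n" using that(2) by (simp add: \<epsilon>_def frac_le)
    then have "reg_weight \<delta> \<delta>' (\<epsilon> n) (norm (fst x)) \<le> reg_weight \<delta> \<delta>' (\<epsilon> m) (norm (fst x))"
      unfolding reg_weight_def using \<epsilon>[of m] rad_weight_pos[OF r, of \<delta> \<delta>'] reg_denominator_pos[OF \<epsilon>[of m], of "rad_weight \<delta> \<delta>' (norm (fst x))"]
      by (intro divide_left_mono mult_pos_pos reg_denominator_pos[OF \<epsilon>]) (auto intro: mult_right_mono)
    then show ?thesis unfolding f_def power_mult_distrib
      using reg_weight_bounds(1)[OF r \<epsilon>[of n], of \<delta> \<delta>'] by (intro mult_right_mono power_mono) auto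
  qed
  have flim: "(\<lambda>n. f n x) \<longlonglongrightarrow> g x" for x
  proof -
    have "\<epsilon> \<longlonglongrightarrow> 0" unfolding \<epsilon>_def[abs_def] using LIMSEQ_Suc[OF lim_1_over_n] by simp
    then have "(\<lambda>n. rad_weight \<delta> \<delta>' (norm (fst x)) / (1 + \<epsilon> n * (rad_weight \<delta> \<delta>' (norm (fst x)))\<^sup>2))
        \<longlonglongrightarrow> rad_weight \<delta> \<delta>' (norm (fst x)) / (1 + 0 * (rad_weight \<delta> \<delta>' (norm (fst x)))\<^sup>2)"
      by (intro tendsto_intros) auto
    then show ?thesis unfolding f_def g_def reg_weight_def rellich_weight_radial
      by (intro tendsto_intros) simp
  qed
  have inc: "incseq (\<lambda>n. integral\<^sup>L ?M (f n))"
    using fi fm by (intro incseq_SucI integral_mono) auto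
  have "\<forall>n. integral\<^sup>L ?M (f n) \<le> l2_inner ?M \<eta> \<eta> / ?A\<^sup>2" using fint by blast
  then obtain L where L: "(\<lambda>n. integral\<^sup>L ?M (f n)) \<longlonglongrightarrow> L"
    using incseq_convergent[OF inc] by blast
  have Lle: "L \<le> l2_inner ?M \<eta> \<eta> / ?A\<^sup>2"
    using L fint by (intro LIMSEQ_le_const2[OF L]) auto
  have sw: "smooth_on (Omega :: ('a \<times> 'b) set) (rellich_weight \<delta> \<delta>')"
    unfolding rellich_weight_radial[abs_def] by (rule smooth_on_radial[OF smooth_on_rad_weight])
  have wm: "(\<lambda>x. rellich_weight \<delta> \<delta>' x * \<phi> x) \<in> borel_measurable ?M"
    by (rule borel_measurable_times[OF continuous_imp_measurable_on_sets_lebesgue[OF smooth_on_continuous[OF sw]]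
          L2_measurable[OF \<phi>L]]) (use Omega_in_sets_lebesgue in simp)
  have gm: "g \<in> borel_measurable ?M" unfolding g_def[abs_def] using wm by simp
  have mono: "AE x in ?M. mono (\<lambda>n. f n x)" using fm by (intro AE_I2 monoI) auto
  have lim: "AE x in ?M. (\<lambda>n. f n x) \<longlonglongrightarrow> g x" using flim by (intro AE_I2)
  have gi: "integrable ?M g" by (rule integrable_monotone_convergence[OF fi mono lim L gm])
  have gL: "integral\<^sup>L ?M g = L" by (rule integral_monotone_convergence[OF fi mono lim L gm])
  have "(\<lambda>x. rellich_weight \<delta> \<delta>' x * \<phi> x) \<in> L2 ?M"
    using wm gi by (simp add: L2_def g_def[abs_def])
  moreover have "?A\<^sup>2 * l2_inner ?M (\<lambda>x. rellich_weight \<delta> \<delta>' x * \<phi> x) (\<lambda>x. rellich_weight \<delta> \<delta>' x * \<phi> x) \<le> l2_inner ?M \<eta> \<eta>"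
  proof -
    have "l2_inner ?M (\<lambda>x. rellich_weight \<delta> \<delta>' x * \<phi> x) (\<lambda>x. rellich_weight \<delta> \<delta>' x * \<phi> x) = L"
      unfolding gL[symmetric] l2_inner_def g_def by (simp add: power2_eq_square)
    then show ?thesis using Lle A by (simp add: field_simps)
  qed
  ultimately show "(\<lambda>x. rellich_weight \<delta> \<delta>' x * \<phi> x) \<in> L2 ?M \<and>
      ?A\<^sup>2 * l2_inner ?M (\<lambda>x. rellich_weight \<delta> \<delta>' x * \<phi> x) (\<lambda>x. rellich_weight \<delta> \<delta>' x * \<phi> x) \<le> l2_inner ?M \<eta> \<eta>" ..
qed

text \<open>By \<open>core_in_operator\<close> it is enough to integrate by parts against core
  functions. In x1 the smooth coefficient is differentiated together with u; in x2 the coefficient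
  \<beta> is constant along the derivative.\<close>

lemma test_function_in_operator:
  assumes u: "u \<in> test_functions Omega"
  shows "(u, grushin_apply \<delta> \<delta>' \<beta> u) \<in> H"
proof -
  let ?M = "lebesgue_on (Omega :: ('a \<times> 'b) set)"
  let ?q = "grushin_form \<delta> \<delta>' \<beta> :: ('a \<times> 'b \<Rightarrow> real) \<Rightarrow> real"
  obtain S where "closed_form_operator ?M (test_functions Omega) ?q H S" by (rule square_root)
  then interpret closed_form_operator ?M "test_functions Omega" ?q H S .
  define F where "F i x = c_Omega \<delta> \<delta>' x * dird (i, 0) u x" for i x
  have F: "F i \<in> test_functions Omega" for i unfolding F_def[abs_def]
    by (rule test_function_mult[OF open_Omega test_function_dird[OF open_Omega u] smooth_on_c_Omega])
  note uj = test_function_dird[OF open_Omega u]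
  define P where "P x = (\<Sum>i\<in>Basis. dird (i, 0) (F i) x)" for x
  define Q where "Q x = (\<Sum>j\<in>Basis. dird (0, j) (dird (0, j) u) x)" for x
  have P: "P \<in> test_functions Omega" and Q: "Q \<in> test_functions Omega"
    unfolding P_def[abs_def] Q_def[abs_def]
    by (intro test_function_sum test_function_dird open_Omega F uj)+
  have eq: "grushin_apply \<delta> \<delta>' \<beta> u = (\<lambda>x. (-1) * P x - \<beta> (fst x) * Q x)"
    by (simp add: grushin_apply_def[abs_def] P_def Q_def F_def[abs_def])
  show ?thesis
  proof (rule core_in_operator[OF u])
    show "grushin_apply \<delta> \<delta>' \<beta> u \<in> L2 ?M" unfolding eq
      by (intro L2_diff L2_cmult test_function_L2 P test_function_L2_mult[OF Q \<beta>_fst \<beta>_abs])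
    fix v assume v: "v \<in> test_functions (Omega :: ('a \<times> 'b) set)"
    note dv = test_function_differentiable[OF v]
    have c1: "(\<integral>x. F i x * dird (i, 0) v x \<partial>lborel) = - (\<integral>x. dird (i, 0) (F i) x * v x \<partial>lborel)" for i
    proof -
      have "(\<integral>x. 1 * dird (i, 0) (\<lambda>x. F i x * v x) x \<partial>lborel) = 0"
        by (rule integral_dird_zero[OF test_function_times[OF open_Omega F v] open_Omega, of _ 1]) auto
      then show ?thesis
        using test_function_integrable[OF test_function_times[OF open_Omega F test_function_dird[OF open_Omega v]]]
          test_function_integrable[OF test_function_times[OF open_Omega test_function_dird[OF open_Omega F] v]]
        by (simp add: dird_mult[OF test_function_differentiable[OF F] dv])
    qed
    have c2: "(\<integral>x. \<beta> (fst x) * (dird (0, j) u x * dird (0, j) v x) \<partial>lborel)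
        = - (\<integral>x. \<beta> (fst x) * (dird (0, j) (dird (0, j) u) x * v x) \<partial>lborel)" for j
    proof -
      have "(\<integral>x. \<beta> (fst x) * dird (0, j) (\<lambda>x. dird (0, j) u x * v x) x \<partial>lborel) = 0"
        by (rule integral_dird_zero[OF test_function_times[OF open_Omega uj v] open_Omega \<beta>_fst \<beta>_abs]) simp
      then show ?thesis
        using integrable_\<beta>[OF test_function_times[OF open_Omega uj test_function_dird[OF open_Omega v]]]
          integrable_\<beta>[OF test_function_times[OF open_Omega test_function_dird[OF open_Omega uj] v]]
        by (simp add: dird_mult[OF test_function_differentiable[OF uj] dv] distrib_left)
    qed
    have s1: "(\<integral>x. c_Omega \<delta> \<delta>' x * grad1_prod v u x \<partial>lborel) = - (\<integral>x. P x * v x \<partial>lborel)"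
    proof -
      have "(\<integral>x. c_Omega \<delta> \<delta>' x * grad1_prod v u x \<partial>lborel) = (\<integral>x. (\<Sum>i\<in>Basis. F i x * dird (i, 0) v x) \<partial>lborel)"
        unfolding grad1_prod_def F_def sum_distrib_left by (simp add: mult_ac)
      also have "\<dots> = (\<Sum>i\<in>Basis. - (\<integral>x. dird (i, 0) (F i) x * v x \<partial>lborel))"
        unfolding c1[symmetric]
        by (intro Bochner_Integration.integral_sum test_function_integrable[OF test_function_times[OF open_Omega F test_function_dird[OF open_Omega v]]])
      also have "\<dots> = - (\<integral>x. (\<Sum>i\<in>Basis. dird (i, 0) (F i) x * v x) \<partial>lborel)"
        unfolding sum_negf
        by (subst Bochner_Integration.integral_sum) (intro test_function_integrable[OF test_function_times[OF open_Omega test_function_dird[OF open_Omega F] v]], simp)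
      finally show ?thesis by (simp add: P_def sum_distrib_right)
    qed
    have s2: "(\<integral>x. \<beta> (fst x) * grad2_prod v u x \<partial>lborel) = - (\<integral>x. \<beta> (fst x) * (Q x * v x) \<partial>lborel)"
    proof -
      have "(\<integral>x. \<beta> (fst x) * grad2_prod v u x \<partial>lborel) = (\<integral>x. (\<Sum>j\<in>Basis. \<beta> (fst x) * (dird (0, j) u x * dird (0, j) v x)) \<partial>lborel)"
        unfolding grad2_prod_def sum_distrib_left by (simp add: mult_ac)
      also have "\<dots> = (\<Sum>j\<in>Basis. - (\<integral>x. \<beta> (fst x) * (dird (0, j) (dird (0, j) u) x * v x) \<partial>lborel))"
        unfolding c2[symmetric]
        by (intro Bochner_Integration.integral_sum integrable_\<beta>[OF test_function_times[OF open_Omega uj test_function_dird[OF open_Omega v]]])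
      also have "\<dots> = - (\<integral>x. (\<Sum>j\<in>Basis. \<beta> (fst x) * (dird (0, j) (dird (0, j) u) x * v x)) \<partial>lborel)"
        unfolding sum_negf
        by (subst Bochner_Integration.integral_sum) (intro integrable_\<beta>[OF test_function_times[OF open_Omega test_function_dird[OF open_Omega uj] v]], simp)
      finally show ?thesis by (simp add: Q_def sum_distrib_right sum_distrib_left)
    qed
    have Iv: "integrable lborel (\<lambda>x. P x * v x)" "integrable lborel (\<lambda>x. \<beta> (fst x) * (Q x * v x))"
      by (rule test_function_integrable[OF test_function_times[OF open_Omega P v]],
          rule integrable_\<beta>[OF test_function_times[OF open_Omega Q v]])
    have "l2_inner ?M v (grushin_apply \<delta> \<delta>' \<beta> u) = (\<integral>x. v x * ((-1) * P x - \<beta> (fst x) * Q x) \<partial>lborel)"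
      unfolding l2_inner_def eq
    proof (rule integral_Omega(1))
      show "(\<lambda>x. v x * ((-1) * P x - \<beta> (fst x) * Q x)) \<in> borel_measurable borel"
        by (intro borel_measurable_times borel_measurable_diff borel_measurable_const \<beta>_fst test_function_borel[OF v] test_function_borel[OF P] test_function_borel[OF Q])
    qed (simp add: test_function_outside[OF v])
    also have "\<dots> = (\<integral>x. - (P x * v x) - \<beta> (fst x) * (Q x * v x) \<partial>lborel)"
      by (intro Bochner_Integration.integral_cong refl) (simp add: algebra_simps)
    also have "\<dots> = - (\<integral>x. P x * v x \<partial>lborel) - (\<integral>x. \<beta> (fst x) * (Q x * v x) \<partial>lborel)"
      using Iv by simp
    also have "\<dots> = polar_form ?q v u"
      unfolding polar_grushin_form[OF v u] grushin_inner_def s1 s2 by simp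
    finally show "polar_form ?q v u = l2_inner ?M v (grushin_apply \<delta> \<delta>' \<beta> u)" ..
  qed
qed

end

section \<open>Cutoff functions\<close>

lemma smooth_on_real_derivative:
  fixes g :: "real \<Rightarrow> real"
  assumes "smooth_on UNIV g" shows "(g has_real_derivative dird 1 g t) (at t)"
proof -
  have D: "(g has_derivative (\<lambda>v. dird v g t)) (at t)" by (rule smooth_on_has_derivative[OF assms]) simp
  have "dird v g t = dird 1 g t * v" for v
    using linear_scale[OF has_derivative_linear[OF D], of v 1] by simp
  then have "(\<lambda>v. dird v g t) = (\<lambda>v. dird 1 g t * v)" by (rule ext)
  with D show ?thesis unfolding has_field_derivative_def by (rule subst[rotated])
qed

lemma dird_eq_zero:
  assumes "open U" "x \<in> U" "\<And>y. y \<in> U \<Longrightarrow> f y = c"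
  shows "dird v f x = 0"
proof -
  have "((\<lambda>y. c) has_derivative (\<lambda>v. 0)) (at x)" by simp
  then have "(f has_derivative (\<lambda>v. 0)) (at x)"
    by (rule has_derivative_transform_within_open[OF _ assms(1,2)]) (simp add: assms(3))
  then show ?thesis by (rule dird_eqI)
qed

locale step_function =
  fixes \<eta> \<eta>1 \<eta>2 :: "real \<Rightarrow> real" and C :: real
  assumes step_smooth: "smooth_on UNIV \<eta>"
    and step_range: "0 \<le> \<eta> t" "\<eta> t \<le> 1"
    and step_const: "t \<le> 0 \<Longrightarrow> \<eta> t = 0" "t \<ge> 1 \<Longrightarrow> \<eta> t = 1"
    and step_derivatives: "(\<eta> has_real_derivative \<eta>1 t) (at t)" "(\<eta>1 has_real_derivative \<eta>2 t) (at t)"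
    and step_support: "t \<notin> {0..1} \<Longrightarrow> \<eta>1 t = 0" "t \<notin> {0..1} \<Longrightarrow> \<eta>2 t = 0"
    and step_bounds: "0 \<le> C" "\<bar>\<eta>1 t\<bar> \<le> C" "\<bar>\<eta>2 t\<bar> \<le> C"

lemma step_function_exists:
  obtains \<eta> \<eta>1 \<eta>2 C where "step_function \<eta> \<eta>1 \<eta>2 C"
proof -
  obtain \<eta> :: "real \<Rightarrow> real" where \<eta>: "smooth_on UNIV \<eta>" "\<And>t. 0 \<le> \<eta> t" "\<And>t. \<eta> t \<le> 1"
    "\<And>t. t \<le> 0 \<Longrightarrow> \<eta> t = 0" "\<And>t. t \<ge> 1 \<Longrightarrow> \<eta> t = 1" using smooth_step by blast
  define \<eta>1 where "\<eta>1 = dird 1 \<eta>"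
  define \<eta>2 where "\<eta>2 = dird 1 \<eta>1"
  have s1: "smooth_on UNIV \<eta>1" unfolding \<eta>1_def by (rule smooth_on_dird[OF \<eta>(1)])
  have s2: "smooth_on UNIV \<eta>2" unfolding \<eta>2_def by (rule smooth_on_dird[OF s1])
  have z1: "\<eta>1 t = 0" if "t \<notin> {0..1}" for t
  proof (cases "t < 0")
    case True
    then show ?thesis unfolding \<eta>1_def by (intro dird_eq_zero[of "{..<0}" t \<eta> 0]) (auto simp: \<eta>)
  next
    case False
    then show ?thesis unfolding \<eta>1_def using that by (intro dird_eq_zero[of "{1<..}" t \<eta> 1]) (auto simp: \<eta>)
  qed
  have z2: "\<eta>2 t = 0" if "t \<notin> {0..1}" for t
    unfolding \<eta>2_def using that by (intro dird_eq_zero[of "- {0..1}" t \<eta>1 0]) (auto simp: z1 open_Compl)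
  \<comment> \<open>A smooth function that vanishes off [0, 1] is a test function on the whole line,
    hence bounded.\<close>
  have bd: "\<exists>C. \<forall>t. \<bar>f t\<bar> \<le> C" if "smooth_on UNIV f" "\<And>t. t \<notin> {0..1} \<Longrightarrow> f t = 0" for f :: "real \<Rightarrow> real"
  proof -
    have "f \<in> test_functions UNIV" by (rule test_functionI[of UNIV f "{0..1}"]) (use that in auto)
    then show ?thesis by (metis test_function_bounded)
  qed
  obtain C1 where C1: "\<And>t. \<bar>\<eta>1 t\<bar> \<le> C1" using bd[OF s1 z1] by blast
  obtain C2 where C2: "\<And>t. \<bar>\<eta>2 t\<bar> \<le> C2" using bd[OF s2 z2] by blast
  have "step_function \<eta> \<eta>1 \<eta>2 (max C1 C2)"
  proof
    show "(\<eta> has_real_derivative \<eta>1 t) (at t)" for t unfolding \<eta>1_def by (rule smooth_on_real_derivative[OF \<eta>(1)])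
    show "(\<eta>1 has_real_derivative \<eta>2 t) (at t)" for t unfolding \<eta>2_def by (rule smooth_on_real_derivative[OF s1])
    show "\<bar>\<eta>1 t\<bar> \<le> max C1 C2" "\<bar>\<eta>2 t\<bar> \<le> max C1 C2" for t using C1[of t] C2[of t] by auto
    show "0 \<le> max C1 C2" using C1[of 0] by auto
  qed (use \<eta> z1 z2 in auto)
  then show ?thesis by (rule that)
qed

locale plateau_function =
  fixes p q C :: real and \<zeta> \<zeta>1 \<zeta>2 :: "real \<Rightarrow> real"
  assumes plateau_smooth: "smooth_on UNIV \<zeta>"
    and plateau_derivatives: "(\<zeta> has_real_derivative \<zeta>1 t) (at t)" "(\<zeta>1 has_real_derivative \<zeta>2 t) (at t)"
    and plateau_range: "0 \<le> \<zeta> t" "\<zeta> t \<le> 1" "\<bar>\<zeta>1 t\<bar> \<le> C" "\<bar>\<zeta>2 t\<bar> \<le> C"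
    and plateau_one: "p + 1 \<le> t \<Longrightarrow> t \<le> q - 1 \<Longrightarrow> \<zeta> t = 1"
    and plateau_zero: "t \<notin> {p..q} \<Longrightarrow> \<zeta> t = 0"
    and plateau_edges: "t \<notin> {p..p+1} \<Longrightarrow> t \<notin> {q-1..q} \<Longrightarrow> \<zeta>1 t = 0 \<and> \<zeta>2 t = 0"

text \<open>The order of quantifiers is the point: both edges have length 1 whatever
  \<open>p\<close> and \<open>q\<close> are, so one bound on the derivatives serves plateaus of
  every length.\<close>

lemma plateau_function_exists:
  obtains C where "\<forall>p q. \<exists>\<zeta> \<zeta>1 \<zeta>2. plateau_function p q C \<zeta> \<zeta>1 \<zeta>2"
proof -
  obtain \<eta> \<eta>1 \<eta>2 C where "step_function \<eta> \<eta>1 \<eta>2 C" by (rule step_function_exists)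
  then interpret step_function \<eta> \<eta>1 \<eta>2 C .
  note \<eta> = step_smooth step_range step_const and D = step_derivatives and Z = step_support and C = step_bounds
  \<comment> \<open>The first derivative is bounded by 2C, the second by 2C + 2C^2.\<close>
  have "\<exists>\<zeta> \<zeta>1 \<zeta>2. plateau_function p q (2 * C + 2 * (C * C)) \<zeta> \<zeta>1 \<zeta>2" for p q
  proof -
    define \<zeta> where "\<zeta> t = \<eta> (t - p) * \<eta> (q - t)" for t
    define \<zeta>1 where "\<zeta>1 t = \<eta>1 (t - p) * \<eta> (q - t) - \<eta> (t - p) * \<eta>1 (q - t)" for t
    define \<zeta>2 where "\<zeta>2 t = \<eta>2 (t - p) * \<eta> (q - t) - 2 * (\<eta>1 (t - p) * \<eta>1 (q - t)) + \<eta> (t - p) * \<eta>2 (q - t)" for t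
    have lin1: "smooth_on UNIV (\<lambda>t::real. t - p)"
      by (rule smooth_on_diff[OF open_UNIV smooth_on_linear[OF bounded_linear_ident open_UNIV] smooth_on_const[OF open_UNIV]])
    have lin2: "smooth_on UNIV (\<lambda>t::real. q - t)"
      by (rule smooth_on_diff[OF open_UNIV smooth_on_const[OF open_UNIV] smooth_on_linear[OF bounded_linear_ident open_UNIV]])
    have sm: "smooth_on UNIV \<zeta>" unfolding \<zeta>_def[abs_def]
      by (rule smooth_on_mult[OF open_UNIV smooth_on_compose[OF open_UNIV open_UNIV UNIV_I \<eta>(1) lin1]
            smooth_on_compose[OF open_UNIV open_UNIV UNIV_I \<eta>(1) lin2]])
    have chain1: "((\<lambda>t. f (t - p)) has_real_derivative f' (t - p)) (at t)"
      if "\<And>t. (f has_real_derivative f' t) (at t)" for f f' :: "real \<Rightarrow> real" and t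
    proof -
      have "((\<lambda>t. t - p) has_real_derivative 1) (at t)" by (auto intro!: derivative_eq_intros)
      from DERIV_chain2[OF that this] show ?thesis by simp
    qed
    have chain2: "((\<lambda>t. f (q - t)) has_real_derivative - f' (q - t)) (at t)"
      if "\<And>t. (f has_real_derivative f' t) (at t)" for f f' :: "real \<Rightarrow> real" and t
    proof -
      have "((\<lambda>t. q - t) has_real_derivative -1) (at t)" by (auto intro!: derivative_eq_intros)
      from DERIV_chain2[OF that this] show ?thesis by simp
    qed
    have d1: "(\<zeta> has_real_derivative \<zeta>1 t) (at t)" for t
      unfolding \<zeta>_def[abs_def] \<zeta>1_def
      by (rule DERIV_cong[OF DERIV_mult[OF chain1[OF D(1)] chain2[OF D(1)]]]) (simp add: algebra_simps)
    have d2: "(\<zeta>1 has_real_derivative \<zeta>2 t) (at t)" for t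
      unfolding \<zeta>1_def[abs_def] \<zeta>2_def
      by (rule DERIV_cong[OF DERIV_diff[OF DERIV_mult[OF chain1[OF D(2)] chain2[OF D(1)]] DERIV_mult[OF chain1[OF D(1)] chain2[OF D(2)]]]])
        (simp add: algebra_simps)
    have e: "\<bar>\<eta> t\<bar> \<le> 1" for t using \<eta>(2,3) by simp
    have m1: "\<bar>a * \<eta> t\<bar> \<le> C" "\<bar>\<eta> t * a\<bar> \<le> C" if "\<bar>a\<bar> \<le> C" for a t
      using mult_mono[OF that e[of t] C(1) abs_ge_zero] by (simp_all add: abs_mult mult.commute)
    have m2: "\<bar>\<eta>1 s * \<eta>1 t\<bar> \<le> C * C" for s t
      unfolding abs_mult using C by (intro mult_mono) auto
    have CC: "0 \<le> C * C" using C(1) by simp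
    have b1: "\<bar>\<zeta>1 t\<bar> \<le> 2 * C + 2 * (C * C)" for t
      using m1(1)[OF C(2)[of "t - p"], of "q - t"] m1(2)[OF C(2)[of "q - t"], of "t - p"] CC unfolding \<zeta>1_def by linarith
    have b2: "\<bar>\<zeta>2 t\<bar> \<le> 2 * C + 2 * (C * C)" for t
      using m1(1)[OF C(3)[of "t - p"], of "q - t"] m1(2)[OF C(3)[of "q - t"], of "t - p"] m2[of "t - p" "q - t"]
      unfolding \<zeta>2_def by linarith
    have pl: "\<zeta> t = 1" if "p + 1 \<le> t" "t \<le> q - 1" for t using that by (simp add: \<zeta>_def \<eta>(5))
    have ou: "\<zeta> t = 0" if "t \<notin> {p..q}" for t
    proof (cases "t \<le> p")
      case True then show ?thesis by (simp add: \<zeta>_def \<eta>(4))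
    next
      case False then have "q - t \<le> 0" using that by auto
      then show ?thesis by (simp add: \<zeta>_def \<eta>(4))
    qed
    have ed: "\<zeta>1 t = 0 \<and> \<zeta>2 t = 0" if "t \<notin> {p..p+1}" "t \<notin> {q-1..q}" for t
    proof -
      have "t - p \<notin> {0..1}" "q - t \<notin> {0..1}" using that by auto
      then show ?thesis by (simp add: \<zeta>1_def \<zeta>2_def Z)
    qed
    have rng: "0 \<le> \<zeta> t" "\<zeta> t \<le> 1" for t unfolding \<zeta>_def using \<eta>(2,3) by (auto intro: mult_le_one)
    have "plateau_function p q (2 * C + 2 * (C * C)) \<zeta> \<zeta>1 \<zeta>2"
      by (rule plateau_function.intro[OF sm d1 d2 rng b1 b2 pl ou ed])
    then show ?thesis by blast
  qed
  then show ?thesis using that by blast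
qed

locale transverse_cutoff =
  fixes R C :: real and g :: "'a::euclidean_space \<times> 'b::euclidean_space \<Rightarrow> real"
  assumes cutoff_smooth: "smooth_on UNIV g"
    and cutoff_dird: "dird (v, 0) g x = 0"
    and cutoff_range: "0 \<le> g x" "g x \<le> 1"
    and cutoff_one: "norm (snd x) \<le> R \<Longrightarrow> g x = 1"
    and cutoff_zero: "2 * R < norm (snd x) \<Longrightarrow> g x = 0 \<and> (\<Sum>j\<in>Basis. dird (0, j) (dird (0, j) g) x) = 0"
    and cutoff_laplacian: "\<bar>\<Sum>j\<in>Basis. dird (0, j) (dird (0, j) g) x\<bar> \<le> C / R\<^sup>2"

text \<open>The cutoff is a function of |x2|^2 / R^2, hence smooth across x2 = 0; two derivatives
  gain R^(-2) with a constant that does not depend on \<open>R\<close>.\<close>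

lemma transverse_cutoff_exists:
  obtains C where "0 \<le> C"
    "\<forall>R\<ge>1. \<exists>g :: 'a::euclidean_space \<times> 'b::euclidean_space \<Rightarrow> real. transverse_cutoff R C g"
proof -
  obtain \<eta> \<eta>1 \<eta>2 C where "step_function \<eta> \<eta>1 \<eta>2 C" by (rule step_function_exists)
  then interpret step_function \<eta> \<eta>1 \<eta>2 C .
  note \<eta> = step_smooth step_range step_const and D = step_derivatives and Z = step_support and C = step_bounds
  have "\<exists>g :: 'a \<times> 'b \<Rightarrow> real. transverse_cutoff R (real DIM('b) * (10 * C)) g" if R: "1 \<le> R" for R
  proof -
    \<comment> \<open>\<open>h\<close> is at least 1 for |x2| <= R and negative once |x2|^2 > 2 R^2,
      in particular beyond |x2| = 2R.\<close>
    define h where "h x = 2 - (snd x \<bullet> snd x) / R\<^sup>2" for x :: "'a \<times> 'b"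
    define g where "g x = \<eta> (h x)" for x
    have dh: "(h has_derivative (\<lambda>v. - (2 * (snd x \<bullet> snd v)) / R\<^sup>2)) (at x)" for x
      unfolding h_def[abs_def] divide_inverse
      by (auto intro!: derivative_eq_intros simp: inner_commute algebra_simps fun_eq_iff)
    have dg: "dird v g x = \<eta>1 (h x) * (- (2 * (snd x \<bullet> snd v)) / R\<^sup>2)" for v x
      unfolding g_def[abs_def]
      by (rule dird_eqI) (rule has_derivative_compose[OF dh D(1)[unfolded has_field_derivative_def]])
    have ddg: "dird (0, j) (dird (0, j) g) x = \<eta>2 (h x) * (4 * (snd x \<bullet> j)\<^sup>2 / R ^ 4) - \<eta>1 (h x) * (2 / R\<^sup>2)"
      if "j \<in> Basis" for j :: 'b and x
    proof -
      have "((\<lambda>x. \<eta>1 (h x)) has_derivative (\<lambda>v. \<eta>2 (h x) * (- (2 * (snd x \<bullet> snd v)) / R\<^sup>2))) (at x)"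
        by (rule has_derivative_compose[OF dh D(2)[unfolded has_field_derivative_def]])
      moreover have "((\<lambda>x. - (2 * (snd x \<bullet> j)) / R\<^sup>2) has_derivative (\<lambda>v. - (2 * (snd v \<bullet> j)) / R\<^sup>2)) (at x)"
        unfolding divide_inverse by (auto intro!: derivative_eq_intros)
      ultimately have "((\<lambda>x. \<eta>1 (h x) * (- (2 * (snd x \<bullet> j)) / R\<^sup>2)) has_derivative
          (\<lambda>v. \<eta>1 (h x) * (- (2 * (snd v \<bullet> j)) / R\<^sup>2) + \<eta>2 (h x) * (- (2 * (snd x \<bullet> snd v)) / R\<^sup>2) * (- (2 * (snd x \<bullet> j)) / R\<^sup>2))) (at x)"
        by (rule has_derivative_mult)
      then have "dird (0, j) (\<lambda>x. \<eta>1 (h x) * (- (2 * (snd x \<bullet> j)) / R\<^sup>2)) x =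
          \<eta>1 (h x) * (- (2 * (j \<bullet> j)) / R\<^sup>2) + \<eta>2 (h x) * (- (2 * (snd x \<bullet> j)) / R\<^sup>2) * (- (2 * (snd x \<bullet> j)) / R\<^sup>2)"
        using dird_eqI by fastforce
      moreover have "dird (0, j) g = (\<lambda>x. \<eta>1 (h x) * (- (2 * (snd x \<bullet> j)) / R\<^sup>2))"
        by (rule ext) (simp add: dg)
      moreover have "(- (2 * y) / R\<^sup>2) * (- (2 * y) / R\<^sup>2) = 4 * y\<^sup>2 / R ^ 4" for y :: real
        by (simp add: power2_eq_square power4_eq_xxxx)
      ultimately show ?thesis using that by (simp add: mult.assoc power2_eq_square)
    qed
    have out: "h x < 0" if "norm (snd x) > 2 * R" for x
    proof -
      have "(2 * R)\<^sup>2 < (norm (snd x))\<^sup>2" using that R by (intro power_strict_mono) auto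
      then have "4 * R\<^sup>2 < snd x \<bullet> snd x" by (simp add: power2_norm_eq_inner power_mult_distrib)
      then have "2 * R\<^sup>2 < snd x \<bullet> snd x" using zero_le_power2[of R] by linarith
      then show ?thesis using R by (simp add: h_def field_simps)
    qed
    \<comment> \<open>10 = 8 + 2: where the derivatives of the step can be nonzero, |x2|^2 <= 2 R^2,
      so its second derivative contributes at most 8C / R^2 and its first at most 2C / R^2.\<close>
    have bd: "\<bar>dird (0, j) (dird (0, j) g) x\<bar> \<le> 10 * C / R\<^sup>2" if j: "j \<in> Basis" for j :: 'b and x
    proof (cases "h x \<in> {0..1}")
      case False then show ?thesis using C(1) R by (simp add: ddg[OF j] Z)
    next
      case True
      then have "snd x \<bullet> snd x \<le> 2 * R\<^sup>2" using R by (simp add: h_def field_simps)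
      moreover have "(snd x \<bullet> j)\<^sup>2 \<le> snd x \<bullet> snd x"
        using Cauchy_Schwarz_ineq[of "snd x" j] j by simp
      ultimately have "4 * (snd x \<bullet> j)\<^sup>2 / R ^ 4 \<le> 4 * (2 * R\<^sup>2) / R ^ 4" by (intro divide_right_mono) auto
      also have "\<dots> = 8 / R\<^sup>2" using R by (simp add: power2_eq_square power4_eq_xxxx)
      finally have "\<bar>\<eta>2 (h x) * (4 * (snd x \<bullet> j)\<^sup>2 / R ^ 4)\<bar> \<le> C * (8 / R\<^sup>2)"
        unfolding abs_mult using C by (intro mult_mono) auto
      moreover have "\<bar>\<eta>1 (h x) * (2 / R\<^sup>2)\<bar> \<le> C * (2 / R\<^sup>2)"
        unfolding abs_mult using C by (intro mult_mono) auto
      moreover have "C * (8 / R\<^sup>2) + C * (2 / R\<^sup>2) = 10 * C / R\<^sup>2" by (simp add: add_divide_distrib[symmetric])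
      ultimately show ?thesis unfolding ddg[OF j] by linarith
    qed
    have "smooth_on UNIV (\<lambda>x::'a \<times> 'b. \<Sum>j\<in>Basis. (snd x \<bullet> j) * (snd x \<bullet> j))"
      by (intro smooth_on_sum smooth_on_mult smooth_on_linear open_UNIV bounded_linear_compose[OF bounded_linear_inner_left bounded_linear_snd])
    then have "smooth_on UNIV (\<lambda>x::'a \<times> 'b. 2 - (1 / R\<^sup>2) * (\<Sum>j\<in>Basis. (snd x \<bullet> j) * (snd x \<bullet> j)))"
      by (intro smooth_on_diff[OF open_UNIV smooth_on_const[OF open_UNIV] smooth_on_mult[OF open_UNIV smooth_on_const[OF open_UNIV]]])
    then have "smooth_on UNIV h"
      by (rule smooth_on_cong[OF open_UNIV]) (simp add: h_def euclidean_inner[symmetric])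
    then have sg: "smooth_on UNIV g" unfolding g_def[abs_def]
      by (rule smooth_on_compose[OF open_UNIV open_UNIV UNIV_I \<eta>(1)])
    have dg0: "dird (v, 0) g x = 0" for v x by (simp add: dg)
    have rng: "0 \<le> g x" "g x \<le> 1" for x using \<eta> by (simp_all add: g_def)
    have one: "g x = 1" if "norm (snd x) \<le> R" for x
    proof -
      have "(norm (snd x))\<^sup>2 \<le> R\<^sup>2" using that by (intro power_mono) auto
      then have "1 \<le> h x" using R by (simp add: h_def power2_norm_eq_inner field_simps)
      then show ?thesis by (simp add: g_def \<eta>)
    qed
    have zero: "g x = 0 \<and> (\<Sum>j\<in>Basis. dird (0, j) (dird (0, j) g) x) = 0" if "2 * R < norm (snd x)" for x
      using out[OF that] by (simp add: g_def \<eta> ddg Z)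
    have lap: "\<bar>\<Sum>j\<in>Basis. dird (0, j) (dird (0, j) g) x\<bar> \<le> real DIM('b) * (10 * C) / R\<^sup>2" for x
    proof -
      have "\<bar>\<Sum>j\<in>Basis. dird (0, j) (dird (0, j) g) x\<bar> \<le> (\<Sum>j\<in>(Basis::'b set). 10 * C / R\<^sup>2)"
        using bd by (intro order_trans[OF sum_abs] sum_mono)
      then show ?thesis by simp
    qed
    have "transverse_cutoff R (real DIM('b) * (10 * C)) g"
      by (rule transverse_cutoff.intro[OF sg dg0 rng one zero lap])
    then show ?thesis by blast
  qed
  moreover have "0 \<le> real DIM('b) * (10 * C)" using C(1) by simp
  ultimately show ?thesis using that by blast
qed

section \<open>The operator on products of radial and transverse functions\<close>

text \<open>With k = c F' / r the field c grad_1 (F g) is x1 k g, whose divergence is (n k + r k')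
  g, so no second derivative of \<open>F\<close> has to be written. \<open>F 0 = 0\<close> makes the
  formula for the x2-derivatives hold off \<open>Omega\<close> too.\<close>

lemma grushin_apply_radial:
  fixes g :: "'a::euclidean_space \<times> 'b::euclidean_space \<Rightarrow> real"
  assumes F: "\<And>r. 0 < r \<Longrightarrow> (F has_real_derivative F1 r) (at r)" and F0: "F 0 = 0"
    and k: "\<And>r. 0 < r \<Longrightarrow> k r = rad_weight \<delta> \<delta>' r * (r * F1 r)"
    and k1: "\<And>r. 0 < r \<Longrightarrow> (k has_real_derivative k1 r) (at r)"
    and g: "smooth_on UNIV g" "\<And>v x. dird (v, 0) g x = 0"
    and u: "(\<lambda>x. F (norm (fst x)) * g x) \<in> test_functions Omega" and x: "x \<in> Omega"
  defines "r \<equiv> norm (fst x)"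
  shows "grushin_apply \<delta> \<delta>' \<beta> (\<lambda>x. F (norm (fst x)) * g x) x =
    - (real DIM('a) * k r + r * k1 r) * g x - \<beta> (fst x) * (F r * (\<Sum>j\<in>Basis. dird (0, j) (dird (0, j) g) x))"
proof -
  define u where "u = (\<lambda>x. F (norm (fst x)) * g x)"
  note uT = u[folded u_def]
  have dg: "g differentiable (at y)" for y
    using smooth_on_has_derivative[OF g(1)] differentiableI by blast
  have dg2: "dird v g differentiable (at y)" for v y
    using smooth_on_has_derivative[OF smooth_on_dird[OF g(1)]] differentiableI by blast
  have pos: "0 < norm (fst y)" if "y \<in> Omega" for y :: "'a \<times> 'b" using that by (simp add: Omega_iff)
  have r: "0 < r" using pos[OF x] by (simp add: r_def)
  have D1: "dird v u y = F (norm (fst y)) * dird v g y + F1 (norm (fst y)) * (fst y \<bullet> fst v) / norm (fst y) * g y"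
    if "y \<in> Omega" for v y
    unfolding u_def by (rule radial_mult_derivatives[OF that F[OF pos[OF that]] dg])
  have D0: "dird v u y = 0" if "y \<notin> Omega" for v y
    by (rule test_function_outside[OF test_function_dird[OF open_Omega uT] that])
  have 1: "(\<lambda>y. c_Omega \<delta> \<delta>' y * dird (i, 0) u y) = (\<lambda>y. (fst y \<bullet> i) * (k (norm (fst y)) * g y))" for i
  proof
    fix y show "c_Omega \<delta> \<delta>' y * dird (i, 0) u y = (fst y \<bullet> i) * (k (norm (fst y)) * g y)"
    proof (cases "y \<in> Omega")
      case False
      then have "fst y = 0" by (simp add: Omega_iff)
      then show ?thesis by (simp add: D0[OF False])
    next
      case True
      then show ?thesis using pos[OF True]
        by (simp add: D1 g(2) k c_Omega_radial rad_weight_square power2_eq_square)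
    qed
  qed
  have kd: "(\<lambda>y. k (norm (fst y)) * g y) differentiable (at x)"
    using has_derivative_mult[OF radial_derivative[OF x k1] has_derivative_dird[OF dg]] r
    by (auto simp: r_def intro: differentiableI)
  have kx: "(k has_real_derivative k1 r) (at (norm (fst x)))" using k1[OF r] by (simp add: r_def)
  have 2: "dird (i, 0) (\<lambda>y. c_Omega \<delta> \<delta>' y * dird (i, 0) u y) x
      = (fst x \<bullet> i) * (fst x \<bullet> i) * (k1 r / r * g x) + k r * g x" if "i \<in> Basis" for i
    unfolding 1 dird_inner_fst_mult[OF kd] using radial_mult_derivatives[OF x kx dg, of "(i, 0)"] that
    by (simp add: g(2) r_def)
  have "(\<Sum>i\<in>Basis. dird (i, 0) (\<lambda>y. c_Omega \<delta> \<delta>' y * dird (i, 0) u y) x)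
      = (\<Sum>i\<in>Basis. (fst x \<bullet> i) * (fst x \<bullet> i)) * (k1 r / r * g x) + real DIM('a) * (k r * g x)"
    by (simp add: 2 sum.distrib sum_distrib_right[symmetric] del: times_divide_eq_right times_divide_eq_left)
  also have "(\<Sum>i\<in>Basis. (fst x \<bullet> i) * (fst x \<bullet> i)) = r * r"
    unfolding euclidean_inner[symmetric] r_def by (simp add: dot_square_norm power2_eq_square)
  finally have 3: "(\<Sum>i\<in>Basis. dird (i, 0) (\<lambda>y. c_Omega \<delta> \<delta>' y * dird (i, 0) u y) x) = (real DIM('a) * k r + r * k1 r) * g x"
    using r by (simp add: distrib_right)
  have 4: "dird (0, j) u = (\<lambda>y. F (norm (fst y)) * dird (0, j) g y)" for j
  proof
    fix y show "dird (0, j) u y = F (norm (fst y)) * dird (0, j) g y"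
    proof (cases "y \<in> Omega")
      case False
      then have "fst y = 0" by (simp add: Omega_iff)
      then show ?thesis by (simp add: D0[OF False] F0)
    qed (simp add: D1)
  qed
  have 5: "dird (0, j) (dird (0, j) u) x = F r * dird (0, j) (dird (0, j) g) x" for j
    unfolding 4 using radial_mult_derivatives[OF x F[OF pos[OF x]] dg2, of "(0, j)" "(0, j)"] by (simp add: r_def)
  show ?thesis
    unfolding u_def[symmetric] grushin_apply_def 3 5 sum_distrib_left[symmetric] by (simp add: algebra_simps)
qed

section \<open>Volumes of products of shells and balls\<close>

lemma emeasure_lborel_Times:
  fixes A :: "'a::euclidean_space set" and B :: "'b::euclidean_space set"
  assumes "A \<in> sets borel" "B \<in> sets borel"
  shows "A \<times> B \<in> sets borel" "emeasure lborel (A \<times> B) = emeasure lborel A * emeasure lborel B"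
proof -
  show "emeasure lborel (A \<times> B) = emeasure lborel A * emeasure lborel B"
    unfolding lborel_prod[symmetric] using assms by (intro lborel.emeasure_pair_measure_Times) auto
  have "A \<times> B \<in> sets (lborel \<Otimes>\<^sub>M lborel)" using assms by (intro pair_measureI) auto
  then show "A \<times> B \<in> sets borel" unfolding lborel_prod by simp
qed

lemma integral_indicator_ball_Times:
  fixes A :: "'a::euclidean_space set"
  assumes "A \<in> sets borel" "emeasure lborel A = ennreal m" "0 \<le> m" "0 \<le> R"
  defines "I \<equiv> \<lambda>x. indicator (A \<times> cball (0::'b::euclidean_space) R) x :: real"
  shows "integrable lborel I" "(\<integral>x. I x \<partial>lborel) = m * (unit_ball_vol (real DIM('b)) * R ^ DIM('b))"
proof -
  let ?B = "cball (0::'b) R" and ?v = "unit_ball_vol (real DIM('b)) * R ^ DIM('b)"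
  have v: "0 \<le> ?v" using assms(4) by simp
  have e: "emeasure lborel (A \<times> ?B) = ennreal (m * ?v)"
    using emeasure_lborel_Times(2)[of A ?B] assms v by (simp add: emeasure_cball ennreal_mult)
  have s: "A \<times> ?B \<in> sets lborel" using emeasure_lborel_Times(1)[of A ?B] assms by simp
  show "integrable lborel I" unfolding I_def using s e by (intro integrable_real_indicator) auto
  have "(\<integral>x. I x \<partial>lborel) = measure lborel (A \<times> ?B)"
    unfolding I_def using s by simp
  then show "(\<integral>x. I x \<partial>lborel) = m * ?v"
    using e assms(3) v by (simp add: measure_def)
qed

text \<open>Half-open shells are differences of open balls, and consecutive ones are
  disjoint.\<close>

lemma emeasure_shell:
  assumes "p \<le> q"
  defines "A \<equiv> {y :: 'a::euclidean_space. exp p \<le> norm y \<and> norm y < exp q}"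
  shows "A \<in> sets borel"
    "emeasure lborel A = ennreal (unit_ball_vol (real DIM('a)) * (exp q ^ DIM('a) - exp p ^ DIM('a)))"
proof -
  have A: "A = ball 0 (exp q) - ball 0 (exp p)" by (auto simp: A_def)
  have sub: "ball (0::'a) (exp p) \<subseteq> ball 0 (exp q)" using assms(1) by (intro subset_ball) simp
  show "A \<in> sets borel" unfolding A by auto
  have "emeasure lborel A = emeasure lborel (ball (0::'a) (exp q)) - emeasure lborel (ball (0::'a) (exp p))"
    unfolding A using sub by (intro emeasure_Diff) (auto simp: emeasure_ball)
  also have "\<dots> = ennreal (unit_ball_vol (real DIM('a)) * (exp q ^ DIM('a) - exp p ^ DIM('a)))"
    using assms(1) by (simp add: emeasure_ball ennreal_minus right_diff_distrib)
  finally show "emeasure lborel A = ennreal (unit_ball_vol (real DIM('a)) * (exp q ^ DIM('a) - exp p ^ DIM('a)))" .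
qed

text \<open>The measure \<open>|x|\<^sup>-\<^sup>n dx\<close> gives the same mass to all shells
  \<open>e\<^sup>t \<le> |x| < e\<^sup>t\<^sup>+\<^sup>1\<close>.\<close>

lemma integral_ge_shells:
  fixes f :: "'a::euclidean_space \<times> 'b::euclidean_space \<Rightarrow> real"
  assumes f: "integrable lborel f" "\<And>x. 0 \<le> f x" and \<kappa>: "0 \<le> \<kappa>" and R: "0 \<le> R"
    and lower: "\<And>x. exp p \<le> norm (fst x) \<Longrightarrow> norm (fst x) < exp (p + real N) \<Longrightarrow> norm (snd x) \<le> R \<Longrightarrow>
      \<kappa> * norm (fst x) powr (- real DIM('a)) \<le> f x"
  shows "\<kappa> * real N * (unit_ball_vol (real DIM('a)) * (1 - exp (- real DIM('a)))) * (unit_ball_vol (real DIM('b)) * R ^ DIM('b)) \<le> (\<integral>x. f x \<partial>lborel)"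
proof -
  let ?n = "real DIM('a)" and ?V = "unit_ball_vol (real DIM('a))" and ?W = "unit_ball_vol (real DIM('b)) * R ^ DIM('b)"
  define X where "X j = {y :: 'a. exp (p + real j) \<le> norm y \<and> norm y < exp (p + real j + 1)}" for j
  \<comment> \<open>A lower value of the bound on shell \<open>j\<close>, taken at the outer radius.
    It cancels the factor exp (n (p + j + 1)) in the volume, so every shell contributes the same
    amount.\<close>
  define l where "l j = \<kappa> * exp (- ?n * (p + real j + 1))" for j
  define I where "I j x = (indicator (X j \<times> cball (0::'b) R) x :: real)" for j and x :: "'a \<times> 'b"
  note sh = emeasure_shell[where 'a = 'a, of "p + real j" "p + real j + 1" for j, folded X_def]
  have vol: "exp (p + real j + 1) ^ DIM('a) - exp (p + real j) ^ DIM('a) = exp (?n * (p + real j + 1)) * (1 - exp (- ?n))" for j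
    by (simp add: exp_of_nat_mult[symmetric] exp_add[symmetric] right_diff_distrib algebra_simps)
  have m0: "0 \<le> ?V * (exp (?n * (p + real j + 1)) * (1 - exp (- ?n)))" for j by simp
  note II = integral_indicator_ball_Times[where 'b = 'b, OF sh(1) sh(2)[unfolded vol] m0 R, folded I_def]
  have "\<kappa> * real N * (?V * (1 - exp (- ?n))) * ?W = (\<Sum>j<N. l j * (?V * (exp (?n * (p + real j + 1)) * (1 - exp (- ?n))) * ?W))"
  proof -
    have "l j * (?V * (exp (?n * (p + real j + 1)) * (1 - exp (- ?n))) * ?W) = \<kappa> * (?V * (1 - exp (- ?n))) * ?W" for j
    proof -
      have eq: "\<kappa> * e * (v * (e' * m) * w) = (e * e') * (\<kappa> * (v * m) * w)" for e v e' m w :: real by simp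
      have one: "exp (- ?n * (p + real j + 1)) * exp (?n * (p + real j + 1)) = 1" by (simp add: exp_add[symmetric])
      show ?thesis unfolding l_def eq one by simp
    qed
    then show ?thesis by (simp only: sum_constant card_lessThan mult_ac)
  qed
  also have "\<dots> = (\<integral>x. (\<Sum>j<N. l j * I j x) \<partial>lborel)"
    using II by (subst Bochner_Integration.integral_sum) auto
  also have "\<dots> \<le> (\<integral>x. f x \<partial>lborel)"
  proof (rule integral_mono)
    show "integrable lborel (\<lambda>x. \<Sum>j<N. l j * I j x)"
      using II by (intro Bochner_Integration.integrable_sum integrable_mult_right) auto
    show "integrable lborel f" by (rule f)
    fix x :: "'a \<times> 'b"
    show "(\<Sum>j<N. l j * I j x) \<le> f x"
    proof (cases "\<exists>i<N. fst x \<in> X i \<and> norm (snd x) \<le> R")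
      case False
      then have "(\<Sum>j<N. l j * I j x) = 0"
        by (intro sum.neutral) (auto simp: I_def indicator_def mem_Times_iff)
      then show ?thesis using f(2) by simp
    next
      case True
      then obtain i where i: "i < N" "fst x \<in> X i" "norm (snd x) \<le> R" by blast
      have uniq: "j = i" if "fst x \<in> X j" for j
      proof (rule ccontr)
        assume "j \<noteq> i"
        then consider "j + 1 \<le> i" | "i + 1 \<le> j" by linarith
        then show False
        proof cases
          case 1
          then have "exp (p + real j + 1) \<le> exp (p + real i)" by simp
          moreover have "norm (fst x) < exp (p + real j + 1)" "exp (p + real i) \<le> norm (fst x)"
            using that i(2) by (simp_all add: X_def)
          ultimately show False by linarith
        next
          case 2
          then have "exp (p + real i + 1) \<le> exp (p + real j)" by simp
          moreover have "norm (fst x) < exp (p + real i + 1)" "exp (p + real j) \<le> norm (fst x)"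
            using that i(2) by (simp_all add: X_def)
          ultimately show False by linarith
        qed
      qed
      have "(\<Sum>j<N. l j * I j x) = (\<Sum>j<N. if j = i then l i else 0)"
      proof (intro sum.cong refl)
        fix j
        show "l j * I j x = (if j = i then l i else 0)"
        proof (cases "j = i")
          case True
          then show ?thesis using i(2,3) by (simp add: I_def mem_Times_iff)
        next
          case False
          then have "fst x \<notin> X j" using uniq by blast
          then show ?thesis using False by (simp add: I_def mem_Times_iff)
        qed
      qed
      also have "\<dots> = l i" using i(1) by simp
      also have "l i \<le> \<kappa> * norm (fst x) powr (- ?n)"
      proof -
        have r: "0 < norm (fst x)" "norm (fst x) \<le> exp (p + real i + 1)"
          using i(2) exp_gt_zero[of "p + real i"] unfolding X_def mem_Collect_eq by linarith+
        have "exp (p + real i + 1) powr (- ?n) \<le> norm (fst x) powr (- ?n)"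
          using r by (intro powr_mono2') auto
        moreover have "exp (p + real i + 1) powr (- ?n) = exp (- ?n * (p + real i + 1))"
          by (simp add: powr_def)
        ultimately show ?thesis unfolding l_def using \<kappa> by (intro mult_left_mono) simp_all
      qed
      also have "\<dots> \<le> f x"
      proof (rule lower)
        show "norm (snd x) \<le> R" by (rule i)
        have "exp p \<le> exp (p + real i)" by simp
        then show "exp p \<le> norm (fst x)" using i(2) unfolding X_def mem_Collect_eq by linarith
        have "exp (p + real i + 1) \<le> exp (p + real N)" using i(1) by simp
        then show "norm (fst x) < exp (p + real N)" using i(2) unfolding X_def mem_Collect_eq by linarith
      qed
      finally show ?thesis .
    qed
  qed
  finally show ?thesis .
qed

section \<open>Weights close to the critical end\<close>

text \<open>The smaller of the two exponents governs the weight near the origin if \<open>\<delta> \<le> \<delta>'\<close>, and near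
  infinity otherwise; the test functions live in the corresponding range of \<open>ln r\<close>.\<close>

definition window_start :: "real \<Rightarrow> real \<Rightarrow> nat \<Rightarrow> real" where
  "window_start \<delta> \<delta>' N = (if \<delta> \<le> \<delta>' then - (2 * real N + 2) else real N)"

text \<open>The window for ln r is [-2N - 2, -N] or [N, 2N + 2], so r / (1 + r) is within exp (-N)
  of 0 or of 1. There c r^(-mu), with mu the smaller exponent, lies within a factor \<open>K\<close>
  of 1, because 1 + r <= 2 or r / (1 + r) >= 1 / 2. The exponent \<alpha> solves 2 + \<alpha> = mu +
  n / 2, which makes the square of \<open>P\<close> comparable to r^(-n).\<close>

lemma window_estimates:
  fixes n \<delta> \<delta>' r :: real
  assumes r: "0 < r" and lo: "window_start \<delta> \<delta>' N \<le> ln r" and hi: "ln r \<le> window_start \<delta> \<delta>' N + real N + 2"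
  defines "\<alpha> \<equiv> (n + 2 * min \<delta> \<delta>' - 4) / 2" and "K \<equiv> 2 powr \<bar>\<delta> - \<delta>'\<bar>"
  defines "P \<equiv> rad_weight \<delta> \<delta>' r * r powr (- \<alpha>)"
  shows "\<bar>c_slope \<delta> \<delta>' r - min \<delta> \<delta>'\<bar> \<le> \<bar>\<delta> - \<delta>'\<bar> * exp (- real N)"
    and "1 / K\<^sup>2 * r powr (- n) \<le> P\<^sup>2" and "P\<^sup>2 \<le> K\<^sup>2 * r powr (- n)"
proof -
  define \<kappa> where "\<kappa> = c_fun \<delta> \<delta>' r * r powr (- min \<delta> \<delta>')"
  have K: "1 \<le> K" unfolding K_def by (rule ge_one_powr_ge_zero) auto
  have main: "\<bar>c_slope \<delta> \<delta>' r - min \<delta> \<delta>'\<bar> \<le> \<bar>\<delta> - \<delta>'\<bar> * exp (- real N) \<and> 1 / K \<le> \<kappa> \<and> \<kappa> \<le> K"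
  proof (cases "\<delta> \<le> \<delta>'")
    case True
    have l: "ln r \<le> - real N" using hi True by (simp add: window_start_def)
    then have rN: "r \<le> exp (- real N)" using r by (metis exp_le_cancel_iff exp_ln)
    then have r1: "r \<le> 1" by (rule order_trans) simp
    have "r / (1 + r) \<le> r" using r by (simp add: divide_simps)
    then have "r / (1 + r) \<le> exp (- real N)" using rN by simp
    then have 1: "(\<delta>' - \<delta>) * (r / (1 + r)) \<le> (\<delta>' - \<delta>) * exp (- real N)" using True by (intro mult_left_mono) auto
    have 0: "0 \<le> (\<delta>' - \<delta>) * (r / (1 + r))" using True r by simp
    have "\<kappa> = (1 + r) powr (\<delta>' - \<delta>) * (r powr \<delta> * r powr (- \<delta>))" using True by (simp add: \<kappa>_def c_fun_def)
    also have "r powr \<delta> * r powr (- \<delta>) = 1" using r by (simp add: powr_add[symmetric])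
    finally have \<kappa>: "\<kappa> = (1 + r) powr (\<delta>' - \<delta>)" by simp
    have "1 \<le> \<kappa>" unfolding \<kappa> using r True by (intro ge_one_powr_ge_zero) auto
    moreover have "\<kappa> \<le> K" unfolding \<kappa> K_def using r r1 True by (auto intro: powr_mono2)
    moreover have "1 / K \<le> 1" using K by simp
    moreover have "\<bar>c_slope \<delta> \<delta>' r - min \<delta> \<delta>'\<bar> \<le> \<bar>\<delta> - \<delta>'\<bar> * exp (- real N)"
      using 0 1 True by (simp only: c_slope_def min_absorb1 abs_of_nonneg abs_of_nonpos add_diff_cancel_left' diff_le_0_iff_le minus_diff_eq)
    ultimately show ?thesis by linarith
  next
    case False
    have l: "real N \<le> ln r" using lo False by (simp add: window_start_def)
    then have rN: "exp (real N) \<le> r" using r by (metis exp_le_cancel_iff exp_ln)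
    moreover have "1 \<le> exp (real N)" by simp
    ultimately have r1: "1 \<le> r" by linarith
    have "c_slope \<delta> \<delta>' r - \<delta>' = (\<delta> - \<delta>') * (1 / (1 + r))" using r by (simp add: c_slope_def field_simps)
    moreover have "1 / (1 + r) \<le> 1 / exp (real N)" using rN r by (intro divide_left_mono) auto
    then have "1 / (1 + r) \<le> exp (- real N)" by (simp add: exp_minus divide_inverse)
    then have 1: "(\<delta> - \<delta>') * (1 / (1 + r)) \<le> (\<delta> - \<delta>') * exp (- real N)" using False by (intro mult_left_mono) auto
    moreover have 0: "0 \<le> (\<delta> - \<delta>') * (1 / (1 + r))" using False r by simp
    moreover have "min \<delta> \<delta>' = \<delta>'" "\<bar>\<delta> - \<delta>'\<bar> = \<delta> - \<delta>'" using False by auto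
    ultimately have c: "\<bar>c_slope \<delta> \<delta>' r - min \<delta> \<delta>'\<bar> \<le> \<bar>\<delta> - \<delta>'\<bar> * exp (- real N)" by linarith
    have "\<kappa> = (r / (1 + r)) powr (\<delta> - \<delta>')"
      using False r by (simp add: \<kappa>_def c_fun_def powr_divide powr_diff powr_minus field_simps)
    moreover have t: "1 / 2 \<le> r / (1 + r)" "r / (1 + r) \<le> 1" using r r1 by (auto simp: divide_simps)
    then have "(1 / 2) powr (\<delta> - \<delta>') \<le> (r / (1 + r)) powr (\<delta> - \<delta>')" using False by (intro powr_mono2) auto
    moreover have "(1 / 2) powr (\<delta> - \<delta>') = 1 / K" using False by (simp add: K_def powr_divide)
    moreover have "(r / (1 + r)) powr (\<delta> - \<delta>') \<le> 1" using t r False by (intro powr_le1) auto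
    ultimately show ?thesis using c K by auto
  qed
  then show "\<bar>c_slope \<delta> \<delta>' r - min \<delta> \<delta>'\<bar> \<le> \<bar>\<delta> - \<delta>'\<bar> * exp (- real N)" by simp
  have "r powr (-2) * r powr (- \<alpha>) = r powr (- min \<delta> \<delta>') * r powr (- n / 2)"
    unfolding powr_add[symmetric] by (rule arg_cong[of _ _ "\<lambda>t. r powr t"]) (simp add: \<alpha>_def field_simps)
  then have P: "P = \<kappa> * r powr (- n / 2)" by (simp add: P_def rad_weight_def \<kappa>_def mult.assoc)
  have "(r powr (- n / 2))\<^sup>2 = r powr (- n)" by (simp add: power2_eq_square powr_add[symmetric])
  then have P2: "P\<^sup>2 = \<kappa>\<^sup>2 * r powr (- n)" by (simp add: P power_mult_distrib)
  have "(1 / K)\<^sup>2 \<le> \<kappa>\<^sup>2" "\<kappa>\<^sup>2 \<le> K\<^sup>2"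
    using main K by (auto intro!: power_mono order_trans[of 0 "1 / K" \<kappa>])
  then have k: "1 / K\<^sup>2 \<le> \<kappa>\<^sup>2" "\<kappa>\<^sup>2 \<le> K\<^sup>2" by (simp_all add: power_divide)
  show "1 / K\<^sup>2 * r powr (- n) \<le> P\<^sup>2" unfolding P2 by (rule mult_right_mono[OF k(1) powr_ge_zero])
  show "P\<^sup>2 \<le> K\<^sup>2 * r powr (- n)" unfolding P2 by (rule mult_right_mono[OF k(2) powr_ge_zero])
qed

section \<open>Optimality\<close>

text \<open>For the coefficient S - 2 mu + 2 of the first derivative of the plateau, with S split
  into its two nonnegative parts.\<close>

lemma abs_combination_le:
  fixes y y' m d d' :: real
  assumes "0 \<le> y" "y \<le> d" "0 \<le> y'" "y' \<le> d'" "0 \<le> m" "m \<le> d + d'"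
  shows "\<bar>y + y' - 2 * m + 2\<bar> \<le> 3 * (d + d') + 2"
  using assms by argo

context grushin
begin

text \<open>\<open>T\<close> and \<open>K\<close> are fixed before \<open>N\<close> and \<theta>.
  The trial functions also have a transverse width R, which has already been sent to infinity in
  this statement; \<theta> is the parameter of Young's inequality that separates the main term from
  the errors.\<close>

lemma optimality_estimate:
  assumes A: "0 < rellich_root (real DIM('a)) \<delta> \<delta>'" and ineq: "rellich_inequality \<delta> \<delta>' H a"
  obtains T K where "\<And>N \<theta>. 1 \<le> N \<Longrightarrow> 0 < \<theta> \<Longrightarrow>
    a \<le> (1 + \<theta>) * (rellich_root (real DIM('a)) \<delta> \<delta>' + T * exp (- real N))\<^sup>2 + (1 + 1 / \<theta>) * K / real N"
proof -
  let ?n = "real DIM('a)" and ?m = "DIM('b)" and ?A = "rellich_root (real DIM('a)) \<delta> \<delta>'"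
  let ?M = "lebesgue_on (Omega :: ('a \<times> 'b) set)"
  define \<mu> where "\<mu> = min \<delta> \<delta>'"
  define \<alpha> where "\<alpha> = (?n + 2 * \<mu> - 4) / 2"
  define K0 where "K0 = 2 powr \<bar>\<delta> - \<delta>'\<bar>"
  define V where "V = unit_ball_vol ?n"
  define W where "W = unit_ball_vol (real ?m)"
  have n1: "1 \<le> ?n" by (simp add: Suc_leI)
  \<comment> \<open>Where c = r^mu, H multiplies r^(-\<alpha>) by chi \<alpha> (n - 2 + mu -
    \<alpha>), and the bracket equals n / 2.\<close>
  have A\<alpha>: "?A = \<alpha> * ?n / 2" by (simp add: rellich_root_def \<alpha>_def \<mu>_def)
  have \<alpha>0: "0 < \<alpha>" using A n1 unfolding A\<alpha> by (simp add: zero_less_mult_iff)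
  have VW: "0 < V" "0 < W" by (simp_all add: V_def W_def)
  have K0: "1 \<le> K0" unfolding K0_def by (rule ge_one_powr_ge_zero) auto
  obtain Cz where plat: "\<forall>p q. \<exists>\<zeta> \<zeta>1 \<zeta>2. plateau_function p q Cz \<zeta> \<zeta>1 \<zeta>2"
    by (rule plateau_function_exists)
  obtain Ct where Ct0: "0 \<le> Ct" and trans: "\<forall>R\<ge>1. \<exists>g :: 'a \<times> 'b \<Rightarrow> real. transverse_cutoff R Ct g"
    by (rule transverse_cutoff_exists)
  define B0 where "B0 = 3 * (\<delta> + \<delta>') + 2"
  define T where "T = \<alpha> * \<bar>\<delta> - \<delta>'\<bar>"
  \<comment> \<open>The two edges are covered by two shells of length 2 in ln r; the power of 2 at
    the end comes from the support of the cutoff in the ball of radius 2R.\<close>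
  define c1 where "c1 = ((B0 + 1) * Cz)\<^sup>2 * K0\<^sup>2 * (2 * (V * (exp (2 * ?n) - 1))) * (W * 2 ^ ?m)"
  define c3 where "c3 = 1 / K0\<^sup>2 * (V * (1 - exp (- ?n))) * W"
  have c3: "0 < c3" unfolding c3_def using K0 VW n1 by simp
  have estimate: "a \<le> (1 + \<theta>) * (?A + T * exp (- real N))\<^sup>2 + (1 + 1 / \<theta>) * (2 * c1 / c3) / real N"
    if N: "1 \<le> N" and \<theta>: "0 < \<theta>" for N \<theta>
  proof -
    define p where "p = window_start \<delta> \<delta>' N"
    \<comment> \<open>A plateau of length N between two edges of length 1.\<close>
    define q where "q = p + real N + 2"
    define E where "E = (1 + \<theta>) * (?A + T * exp (- real N))\<^sup>2"
    \<comment> \<open>This depends on N through \<open>p\<close> and \<open>q\<close> without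
      control and is removed by R^(-4) at fixed N. The shell ends at q + 1 because shells are
      half-open and ln r = q occurs.\<close>
    define c2 where "c2 = (C * exp (- \<alpha> * p) * Ct)\<^sup>2 * (V * (exp (q + 1) ^ DIM('a) - exp p ^ DIM('a))) * (W * 2 ^ ?m)"
    have pq: "p \<le> q" by (simp add: q_def)
    obtain \<zeta> \<zeta>1 \<zeta>2 where "plateau_function p q Cz \<zeta> \<zeta>1 \<zeta>2" using plat by blast
    then interpret plateau_function p q Cz \<zeta> \<zeta>1 \<zeta>2 .
    note s\<zeta> = plateau_smooth and d\<zeta> = plateau_derivatives and r\<zeta> = plateau_range
      and out\<zeta> = plateau_zero and edge = plateau_edges
    define P where "P r = rad_weight \<delta> \<delta>' r * r powr (- \<alpha>)" for r
    define F where "F r = r powr (- \<alpha>) * \<zeta> (ln r)" for r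
    define F1 where "F1 r = r powr (- \<alpha>) / r * (\<zeta>1 (ln r) - \<alpha> * \<zeta> (ln r))" for r
    define k where "k r = P r * (\<zeta>1 (ln r) - \<alpha> * \<zeta> (ln r))" for r
    define k1 where "k1 r = P r / r * ((c_slope \<delta> \<delta>' r - 2 - \<alpha>) * (\<zeta>1 (ln r) - \<alpha> * \<zeta> (ln r)) + (\<zeta>2 (ln r) - \<alpha> * \<zeta>1 (ln r)))" for r
    have dpow: "((\<lambda>r. r powr (- \<alpha>)) has_real_derivative (- \<alpha>) * (r powr (- \<alpha>) / r)) (at r)" if "0 < r" for r
      using has_real_derivative_powr[OF that, of "- \<alpha>"] that by (simp add: powr_diff)
    have dln: "((\<lambda>r. f (ln r)) has_real_derivative f' (ln r) * (1 / r)) (at r)"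
      if "\<And>t. (f has_real_derivative f' t) (at t)" "0 < r" for f f' :: "real \<Rightarrow> real" and r
      by (rule DERIV_chain2[OF that(1) DERIV_ln_divide[OF that(2)]])
    have dF: "(F has_real_derivative F1 r) (at r)" if r: "0 < r" for r
      unfolding F_def[abs_def] F1_def
      by (rule DERIV_cong[OF DERIV_mult[OF dpow[OF r] dln[OF d\<zeta>(1) r]]]) (simp add: algebra_simps)
    have F0: "F 0 = 0" by (simp add: F_def)
    have kF: "k r = rad_weight \<delta> \<delta>' r * (r * F1 r)" if "0 < r" for r
      using that by (simp add: k_def P_def F1_def)
    have dP: "(P has_real_derivative P r * (c_slope \<delta> \<delta>' r - 2 - \<alpha>) / r) (at r)" if r: "0 < r" for r
      unfolding P_def[abs_def]
      by (rule DERIV_cong[OF DERIV_mult[OF rad_weight_derivative[OF r] dpow[OF r]]])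
        (simp add: algebra_simps add_divide_distrib diff_divide_distrib)
    have dk: "(k has_real_derivative k1 r) (at r)" if r: "0 < r" for r
      unfolding k_def[abs_def] k1_def
      by (rule DERIV_cong[OF DERIV_mult[OF dP[OF r] DERIV_diff[OF dln[OF d\<zeta>(2) r] DERIV_cmult[OF dln[OF d\<zeta>(1) r], of \<alpha>]]]])
        (simp add: algebra_simps add_divide_distrib diff_divide_distrib)
    have sF: "smooth_on {0<..} F" unfolding F_def[abs_def]
      by (rule smooth_on_mult[OF open_greaterThan smooth_on_powr smooth_on_compose[OF open_greaterThan open_UNIV UNIV_I s\<zeta> smooth_on_ln]])
    \<comment> \<open>\<open>Q\<close> is the squared norm of the weighted trial function of width
      \<open>R\<close>. Its lower bound and the errors all carry R^d2, so this power cancels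
      later.\<close>
    have step: "\<exists>Q. c3 * real N * R ^ ?m \<le> Q \<and> a * Q \<le> E * Q + (1 + 1 / \<theta>) * (2 * ((c1 + c2 / R ^ 4) * R ^ ?m))"
      if R: "1 \<le> R" for R
    proof -
      obtain g :: "'a \<times> 'b \<Rightarrow> real" where "transverse_cutoff R Ct g" using trans R by blast
      then interpret transverse_cutoff R Ct g .
      note sg = cutoff_smooth and g1 = cutoff_dird and rg = cutoff_range and gin = cutoff_one
        and gout = cutoff_zero and \<Delta>g = cutoff_laplacian
      define \<Delta> where "\<Delta> x = (\<Sum>j\<in>Basis. dird (0, j) (dird (0, j) g) x)" for x
      define u where "u = (\<lambda>x. F (norm (fst x)) * g x)"
      have u: "u \<in> test_functions Omega" unfolding u_def
      proof (rule test_functionI[OF open_Omega])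
        show "smooth_on Omega (\<lambda>x. F (norm (fst x)) * g x)"
          by (rule smooth_on_mult[OF open_Omega smooth_on_radial[OF sF] smooth_on_subset[OF sg subset_UNIV]])
        show "compact ((cball 0 (exp q) - ball 0 (exp p)) \<times> cball 0 (2 * R) :: ('a \<times> 'b) set)"
          by (intro compact_Times compact_diff compact_cball open_ball)
        show "(cball 0 (exp q) - ball 0 (exp p)) \<times> cball 0 (2 * R) \<subseteq> (Omega :: ('a \<times> 'b) set)"
          by (auto simp: Omega_iff)
        fix x :: "'a \<times> 'b" assume x: "x \<notin> (cball 0 (exp q) - ball 0 (exp p)) \<times> cball 0 (2 * R)"
        show "F (norm (fst x)) * g x = 0"
        proof (cases "norm (snd x) > 2 * R \<or> fst x = 0")
          case True then show ?thesis using gout[of x] F0 by auto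
        next
          case False
          then have "norm (fst x) > exp q \<or> norm (fst x) < exp p" using x by (auto simp: mem_Times_iff)
          moreover have "exp (ln (norm (fst x))) = norm (fst x)" using False by simp
          ultimately have "ln (norm (fst x)) \<notin> {p..q}" by (metis atLeastAtMost_iff exp_le_cancel_iff not_less)
          then show ?thesis using out\<zeta> by (simp add: F_def)
        qed
      qed
      define L where "L = grushin_apply \<delta> \<delta>' \<beta> u"
      have LH: "(u, L) \<in> H" unfolding L_def by (rule test_function_in_operator[OF u])
      define X where "X x = rellich_weight \<delta> \<delta>' x * u x" for x
      have sw: "smooth_on (Omega :: ('a \<times> 'b) set) (rellich_weight \<delta> \<delta>')"
        unfolding rellich_weight_radial[abs_def] by (rule smooth_on_radial[OF smooth_on_rad_weight])
      have X: "X \<in> test_functions Omega" unfolding X_def[abs_def] by (rule test_function_mult[OF open_Omega u sw])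
      define Q where "Q = (\<integral>x. X x * X x \<partial>lborel)"
      have QM: "l2_inner ?M X X = Q" unfolding Q_def by (rule test_function_l2_inner[OF X X])
      have "a * l2_inner ?M X X \<le> l2_inner ?M L L"
        using ineq LH unfolding rellich_inequality_def X_def[abs_def] by blast
      then have aQ: "a * Q \<le> l2_inner ?M L L" by (simp add: QM)
      have LL: "L \<in> L2 ?M"
      proof -
        obtain S where "closed_form_operator ?M (test_functions Omega) (grushin_form \<delta> \<delta>' \<beta>) H S" by (rule square_root)
        then interpret closed_form_operator ?M "test_functions Omega" "grushin_form \<delta> \<delta>' \<beta>" H S .
        show ?thesis by (rule operator_approx[OF LH])
      qed
      have Xeq: "X x = P (norm (fst x)) * \<zeta> (ln (norm (fst x))) * g x" for x
        by (simp add: X_def u_def F_def P_def rellich_weight_radial)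
      define sh where "sh p q = {y :: 'a. exp p \<le> norm y \<and> norm y < exp q}" for p q
      define I where "I p q x = (indicator (sh p q \<times> cball (0::'b) (2 * R)) x :: real)" for p q x
      \<comment> \<open>The closed edge intervals of length 1 lie inside half-open shells of length
        2.\<close>
      define Z1 where "Z1 x = ((B0 + 1) * Cz)\<^sup>2 * K0\<^sup>2 * (exp (- ?n * p) * I p (p + 2) x + exp (- ?n * (q - 1)) * I (q - 1) (q - 1 + 2) x)" for x
      define Z2 where "Z2 x = (C * exp (- \<alpha> * p) * (Ct / R\<^sup>2))\<^sup>2 * I p (q + 1) x" for x
      have I0: "0 \<le> I p q x" for p q x by (simp add: I_def)
      have Z0: "0 \<le> Z1 x" "0 \<le> Z2 x" for x by (simp_all add: Z1_def Z2_def I0)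
      have In: "integrable lborel (I p q)"
        "(\<integral>x. I p q x \<partial>lborel) = V * (exp q ^ DIM('a) - exp p ^ DIM('a)) * (W * (2 * R) ^ ?m)" if "p \<le> q" for p q
      proof -
        have m0: "0 \<le> V * (exp q ^ DIM('a) - exp p ^ DIM('a))"
          using VW that by (intro mult_nonneg_nonneg) (auto intro: power_mono)
        note sh = emeasure_shell[where 'a = 'a, OF that, folded sh_def V_def]
        note * = integral_indicator_ball_Times[where 'b = 'b, OF sh m0, of "2 * R"]
        show "integrable lborel (I p q)" unfolding I_def[abs_def] using *(1) R by simp
        show "(\<integral>x. I p q x \<partial>lborel) = V * (exp q ^ DIM('a) - exp p ^ DIM('a)) * (W * (2 * R) ^ ?m)"
          unfolding I_def W_def using *(2) R by simp
      qed
      have ipow: "exp (t + 2) ^ DIM('a) - exp t ^ DIM('a) = exp (?n * t) * (exp (2 * ?n) - 1)" for t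
        by (simp add: exp_of_nat_mult[symmetric] exp_add[symmetric] right_diff_distrib algebra_simps)
      have Iexp: "exp (- ?n * t) * (\<integral>x. I t (t + 2) x \<partial>lborel) = V * (exp (2 * ?n) - 1) * (W * (2 * R) ^ ?m)" for t
      proof -
        have "exp (- ?n * t) * exp (?n * t) = 1" by (simp add: exp_add[symmetric])
        moreover have "e * (V * (e' * y) * z) = (e * e') * (V * y * z)" for e e' y z :: real by simp
        ultimately show ?thesis using In(2)[of t "t + 2"] unfolding ipow by simp
      qed
      have Z1i: "integrable lborel Z1" "(\<integral>x. Z1 x \<partial>lborel) = c1 * R ^ ?m"
      proof -
        show "integrable lborel Z1" unfolding Z1_def[abs_def] using In(1) by simp
        have "(\<integral>x. Z1 x \<partial>lborel) = ((B0 + 1) * Cz)\<^sup>2 * K0\<^sup>2 * (exp (- ?n * p) * (\<integral>x. I p (p + 2) x \<partial>lborel)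
            + exp (- ?n * (q - 1)) * (\<integral>x. I (q - 1) (q - 1 + 2) x \<partial>lborel))"
          unfolding Z1_def using In(1)[of p "p + 2"] In(1)[of "q - 1" "q - 1 + 2"] by simp
        then show "(\<integral>x. Z1 x \<partial>lborel) = c1 * R ^ ?m"
          unfolding Iexp c1_def by (simp add: power_mult_distrib)
      qed
      have Z2i: "integrable lborel Z2" "(\<integral>x. Z2 x \<partial>lborel) = c2 / R ^ 4 * R ^ ?m"
      proof -
        show "integrable lborel Z2" unfolding Z2_def[abs_def] using In(1)[of p "q + 1"] pq by simp
        have "(\<integral>x. Z2 x \<partial>lborel) = (C * exp (- \<alpha> * p) * (Ct / R\<^sup>2))\<^sup>2 * (V * (exp (q + 1) ^ DIM('a) - exp p ^ DIM('a)) * (W * (2 * R) ^ ?m))"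
          unfolding Z2_def using In(2)[of p "q + 1"] pq by simp
        then show "(\<integral>x. Z2 x \<partial>lborel) = c2 / R ^ 4 * R ^ ?m"
          unfolding c2_def by (simp add: power_mult_distrib power_divide power2_eq_square power4_eq_xxxx)
      qed
      have pt: "(L x)\<^sup>2 \<le> E * (X x)\<^sup>2 + (1 + 1 / \<theta>) * (2 * (Z1 x + Z2 x))" if x: "x \<in> Omega" for x
      proof -
        define r where "r = norm (fst x)"
        have r: "0 < r" using x by (simp add: r_def Omega_iff)
        have rhs0: "0 \<le> E * (X x)\<^sup>2 + (1 + 1 / \<theta>) * (2 * (Z1 x + Z2 x))"
          using \<theta> Z0 by (simp add: E_def)
        have Lx: "L x = - (?n * k r + r * k1 r) * g x - \<beta> (fst x) * (F r * \<Delta> x)"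
          unfolding L_def u_def r_def \<Delta>_def by (rule grushin_apply_radial[OF dF F0 kF dk sg g1 u[unfolded u_def] x])
        show ?thesis
        proof (cases "ln r \<in> {p..q}")
          case False
          then have z: "\<zeta> (ln r) = 0" "\<zeta>1 (ln r) = 0 \<and> \<zeta>2 (ln r) = 0"
            using out\<zeta>[OF False] edge[of "ln r"] q_def N by auto
          then have "L x = 0" unfolding Lx by (simp add: k_def k1_def F_def)
          then show ?thesis using rhs0 by simp
        next
          case True
          define S where "S = c_slope \<delta> \<delta>' r"
          define z z1 z2 where "z = \<zeta> (ln r)" and "z1 = \<zeta>1 (ln r)" and "z2 = \<zeta>2 (ln r)"
          have win: "window_start \<delta> \<delta>' N \<le> ln r" "ln r \<le> window_start \<delta> \<delta>' N + real N + 2"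
            using True by (auto simp: p_def q_def)
          note we = window_estimates(1)[OF r win, folded \<mu>_def, folded S_def]
            window_estimates(2,3)[OF r win, of ?n, folded \<mu>_def, folded \<alpha>_def K0_def, folded P_def]
          have rp: "exp p \<le> r" using True r by (metis atLeastAtMost_iff exp_le_cancel_iff exp_ln)
          \<comment> \<open>\<open>x0\<close> is the main term, \<open>y1\<close> the error from
            derivatives of the plateau, \<open>y2\<close> the error from x2-derivatives of the
            cutoff.\<close>
          define x0 where "x0 = (?A + \<alpha> * (S - \<mu>)) * X x"
          define y1 where "y1 = P r * g x * ((S - 2 * \<mu> + 2) * z1 + z2)"
          define y2 where "y2 = \<beta> (fst x) * (F r * \<Delta> x)"
          have Leq: "L x = x0 - (y1 + y2)"
          proof -
            have "- (?n * k r + r * k1 r) = P r * (\<alpha> * (?n - 2 + S - \<alpha>) * z - (?n - 2 + S - 2 * \<alpha>) * z1 - z2)"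
              using r by (simp add: k_def k1_def S_def z_def z1_def z2_def algebra_simps)
            also have "\<alpha> * (?n - 2 + S - \<alpha>) = ?A + \<alpha> * (S - \<mu>)"
              unfolding A\<alpha> by (simp add: \<alpha>_def field_simps)
            also have "?n - 2 + S - 2 * \<alpha> = S - 2 * \<mu> + 2"
            proof -
              have "2 * \<alpha> = ?n + 2 * \<mu> - 4" by (simp add: \<alpha>_def)
              then show ?thesis by simp
            qed
            finally have e: "- (?n * k r + r * k1 r) = P r * ((?A + \<alpha> * (S - \<mu>)) * z - (S - 2 * \<mu> + 2) * z1 - z2)" .
            show ?thesis unfolding Lx e x0_def y1_def y2_def Xeq r_def[symmetric] z_def[symmetric]
              by (simp add: algebra_simps)
          qed
          have "(L x)\<^sup>2 \<le> (1 + \<theta>) * x0\<^sup>2 + (1 + 1 / \<theta>) * (2 * (y1\<^sup>2 + y2\<^sup>2))"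
          proof -
            \<comment> \<open>This square yields (x0 - y)^2 <= (1 + \<theta>) x0^2 + (1 + 1 /
              \<theta>) y^2 for y = y1 + y2.\<close>
            have "0 \<le> (\<theta> * x0 + (y1 + y2))\<^sup>2 / \<theta>" using \<theta> by simp
            also have "\<dots> = \<theta> * x0\<^sup>2 + 2 * (x0 * (y1 + y2)) + (y1 + y2)\<^sup>2 / \<theta>"
              using \<theta> by (simp add: power2_eq_square field_simps)
            finally have "(x0 - (y1 + y2))\<^sup>2 \<le> (1 + \<theta>) * x0\<^sup>2 + (1 + 1 / \<theta>) * (y1 + y2)\<^sup>2"
              by (simp add: power2_diff algebra_simps)
            moreover have "(y1 + y2)\<^sup>2 \<le> 2 * (y1\<^sup>2 + y2\<^sup>2)"
              using sum_squares_bound[of y1 y2] by (simp add: power2_sum)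
            then have "(1 + 1 / \<theta>) * (y1 + y2)\<^sup>2 \<le> (1 + 1 / \<theta>) * (2 * (y1\<^sup>2 + y2\<^sup>2))"
              using \<theta> by (intro mult_left_mono) auto
            ultimately show ?thesis unfolding Leq by linarith
          qed
          moreover have "(1 + \<theta>) * x0\<^sup>2 \<le> E * (X x)\<^sup>2"
          proof -
            have "\<bar>\<alpha> * (S - \<mu>)\<bar> \<le> T * exp (- real N)"
              using mult_left_mono[OF we(1), of \<alpha>] \<alpha>0 by (simp add: abs_mult T_def mult.assoc)
            then have "\<bar>?A + \<alpha> * (S - \<mu>)\<bar> \<le> \<bar>?A + T * exp (- real N)\<bar>" using A by linarith
            then have "(?A + \<alpha> * (S - \<mu>))\<^sup>2 \<le> (?A + T * exp (- real N))\<^sup>2" by (simp add: abs_le_square_iff)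
            then have "(?A + \<alpha> * (S - \<mu>))\<^sup>2 * (X x)\<^sup>2 \<le> (?A + T * exp (- real N))\<^sup>2 * (X x)\<^sup>2"
              by (rule mult_right_mono) simp
            then show ?thesis using \<theta> unfolding x0_def E_def power_mult_distrib by (simp add: mult.assoc)
          qed
          moreover have "y1\<^sup>2 \<le> Z1 x"
          proof (cases "norm (snd x) > 2 * R \<or> (ln r \<notin> {p..p+1} \<and> ln r \<notin> {q-1..q})")
            case True
            then have "y1 = 0" using gout[of x] edge[of "ln r"] by (auto simp: y1_def z1_def z2_def)
            then show ?thesis using Z0 by simp
          next
            case False
            then have sx: "snd x \<in> cball 0 (2 * R)" and ed: "ln r \<in> {p..p+1} \<or> ln r \<in> {q-1..q}" by auto
            have S0: "\<bar>S - 2 * \<mu> + 2\<bar> \<le> B0"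
            proof -
              define t where "t = r / (1 + r)"
              have t: "0 \<le> t" "t \<le> 1" using r by (auto simp: t_def)
              have st: "S = \<delta> * (1 - t) + \<delta>' * t" unfolding S_def c_slope_def t_def[symmetric] by (simp add: algebra_simps)
              have "0 \<le> \<delta> * (1 - t)" "\<delta> * (1 - t) \<le> \<delta>" "0 \<le> \<delta>' * t" "\<delta>' * t \<le> \<delta>'"
                using \<delta> t by (auto intro: mult_left_le)
              moreover have "0 \<le> \<mu>" "\<mu> \<le> \<delta> + \<delta>'" using \<delta> by (auto simp: \<mu>_def)
              ultimately show ?thesis unfolding st B0_def by (intro abs_combination_le)
            qed
            have Cz: "\<bar>z1\<bar> \<le> Cz" "\<bar>z2\<bar> \<le> Cz" using r\<zeta>[of "ln r"] by (auto simp: z1_def z2_def)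
            have Cz0: "0 \<le> Cz" using Cz(1) abs_ge_zero order_trans by blast
            have "\<bar>(S - 2 * \<mu> + 2) * z1\<bar> \<le> B0 * Cz" unfolding abs_mult using S0 Cz Cz0 by (intro mult_mono) auto
            then have "\<bar>(S - 2 * \<mu> + 2) * z1 + z2\<bar> \<le> \<bar>(B0 + 1) * Cz\<bar>" using Cz(2) by (simp add: distrib_right)
            then have b1: "((S - 2 * \<mu> + 2) * z1 + z2)\<^sup>2 \<le> ((B0 + 1) * Cz)\<^sup>2" by (simp add: abs_le_square_iff)
            have g2: "(g x)\<^sup>2 \<le> 1" using rg[of x] by (simp add: power_le_one)
            have "y1\<^sup>2 = ((S - 2 * \<mu> + 2) * z1 + z2)\<^sup>2 * ((P r)\<^sup>2 * (g x)\<^sup>2)"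
              by (simp add: y1_def power_mult_distrib)
            also have "\<dots> \<le> ((B0 + 1) * Cz)\<^sup>2 * (K0\<^sup>2 * r powr (- ?n) * 1)"
              using we(3) g2 b1 by (intro mult_mono) auto
            also have "\<dots> = ((B0 + 1) * Cz)\<^sup>2 * K0\<^sup>2 * r powr (- ?n)" by simp
            also have "\<dots> \<le> Z1 x" unfolding Z1_def
            proof (intro mult_left_mono)
              have rb: "r powr (- ?n) \<le> exp (- ?n * t) * I t (t + 2) x" if "ln r \<in> {t..t+1}" for t
              proof -
                have e: "exp t \<le> r" "r \<le> exp (t + 1)"
                  using that r by (metis atLeastAtMost_iff exp_le_cancel_iff exp_ln)+
                have "r < exp (t + 2)" using e(2) by (rule le_less_trans) simp
                then have "I t (t + 2) x = 1" using e(1) sx by (simp add: I_def sh_def mem_Times_iff r_def)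
                moreover have "r powr (- ?n) \<le> exp t powr (- ?n)" using e(1) by (intro powr_mono2') auto
                moreover have "exp t powr (- ?n) = exp (- ?n * t)" by (simp add: powr_def)
                ultimately show ?thesis by simp
              qed
              show "r powr (- ?n) \<le> exp (- ?n * p) * I p (p + 2) x + exp (- ?n * (q - 1)) * I (q - 1) (q - 1 + 2) x"
                using ed
              proof
                assume "ln r \<in> {p..p+1}"
                moreover have "0 \<le> exp (- ?n * (q - 1)) * I (q - 1) (q - 1 + 2) x" by (simp add: I0)
                ultimately show ?thesis using rb[of p] by linarith
              next
                assume "ln r \<in> {q-1..q}"
                then have "ln r \<in> {q-1..q-1+1}" by simp
                moreover have "0 \<le> exp (- ?n * p) * I p (p + 2) x" by (simp add: I0)
                ultimately show ?thesis using rb[of "q - 1"] by linarith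
              qed
            qed simp
            finally show ?thesis .
          qed
          moreover have "y2\<^sup>2 \<le> Z2 x"
          proof (cases "norm (snd x) > 2 * R")
            case True
            then have "y2 = 0" using gout[of x] by (simp add: y2_def \<Delta>_def)
            then show ?thesis using Z0 by simp
          next
            case False
            have "r \<le> exp q" using True r by (metis atLeastAtMost_iff exp_le_cancel_iff exp_ln)
            then have "r < exp (q + 1)" by (rule le_less_trans) simp
            then have I1: "I p (q + 1) x = 1" using rp False by (simp add: I_def sh_def mem_Times_iff r_def)
            \<comment> \<open>\<alpha> is positive, so the power is largest at the inner
              radius.\<close>
            have "r powr (- \<alpha>) \<le> exp p powr (- \<alpha>)" using rp \<alpha>0 by (intro powr_mono2') auto
            then have "r powr (- \<alpha>) \<le> exp (- \<alpha> * p)" by (simp add: powr_def)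
            then have "r powr (- \<alpha>) * \<zeta> (ln r) \<le> exp (- \<alpha> * p) * 1"
              using r\<zeta>[of "ln r"] by (intro mult_mono) auto
            then have "\<bar>F r\<bar> \<le> exp (- \<alpha> * p)" using r\<zeta>[of "ln r"] by (simp add: F_def)
            then have "\<bar>F r * \<Delta> x\<bar> \<le> exp (- \<alpha> * p) * (Ct / R\<^sup>2)"
              unfolding abs_mult using \<Delta>g[of x] by (intro mult_mono) (auto simp: \<Delta>_def)
            then have "\<bar>y2\<bar> \<le> C * (exp (- \<alpha> * p) * (Ct / R\<^sup>2))"
              unfolding y2_def abs_mult[of "\<beta> (fst x)"] using \<beta>_abs[of "fst x"] by (intro mult_mono) (auto intro: order_trans[OF abs_ge_zero])
            then have "\<bar>y2\<bar>\<^sup>2 \<le> (C * (exp (- \<alpha> * p) * (Ct / R\<^sup>2)))\<^sup>2" by (intro power_mono) auto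
            then show ?thesis by (simp add: Z2_def I1 mult.assoc)
          qed
          then have "(1 + 1 / \<theta>) * (2 * (y1\<^sup>2 + y2\<^sup>2)) \<le> (1 + 1 / \<theta>) * (2 * (Z1 x + Z2 x))"
            using \<open>y1\<^sup>2 \<le> Z1 x\<close> \<theta> by (intro mult_left_mono) auto
          ultimately show ?thesis by linarith
        qed
      qed
      have XX: "integrable lborel (\<lambda>x. X x * X x)" by (rule test_function_integrable[OF test_function_times[OF open_Omega X X]])
      define RHS where "RHS x = E * (X x)\<^sup>2 + (1 + 1 / \<theta>) * (2 * (Z1 x + Z2 x))" for x
      have RHSi: "integrable lborel RHS" unfolding RHS_def[abs_def]
        using XX Z1i(1) Z2i(1) by (simp add: power2_eq_square)
      have RHSz: "RHS x = 0" if "x \<notin> Omega" for x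
      proof -
        have "fst x = 0" using that by (simp add: Omega_iff)
        then have "I p q x = 0" for p q by (simp add: I_def sh_def mem_Times_iff)
        then show ?thesis using test_function_outside[OF X that] by (simp add: RHS_def Z1_def Z2_def)
      qed
      have RHSm: "RHS \<in> borel_measurable borel" using RHSi borel_measurable_integrable by fastforce
      have "l2_inner ?M L L = (\<integral>x. (L x)\<^sup>2 \<partial>?M)" by (simp add: l2_inner_def power2_eq_square)
      also have "\<dots> \<le> (\<integral>x. RHS x \<partial>?M)"
      proof (rule integral_mono)
        show "integrable ?M (\<lambda>x. (L x)\<^sup>2)" by (rule L2_integrable_square[OF LL])
        show "integrable ?M RHS" using integral_Omega(2)[OF RHSm RHSz] RHSi by simp
        show "(L x)\<^sup>2 \<le> RHS x" if "x \<in> space ?M" for x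
          using pt[of x] that by (simp add: RHS_def space_restrict_space)
      qed
      also have "\<dots> = (\<integral>x. RHS x \<partial>lborel)" by (rule integral_Omega(1)[OF RHSm RHSz])
      also have "\<dots> = E * Q + (1 + 1 / \<theta>) * (2 * ((c1 + c2 / R ^ 4) * R ^ ?m))"
        unfolding RHS_def Q_def using XX Z1i Z2i by (simp add: power2_eq_square distrib_right)
      finally have up: "a * Q \<le> E * Q + (1 + 1 / \<theta>) * (2 * ((c1 + c2 / R ^ 4) * R ^ ?m))" using aQ by simp
      have "1 / K0\<^sup>2 * real N * (V * (1 - exp (- ?n))) * (W * R ^ ?m) \<le> Q"
        unfolding Q_def V_def W_def
      proof (rule integral_ge_shells[OF XX])
        fix x :: "'a \<times> 'b"
        assume x: "exp (p + 1) \<le> norm (fst x)" "norm (fst x) < exp (p + 1 + real N)" "norm (snd x) \<le> R"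
        define r where "r = norm (fst x)"
        have r: "0 < r" using x(1) exp_gt_zero[of "p + 1"] unfolding r_def by linarith
        have l: "p + 1 \<le> ln r" "ln r \<le> p + 1 + real N"
          using x(1,2) r unfolding r_def[symmetric] by (metis exp_le_cancel_iff exp_ln less_imp_le)+
        have "\<zeta> (ln r) = 1" using l by (intro plateau_one) (auto simp: q_def)
        then have "X x * X x = (P r)\<^sup>2" unfolding Xeq r_def[symmetric] using gin[OF x(3)] by (simp add: power2_eq_square)
        moreover have win: "window_start \<delta> \<delta>' N \<le> ln r" "ln r \<le> window_start \<delta> \<delta>' N + real N + 2"
          using l by (auto simp: p_def)
        note we = window_estimates(2)[OF r win, of ?n, folded \<mu>_def, folded \<alpha>_def K0_def, folded P_def]
        ultimately show "1 / K0\<^sup>2 * norm (fst x) powr (- ?n) \<le> X x * X x" using we by (simp add: r_def)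
      qed (use R K0 in auto)
      then have "c3 * real N * R ^ ?m \<le> Q" unfolding c3_def by (simp add: mult_ac)
      with up show ?thesis by blast
    qed
    have fin: "a - E \<le> (1 + 1 / \<theta>) * (2 * c1 / c3) / real N"
    proof (cases "a \<le> E")
      case True
      have "0 \<le> c1" unfolding c1_def using VW by simp
      then have "0 \<le> (1 + 1 / \<theta>) * (2 * c1 / c3) / real N" using \<theta> c3 by simp
      then show ?thesis using True by linarith
    next
      case False
      \<comment> \<open>As a > E, the lower bound on \<open>Q\<close> may be inserted on the left,
        and R^d2 cancels.\<close>
      have b: "(a - E) * (c3 * real N) \<le> (1 + 1 / \<theta>) * (2 * (c1 + c2 / R ^ 4))" if R: "1 \<le> R" for R
      proof -
        obtain Q where Q: "c3 * real N * R ^ ?m \<le> Q" "a * Q \<le> E * Q + (1 + 1 / \<theta>) * (2 * ((c1 + c2 / R ^ 4) * R ^ ?m))"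
          using step[OF R] by blast
        have "(a - E) * (c3 * real N * R ^ ?m) \<le> (a - E) * Q" using Q(1) False by (intro mult_left_mono) auto
        also have "\<dots> \<le> (1 + 1 / \<theta>) * (2 * ((c1 + c2 / R ^ 4) * R ^ ?m))" using Q(2) by (simp add: left_diff_distrib)
        finally have "((a - E) * (c3 * real N)) * R ^ ?m \<le> ((1 + 1 / \<theta>) * (2 * (c1 + c2 / R ^ 4))) * R ^ ?m"
          by (simp only: mult.assoc)
        then show ?thesis using R by (simp add: mult_le_cancel_right)
      qed
      \<comment> \<open>R tends to infinity along the positive integers; N and \<theta> stay fixed,
        so \<open>c2\<close> is a constant.\<close>
      have "(\<lambda>i. inverse (real (Suc i))) \<longlonglongrightarrow> 0" by (rule LIMSEQ_inverse_real_of_nat)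
      then have "(\<lambda>i. (1 + 1 / \<theta>) * (2 * (c1 + c2 * inverse (real (Suc i)) ^ 4))) \<longlonglongrightarrow> (1 + 1 / \<theta>) * (2 * (c1 + c2 * 0 ^ 4))"
        by (intro tendsto_intros)
      moreover have "(a - E) * (c3 * real N) \<le> (1 + 1 / \<theta>) * (2 * (c1 + c2 * inverse (real (Suc i)) ^ 4))" for i
        using b[of "real (Suc i)"] by (simp add: divide_inverse power_inverse)
      ultimately have "(a - E) * (c3 * real N) \<le> (1 + 1 / \<theta>) * (2 * (c1 + c2 * 0 ^ 4))"
        by (intro LIMSEQ_le_const) auto
      then have "(a - E) * (c3 * real N) \<le> (1 + 1 / \<theta>) * (2 * c1)" by simp
      then have "a - E \<le> (1 + 1 / \<theta>) * (2 * c1) / (c3 * real N)" using c3 N by (subst pos_le_divide_eq) auto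
      then show ?thesis by simp
    qed
    then show ?thesis unfolding E_def by linarith
  qed
  then show ?thesis by (rule that)
qed

text \<open>First N tends to infinity at fixed \<theta>, which removes the slope error and the edge
  error; then \<theta> tends to 0.\<close>

theorem rellich_root_optimal:
  assumes A: "0 < rellich_root (real DIM('a)) \<delta> \<delta>'" and ineq: "rellich_inequality \<delta> \<delta>' H a"
  shows "a \<le> (rellich_root (real DIM('a)) \<delta> \<delta>')\<^sup>2"
proof -
  let ?A = "rellich_root (real DIM('a)) \<delta> \<delta>'"
  obtain T K where TK: "\<And>N \<theta>. 1 \<le> N \<Longrightarrow> 0 < \<theta> \<Longrightarrow>
    a \<le> (1 + \<theta>) * (?A + T * exp (- real N))\<^sup>2 + (1 + 1 / \<theta>) * K / real N"
    using optimality_estimate[OF A ineq] by blast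
  have 1: "a \<le> (1 + \<theta>) * ?A\<^sup>2" if \<theta>: "0 < \<theta>" for \<theta>
  proof -
    have e: "(\<lambda>N. exp (- real N)) \<longlonglongrightarrow> 0"
      by (rule filterlim_compose[OF exp_at_bot]) (simp add: filterlim_uminus_at_bot filterlim_real_sequentially)
    have i: "(\<lambda>N. inverse (real N)) \<longlonglongrightarrow> 0"
      by (rule tendsto_inverse_0_at_top[OF filterlim_real_sequentially])
    have "(\<lambda>N. (1 + \<theta>) * (?A + T * exp (- real N))\<^sup>2 + (1 + 1 / \<theta>) * K * inverse (real N))
        \<longlonglongrightarrow> (1 + \<theta>) * (?A + T * 0)\<^sup>2 + (1 + 1 / \<theta>) * K * 0"
      by (intro tendsto_intros e i)
    moreover have "\<exists>M. \<forall>N\<ge>M. a \<le> (1 + \<theta>) * (?A + T * exp (- real N))\<^sup>2 + (1 + 1 / \<theta>) * K * inverse (real N)"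
      using TK[OF _ \<theta>] by (intro exI[of _ 1]) (auto simp: divide_inverse)
    ultimately have "a \<le> (1 + \<theta>) * (?A + T * 0)\<^sup>2 + (1 + 1 / \<theta>) * K * 0" by (rule LIMSEQ_le_const)
    then show ?thesis by simp
  qed
  have "(\<lambda>i. (1 + inverse (real (Suc i))) * ?A\<^sup>2) \<longlonglongrightarrow> (1 + 0) * ?A\<^sup>2"
    by (intro tendsto_intros LIMSEQ_inverse_real_of_nat)
  then have "a \<le> (1 + 0) * ?A\<^sup>2" by (rule LIMSEQ_le_const) (use 1 in auto)
  then show ?thesis by simp
qed

end

section \<open>The theorem\<close>

lemma rellich_inequality_mono:
  assumes "rellich_inequality \<delta> \<delta>' H a" "a' \<le> a"
  shows "rellich_inequality \<delta> \<delta>' H a'"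
  using assms(1) unfolding rellich_inequality_def
  by (fastforce intro: order_trans[OF mult_right_mono[OF assms(2) l2_inner_self_nonneg]])

text \<open>For \<open>\<delta> + \<delta>' \<ge> 4\<close> the constant of the second part is at most that of the first: the difference of
  their square roots is \<open>\<bar>\<delta> - \<delta>'\<bar> (\<delta> + \<delta>' - 4) / 4\<close>.\<close>

lemma rellich_root_ge:
  assumes "4 \<le> \<delta> + \<delta>'"
  shows "(n - \<bar>\<delta> - \<delta>'\<bar>) * (n + \<delta> + \<delta>' - 4) / 4 \<le> rellich_root n \<delta> \<delta>'"
proof -
  define D where "D = \<bar>\<delta> - \<delta>'\<bar>"
  have s: "\<delta> + \<delta>' = 2 * min \<delta> \<delta>' + D" by (simp add: D_def)
  have "n * (n + 2 * m - 4) - (n - D) * (n + (2 * m + D) - 4) = D * (2 * m + D - 4)" for m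
    by (simp add: algebra_simps)
  moreover have "4 * rellich_root n \<delta> \<delta>' = n * (n + 2 * min \<delta> \<delta>' - 4)" by (simp add: rellich_root_def)
  ultimately have "4 * rellich_root n \<delta> \<delta>' - (n - D) * (n + (\<delta> + \<delta>') - 4) = D * (\<delta> + \<delta>' - 4)"
    unfolding s by simp
  also have "\<dots> \<ge> 0" using assms by (simp add: D_def)
  finally show ?thesis by (simp add: D_def add.assoc)
qed

theorem mainTheorem15:
  fixes \<delta> \<delta>' :: real
    and b :: "real ^ 'd1 \<Rightarrow> real"
    and H :: "(((real ^ 'd1) \<times> (real ^ 'd2) \<Rightarrow> real) \<times> ((real ^ 'd1) \<times> (real ^ 'd2) \<Rightarrow> real)) set"
  assumes "\<delta> \<ge> 0" and "\<delta>' \<ge> 0"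
    and "b \<in> borel_measurable (lebesgue_on (- {0}))"
    and "\<forall>y\<in>- {0}. 0 < b y"
    and "bounded (b ` (- {0}))"
    and "grushin_operator \<delta> \<delta>' b H"
  shows "(\<delta> + \<delta>' \<le> 4 \<and> real CARD('d1) + 2 * min \<delta> \<delta>' - 4 > 0 \<longrightarrow>
            (let a2 = (real CARD('d1))\<^sup>2 * (real CARD('d1) + 2 * min \<delta> \<delta>' - 4)\<^sup>2 / 16
             in rellich_inequality \<delta> \<delta>' H a2 \<and>
                (\<forall>a. rellich_inequality \<delta> \<delta>' H a \<longrightarrow> a \<le> a2))) \<and>
         (\<delta> + \<delta>' \<ge> 4 \<and> real CARD('d1) - \<bar>\<delta> - \<delta>'\<bar> > 0 \<longrightarrow>
            rellich_inequality \<delta> \<delta>' H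
              ((real CARD('d1) - \<bar>\<delta> - \<delta>'\<bar>)\<^sup>2 * (real CARD('d1) + \<delta> + \<delta>' - 4)\<^sup>2 / 16))"
proof -
  let ?n = "real CARD('d1)" and ?A = "rellich_root (real CARD('d1)) \<delta> \<delta>'"
  obtain \<beta> C where \<beta>: "bounded_coefficient \<beta> C"
    "\<And>u :: (real ^ 'd1) \<times> (real ^ 'd2) \<Rightarrow> real. u \<in> test_functions Omega \<Longrightarrow> grushin_form \<delta> \<delta>' b u = grushin_form \<delta> \<delta>' \<beta> u"
    using bounded_borel_version[OF assms(3-5)] by blast
  \<comment> \<open>The closure sees the form only on test functions, where \<open>b\<close> and its
    Borel version give equal values.\<close>
  have "grushin_operator \<delta> \<delta>' \<beta> H"
    using assms(6) unfolding grushin_operator_def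
    by (subst (asm) form_closure_cong[OF test_function_diff[OF open_Omega] \<beta>(2)])
  then interpret grushin \<beta> C \<delta> \<delta>' H
    using \<beta>(1) assms(1,2) by (simp add: grushin_def grushin_axioms_def)
  have n1: "1 \<le> ?n" by (simp add: Suc_leI)
  have ineq: "rellich_inequality \<delta> \<delta>' H (?A\<^sup>2)" if "0 < ?A"
    using rellich_inequality_root that by simp
  have opt: "a \<le> ?A\<^sup>2" if "0 < ?A" "rellich_inequality \<delta> \<delta>' H a" for a
    using rellich_root_optimal[of a] that by simp
  have a: "?n\<^sup>2 * (?n + 2 * min \<delta> \<delta>' - 4)\<^sup>2 / 16 = ?A\<^sup>2"
    by (simp add: rellich_root_def power_mult_distrib power_divide)
  have "rellich_inequality \<delta> \<delta>' H ((?n - \<bar>\<delta> - \<delta>'\<bar>)\<^sup>2 * (?n + \<delta> + \<delta>' - 4)\<^sup>2 / 16)"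
    if h: "4 \<le> \<delta> + \<delta>'" "?n - \<bar>\<delta> - \<delta>'\<bar> > 0"
  proof -
    let ?B = "(?n - \<bar>\<delta> - \<delta>'\<bar>) * (?n + \<delta> + \<delta>' - 4) / 4"
    \<comment> \<open>n + \<delta> + \<delta>' - 4 is at least n, so \<open>?B\<close> is positive,
      and with it the root \<open>?A\<close>.\<close>
    have B: "0 < ?B" using h n1 by (intro divide_pos_pos mult_pos_pos) auto
    have le: "?B \<le> ?A" by (rule rellich_root_ge[OF h(1)])
    have "?B\<^sup>2 \<le> ?A\<^sup>2" using B le by (intro power_mono) auto
    then have "rellich_inequality \<delta> \<delta>' H (?B\<^sup>2)"
      using B le by (intro rellich_inequality_mono[OF ineq]) auto
    then show ?thesis by (simp add: power_mult_distrib power_divide)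
  qed
  moreover have "0 < ?A" if "?n + 2 * min \<delta> \<delta>' - 4 > 0"
    using that n1 by (simp add: rellich_root_def)
  ultimately show ?thesis unfolding Let_def a using ineq opt by blast
qed

end
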